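(* Let $V$ be a discrete valuation ring with quotient field $F$, let $K/F$ be a finite Galois extension with group $G$, let $S$ be the integral closure of $V$ in $K$, and assume $S$ is unramified over $V$. Let $f\in Z^2(G,K\setminus\{0\})$ be a normalized two-cocycle with $f(G\times G)\subseteq S\setminus\{0\}$, and let $A_f=\sum_{\sigma\in G}Sx_\sigma$ be the associated crossed-product order in $\Sigma_f$. Suppose $A_f$ is primary. Then $A_f$ is a maximal order (that is, a maximal $V$-order in $\Sigma_f$) if and only if there exists a maximal ideal $M$ of $S$ such that $f(\tau,\tau^{-1})\notin M^2$ for all $\tau\in D_M$.
   Context: A normalized two-cocycle is a map $f:G\times G\to K\setminus\{0\}$ with $\sigma(f(\tau,\gamma))\,f(\sigma,\tau\gamma)=f(\sigma,\tau)\,f(\sigma\tau,\gamma)$ and $f(1,\sigma)=f(\sigma,1)=1$ for all $\sigma,\tau,\gamma\in G$. It is not required that the values of $f$ be units of $S$. The crossed-product algebra is $\Sigma_f=(K/F,G,f)=\bigoplus_{\sigma\in G}Kx_\sigma$, with multiplication determined by $x_\sigma a=\sigma(a)x_\sigma$ ($a\in K$) and $x_\sigma x_\tau=f(\sigma,\tau)x_{\sigma\tau}$. The crossed-product order is the subring $A_f=\bigoplus_{\sigma\in G}Sx_\sigma$ of $\Sigma_f$; it is a $V$-order in $\Sigma_f$ with identity $1=x_1$. "Unramified" has its standard meaning: every maximal ideal of $S$ has ramification index $1$ over $V$ (so $J(V)S=J(S)$) and separable residue field extension. $J(R)$ denotes the Jacobson radical of a ring $R$. The order $A_f$ is primary if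 $J(A_f)$ is a maximal two-sided ideal of $A_f$ (equivalently, $A_f/J(A_f)$ is a simple Artinian ring). For a maximal ideal $M$ of $S$, $D_M=\{\sigma\in G\mid \sigma(M)=M\}$ is the decomposition group of $M$. *)

theory Defs
  imports "HOL-Algebra.Algebra" "HOL-Algebra.Algebraic_Closure_Type"
begin

section \<open>Subrings of a field\<close>

text \<open>The ambient field is a type \<open>'k\<close> of class \<open>field\<close>, seen as a HOL-Algebra ring through
  \<^const>\<open>ring_of_type_algebra\<close>. Its subrings and subfields are subsets of \<open>'k\<close>.\<close>

abbreviation ring_on :: "'k::field set \<Rightarrow> 'k ring"
  where "ring_on S \<equiv> ring_of_type_algebra\<lparr>carrier := S\<rparr>"

definition quotient_field :: "'k::field set \<Rightarrow> 'k set"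
  where "quotient_field V = {a / b | a b. a \<in> V \<and> b \<in> V \<and> b \<noteq> 0}"

definition discrete_valuation_ring :: "('a, 'b) ring_scheme \<Rightarrow> bool"
  where "discrete_valuation_ring R \<longleftrightarrow>
    principal_domain R \<and> \<not> field R \<and> (\<exists>!M. maximalideal M R)"

definition integral_closure :: "('a, 'b) ring_scheme \<Rightarrow> 'a set \<Rightarrow> 'a set"
  where "integral_closure R V =
    {x \<in> carrier R. \<exists>p \<in> carrier (univ_poly R V).
        p \<noteq> [] \<and> hd p = \<one>\<^bsub>R\<^esub> \<and> ring.eval R p x = \<zero>\<^bsub>R\<^esub>}"

section \<open>Galois extensions\<close>

definition Gal :: "'k::field set \<Rightarrow> ('k \<Rightarrow> 'k) set"
  where "Gal F = {\<sigma> \<in> ring_iso ring_of_type_algebra ring_of_type_algebra. \<forall>x\<in>F. \<sigma> x = x}"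

definition finite_galois :: "'k::field set \<Rightarrow> bool"
  where "finite_galois F \<longleftrightarrow>
    subfield F ring_of_type_algebra \<and>
    ring.finite_dimension ring_of_type_algebra F UNIV \<and>
    {x. \<forall>\<sigma>\<in>Gal F. \<sigma> x = x} = F"

section \<open>Unramified extensions\<close>

text \<open>Polynomials are coefficient lists with the leading coefficient first.\<close>

definition formal_derivative :: "('a, 'b) ring_scheme \<Rightarrow> 'a list \<Rightarrow> 'a list"
  where "formal_derivative R p =
    ring.normalize R (map (\<lambda>i. add_pow R (length p - 1 - i) (p ! i)) [0..<length p - 1])"

definition separable_poly :: "('a, 'b) ring_scheme \<Rightarrow> 'a set \<Rightarrow> 'a list \<Rightarrow> bool"
  where "separable_poly L k p \<longleftrightarrow>
    (\<exists>u \<in> carrier (univ_poly L k). \<exists>v \<in> carrier (univ_poly L k).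
      u \<otimes>\<^bsub>univ_poly L k\<^esub> p \<oplus>\<^bsub>univ_poly L k\<^esub> v \<otimes>\<^bsub>univ_poly L k\<^esub> formal_derivative L p
        = \<one>\<^bsub>univ_poly L k\<^esub>)"

definition separable_extension :: "('a, 'b) ring_scheme \<Rightarrow> 'a set \<Rightarrow> bool"
  where "separable_extension L k \<longleftrightarrow>
    (\<forall>x \<in> carrier L. \<not> ring.transcendental L k x \<and> separable_poly L k (ring.Irr L k x))"

abbreviation ideal_power :: "('a, 'b) ring_scheme \<Rightarrow> 'a set \<Rightarrow> nat \<Rightarrow> 'a set"
  where "ideal_power R I n \<equiv> I [^]\<^bsub>ideals_set R\<^esub> n"

definition ramification_index :: "('a, 'b) ring_scheme \<Rightarrow> 'a set \<Rightarrow> 'a set \<Rightarrow> nat"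
  where "ramification_index S V M = (GREATEST e. genideal S (M \<inter> V) \<subseteq> ideal_power S M e)"

text \<open>The residue field of \<open>V\<close> at \<open>M \<inter> V\<close> enters as its image in \<open>S/M\<close>.\<close>

definition unramified :: "('a, 'b) ring_scheme \<Rightarrow> 'a set \<Rightarrow> bool"
  where "unramified S V \<longleftrightarrow>
    (\<forall>M. maximalideal M S \<longrightarrow>
      ramification_index S V M = 1 \<and>
      separable_extension (S Quot M) ((\<lambda>v. M +>\<^bsub>S\<^esub> v) ` V))"

section \<open>Orders\<close>

definition left_ideal :: "'a set \<Rightarrow> ('a, 'b) ring_scheme \<Rightarrow> bool"
  where "left_ideal I R \<longleftrightarrow>
    additive_subgroup I R \<and> (\<forall>r \<in> carrier R. \<forall>a \<in> I. r \<otimes>\<^bsub>R\<^esub> a \<in> I)"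

definition maximal_left_ideal :: "'a set \<Rightarrow> ('a, 'b) ring_scheme \<Rightarrow> bool"
  where "maximal_left_ideal I R \<longleftrightarrow>
    left_ideal I R \<and> I \<noteq> carrier R \<and>
    (\<forall>J. left_ideal J R \<and> I \<subseteq> J \<longrightarrow> J = I \<or> J = carrier R)"

definition jacobson_radical :: "('a, 'b) ring_scheme \<Rightarrow> 'a set"
  where "jacobson_radical R = carrier R \<inter> \<Inter>{I. maximal_left_ideal I R}"

definition primary :: "('a, 'b) ring_scheme \<Rightarrow> bool"
  where "primary R \<longleftrightarrow> maximalideal (jacobson_radical R) R"

text \<open>For subrings \<open>V \<subseteq> F\<close> of the centre of \<open>R\<close>, with \<open>F\<close> the quotient field of \<open>V\<close>:
  \<open>A\<close> is a subring of \<open>R\<close> that contains \<open>V\<close>, is finitely generated as a \<open>V\<close>-module and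
  spans \<open>R\<close> over \<open>F\<close>. Here \<open>ring.Span R V Us\<close> is the set of combinations of the list \<open>Us\<close>
  with coefficients in \<open>V\<close>; its definition does not need \<open>V\<close> to be a field.\<close>

definition is_order :: "('a, 'b) ring_scheme \<Rightarrow> 'a set \<Rightarrow> 'a set \<Rightarrow> 'a set \<Rightarrow> bool"
  where "is_order R V F A \<longleftrightarrow>
    subring A R \<and> V \<subseteq> A \<and>
    (\<exists>Us. set Us \<subseteq> A \<and> A = ring.Span R V Us) \<and>
    (\<forall>x \<in> carrier R. \<exists>Us. set Us \<subseteq> A \<and> x \<in> ring.Span R F Us)"

definition maximal_order :: "('a, 'b) ring_scheme \<Rightarrow> 'a set \<Rightarrow> 'a set \<Rightarrow> 'a set \<Rightarrow> bool"
  where "maximal_order R V F A \<longleftrightarrow>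
    is_order R V F A \<and> (\<forall>B. is_order R V F B \<and> A \<subseteq> B \<longrightarrow> B = A)"

section \<open>Crossed products\<close>

definition normalized_cocycle ::
    "('k::field \<Rightarrow> 'k) set \<Rightarrow> (('k \<Rightarrow> 'k) \<Rightarrow> ('k \<Rightarrow> 'k) \<Rightarrow> 'k) \<Rightarrow> bool"
  where "normalized_cocycle G f \<longleftrightarrow>
    (\<forall>\<sigma>\<in>G. \<forall>\<tau>\<in>G. f \<sigma> \<tau> \<noteq> 0) \<and>
    (\<forall>\<sigma>\<in>G. \<forall>\<tau>\<in>G. \<forall>\<gamma>\<in>G. \<sigma> (f \<tau> \<gamma>) * f \<sigma> (\<tau> \<circ> \<gamma>) = f \<sigma> \<tau> * f (\<sigma> \<circ> \<tau>) \<gamma>) \<and>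
    (\<forall>\<sigma>\<in>G. f id \<sigma> = 1 \<and> f \<sigma> id = 1)"

text \<open>The element \<open>\<Sum>\<sigma>\<in>G. a\<^sub>\<sigma> x\<^sub>\<sigma>\<close> is represented by its coefficient function, extended by \<open>0\<close>
  outside \<open>G\<close>. The product comes from \<open>(a x\<^sub>\<sigma>) (b x\<^sub>\<tau>) = a \<sigma>(b) f(\<sigma>,\<tau>) x\<^bsub>\<sigma>\<tau>\<^esub>\<close>.\<close>

definition crossed_product ::
    "('k::field \<Rightarrow> 'k) set \<Rightarrow> (('k \<Rightarrow> 'k) \<Rightarrow> ('k \<Rightarrow> 'k) \<Rightarrow> 'k) \<Rightarrow> (('k \<Rightarrow> 'k) \<Rightarrow> 'k) ring"
  where "crossed_product G f =
    \<lparr>carrier = {a. \<forall>\<sigma>. \<sigma> \<notin> G \<longrightarrow> a \<sigma> = 0},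
     monoid.mult = (\<lambda>a b \<rho>. \<Sum>(\<sigma>, \<tau>) \<in> {(\<sigma>, \<tau>). \<sigma> \<in> G \<and> \<tau> \<in> G \<and> \<sigma> \<circ> \<tau> = \<rho>}. a \<sigma> * \<sigma> (b \<tau>) * f \<sigma> \<tau>),
     monoid.one = (\<lambda>\<sigma>. if \<sigma> = id then 1 else 0),
     ring.zero = (\<lambda>\<sigma>. 0),
     ring.add = (\<lambda>a b \<sigma>. a \<sigma> + b \<sigma>)\<rparr>"

definition crossed_product_order ::
    "('k::field \<Rightarrow> 'k) set \<Rightarrow> (('k \<Rightarrow> 'k) \<Rightarrow> ('k \<Rightarrow> 'k) \<Rightarrow> 'k) \<Rightarrow> 'k set \<Rightarrow> (('k \<Rightarrow> 'k) \<Rightarrow> 'k) set"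
  where "crossed_product_order G f S = {a \<in> carrier (crossed_product G f). \<forall>\<sigma>\<in>G. a \<sigma> \<in> S}"

text \<open>The embedding \<open>c \<mapsto> c x\<^sub>1\<close>.\<close>

definition cp_scalar :: "'k::field \<Rightarrow> ('k \<Rightarrow> 'k) \<Rightarrow> 'k"
  where "cp_scalar c = (\<lambda>\<sigma>. if \<sigma> = id then c else 0)"

definition decomposition_group :: "('k \<Rightarrow> 'k) set \<Rightarrow> 'k set \<Rightarrow> ('k \<Rightarrow> 'k) set"
  where "decomposition_group G M = {\<sigma> \<in> G. \<sigma> ` M = M}"

end

theory Submission
  imports Defs
begin

text \<open>Let \<open>\<pi>\<close> be a uniformizer of \<open>V\<close>. Since \<open>S\<close> is unramified, the intersection of its maximal
  ideals is \<open>\<pi> S\<close>, its localizations are discrete valuation rings with uniformizer \<open>\<pi>\<close>, and all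
  inertia groups are trivial. The latter yields elements of \<open>S \<otimes> S\<close> which act on \<open>K x\<^sub>\<sigma>\<close> as
  the identity and on the other components as \<open>0\<close>, so every order containing \<open>A\<^sub>f\<close> is graded.

  If \<open>f(\<tau>,\<tau>\<^sup>-\<^sup>1) \<in> M\<^sup>2\<close> for some \<open>M\<close> and \<open>\<tau>\<close>, choose such a \<open>\<tau>\<close> maximal for the preorder
  \<open>f(\<sigma>,\<sigma>\<^sup>-\<^sup>1\<tau>) \<notin> M\<close>. Then some \<open>b x\<^sub>\<tau>\<close> with \<open>b\<close> of value \<open>-1\<close> at \<open>M\<close> lies in the left order
  of the ideal \<open>\<Sum>\<sigma>. I\<^sub>\<sigma> x\<^sub>\<sigma>\<close>, where \<open>I\<^sub>\<sigma>\<close> is the product of all \<open>M\<close> with \<open>f(\<sigma>,\<sigma>\<^sup>-\<^sup>1) \<notin> M\<close>.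
  Hence \<open>A\<^sub>f\<close> is not maximal.

  Conversely, let \<open>b x\<^sub>\<sigma>\<close> belong to an order \<open>B \<supseteq> A\<^sub>f\<close> with \<open>b\<close> not integral at \<open>M'\<close>. Primarity means
  that any two maximal ideals of \<open>S\<close> are linked by some \<open>\<sigma>\<close> with \<open>x\<^sub>\<sigma>\<close> locally invertible. Multiplying
  by such elements moves the pole to \<open>M\<close> and \<open>\<sigma>\<close> into \<open>D\<^sub>M\<close>. The \<open>n\<close>-th power of \<open>b x\<^sub>\<sigma>\<close>
  then has value at most \<open>-n + (n - 1)\<close> at \<open>M\<close>, which for \<open>n\<close> the order of \<open>\<sigma>\<close> contradicts the
  integrality of the identity component of \<open>B\<close>.\<close>

text \<open>The exponent 2 is a balance of costs. A coefficient \<open>b\<close> of value -1 loses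
  one at \<open>M\<close>, and landing in a component of the radical that is invertible at
  \<open>M\<close> requires one more; a cocycle value of at least 2 pays for both. With values at
  most 1, a product of two homogeneous elements can at best make good the loss of one of them.

  One object serves twice, the function on G that is 1 at the identity and 0 elsewhere. As an
  element of K \<otimes> K it yields a nonzero trace, bounded products and finite generation of S
  over V. As an element of S \<otimes> S, available once inertia is trivial, it yields the grading
  of the larger orders.

  The radical P of S is compared with \<pi> S through the fractional ideal P^-1. G permutes the
  maximal ideals transitively, so a G-stable ideal is S or lies in P. This is applied to P^-1 P and
  to \<pi> P^-1.

  A condition at a single M suffices because locally invertible \<open>x_\<sigma>\<close> carry a
  pole from one maximal ideal to another without changing its value.\<close>

abbreviation finv :: "('a \<Rightarrow> 'a) \<Rightarrow> 'a \<Rightarrow> 'a"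
  where "finv \<equiv> inv_into UNIV"

text \<open>\<open>unif_nonunit\<close> and \<open>V_cases\<close> are the elementary form of a
  discrete valuation ring with uniformizer \<pi>. \<open>fixed_iff\<close> says that the fixed field
  of G is the quotient field of V, so that the base field can be recovered from G.\<close>

locale dvr_galois =
  fixes V :: "'k::field set" and \<pi> :: 'k and G :: "('k \<Rightarrow> 'k) set"
  assumes V_one: "1 \<in> V"
    and V_diff: "\<lbrakk>x \<in> V; y \<in> V\<rbrakk> \<Longrightarrow> x - y \<in> V"
    and V_mult: "\<lbrakk>x \<in> V; y \<in> V\<rbrakk> \<Longrightarrow> x * y \<in> V"
    and unif_in_V: "\<pi> \<in> V"
    and unif_nonzero: "\<pi> \<noteq> 0"
    and unif_nonunit: "inverse \<pi> \<notin> V"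
    and V_cases: "\<lbrakk>x \<in> V; x \<noteq> 0\<rbrakk> \<Longrightarrow> \<exists>n u. u \<in> V \<and> inverse u \<in> V \<and> x = \<pi> ^ n * u"
    and finite_G: "finite G"
    and id_in_G: "id \<in> G"
    and comp_in_G: "\<lbrakk>\<sigma> \<in> G; \<tau> \<in> G\<rbrakk> \<Longrightarrow> \<sigma> \<circ> \<tau> \<in> G"
    and inv_in_G: "\<sigma> \<in> G \<Longrightarrow> finv \<sigma> \<in> G"
    and bij_G: "\<sigma> \<in> G \<Longrightarrow> bij \<sigma>"
    and G_add: "\<sigma> \<in> G \<Longrightarrow> \<sigma> (x + y) = \<sigma> x + \<sigma> y"
    and G_mult: "\<sigma> \<in> G \<Longrightarrow> \<sigma> (x * y) = \<sigma> x * \<sigma> y"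
    and fixed_iff: "(\<forall>\<sigma>\<in>G. \<sigma> x = x) \<longleftrightarrow> (\<exists>a\<in>V. \<exists>b\<in>V. b \<noteq> 0 \<and> x = a / b)"
begin

lemma V_zero: "0 \<in> V"
  using V_diff[OF V_one V_one] by simp

lemma V_minus: "x \<in> V \<Longrightarrow> - x \<in> V"
  using V_diff[OF V_zero] by fastforce

lemma V_add: "\<lbrakk>x \<in> V; y \<in> V\<rbrakk> \<Longrightarrow> x + y \<in> V"
  using V_diff[of x "- y"] V_minus by simp

lemma V_power: "x \<in> V \<Longrightarrow> x ^ n \<in> V"
  by (induction n) (auto intro: V_one V_mult)

lemma V_sum: "(\<And>i. i \<in> I \<Longrightarrow> g i \<in> V) \<Longrightarrow> sum g I \<in> V"
  by (induction I rule: infinite_finite_induct) (auto intro: V_zero V_add)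

lemma V_of_nat: "of_nat n \<in> V"
  by (induction n) (auto intro: V_zero V_one V_add)

lemma unif_power_in_V: "\<pi> ^ n \<in> V"
  by (rule V_power[OF unif_in_V])

subsection \<open>The group action\<close>

lemma G_zero: "\<sigma> \<in> G \<Longrightarrow> \<sigma> 0 = 0"
  by (metis G_add add_cancel_left_left add.right_neutral)

lemma G_inv_apply: "\<sigma> \<in> G \<Longrightarrow> finv \<sigma> (\<sigma> x) = x"
  by (simp add: bij_G bij_is_inj)

lemma G_apply_inv: "\<sigma> \<in> G \<Longrightarrow> \<sigma> (finv \<sigma> x) = x"
  by (simp add: bij_G bij_is_surj surj_f_inv_f)

lemma G_inv_comp: "\<sigma> \<in> G \<Longrightarrow> finv \<sigma> \<circ> \<sigma> = id"
  by (simp add: bij_G bij_is_inj)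

lemma G_comp_inv: "\<sigma> \<in> G \<Longrightarrow> \<sigma> \<circ> finv \<sigma> = id"
  by (simp add: G_apply_inv fun_eq_iff)

lemma G_inv_inv: "\<sigma> \<in> G \<Longrightarrow> finv (finv \<sigma>) = \<sigma>"
  by (simp add: bij_G inv_inv_eq)

lemma G_eq_zero_iff: "\<sigma> \<in> G \<Longrightarrow> \<sigma> x = 0 \<longleftrightarrow> x = 0"
  by (metis G_zero G_inv_apply)

lemma G_one:
  assumes "\<sigma> \<in> G"
  shows "\<sigma> 1 = 1"
proof -
  have "\<sigma> 1 * \<sigma> 1 = \<sigma> 1 * 1"
    using G_mult[OF assms, of 1 1] by simp
  then show ?thesis
    using G_eq_zero_iff[OF assms, of 1] by simp
qed

lemma G_minus: "\<sigma> \<in> G \<Longrightarrow> \<sigma> (- x) = - \<sigma> x"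
  by (metis G_add G_zero add.right_inverse minus_unique)

lemma G_inverse:
  assumes "\<sigma> \<in> G"
  shows "\<sigma> (inverse x) = inverse (\<sigma> x)"
proof (cases "x = 0")
  case False
  then have "\<sigma> x * \<sigma> (inverse x) = 1"
    by (metis G_mult G_one assms right_inverse)
  then show ?thesis
    by (metis inverse_unique)
qed (simp add: G_zero assms)

lemma G_divide: "\<sigma> \<in> G \<Longrightarrow> \<sigma> (x / y) = \<sigma> x / \<sigma> y"
  by (simp add: divide_inverse G_mult G_inverse)

lemma G_power: "\<sigma> \<in> G \<Longrightarrow> \<sigma> (x ^ n) = \<sigma> x ^ n"
  by (induction n) (simp_all add: G_one G_mult)

lemma G_power_int: "\<sigma> \<in> G \<Longrightarrow> \<sigma> (x powi n) = \<sigma> x powi n"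
  by (simp add: power_int_def G_power G_inverse)

lemma G_sum: "\<sigma> \<in> G \<Longrightarrow> \<sigma> (sum g I) = (\<Sum>i\<in>I. \<sigma> (g i))"
  by (induction I rule: infinite_finite_induct) (simp_all add: G_zero G_add)

lemma G_prod: "\<sigma> \<in> G \<Longrightarrow> \<sigma> (prod g I) = (\<Prod>i\<in>I. \<sigma> (g i))"
  by (induction I rule: infinite_finite_induct) (simp_all add: G_one G_mult)

lemma G_V: "\<lbrakk>\<sigma> \<in> G; x \<in> V\<rbrakk> \<Longrightarrow> \<sigma> x = x"
  using fixed_iff[of x] V_one by force

lemma G_unif: "\<sigma> \<in> G \<Longrightarrow> \<sigma> \<pi> = \<pi>"
  by (rule G_V[OF _ unif_in_V])

lemma bij_betw_comp_left: "\<sigma> \<in> G \<Longrightarrow> bij_betw ((\<circ>) \<sigma>) G G"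
  by (rule bij_betw_byWitness[where f' = "(\<circ>) (finv \<sigma>)"])
    (auto simp: comp_assoc[symmetric] G_inv_comp G_comp_inv comp_in_G inv_in_G)

lemma bij_betw_comp_right: "\<sigma> \<in> G \<Longrightarrow> bij_betw (\<lambda>\<tau>. \<tau> \<circ> \<sigma>) G G"
  by (rule bij_betw_byWitness[where f' = "\<lambda>\<tau>. \<tau> \<circ> finv \<sigma>"])
    (auto simp: comp_assoc G_inv_comp G_comp_inv comp_in_G inv_in_G)

section \<open>The fixed field and the trace\<close>

definition F :: "'k set"
  where "F = {x. \<forall>\<sigma>\<in>G. \<sigma> x = x}"

lemma G_F: "\<lbrakk>\<sigma> \<in> G; x \<in> F\<rbrakk> \<Longrightarrow> \<sigma> x = x"
  by (simp add: F_def)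

lemma V_in_F: "x \<in> V \<Longrightarrow> x \<in> F"
  by (simp add: F_def G_V)

lemma F_cases:
  assumes "x \<in> F"
  obtains n where "\<pi> ^ n * x \<in> V"
proof -
  obtain a b where ab: "a \<in> V" "b \<in> V" "b \<noteq> 0" "x = a / b"
    using assms fixed_iff[of x] by (auto simp: F_def)
  obtain n u where u: "inverse u \<in> V" "b = \<pi> ^ n * u"
    using V_cases[of b] ab by blast
  have "\<pi> ^ n * x = a * inverse u"
    using ab u by (auto simp: field_simps)
  then show ?thesis
    using that ab u by (metis V_mult)
qed

lemma F_finite_scale:
  assumes "finite I" "\<And>i. i \<in> I \<Longrightarrow> g i \<in> F"
  shows "\<exists>k. \<forall>i\<in>I. \<pi> ^ k * g i \<in> V"
  using assms
proof (induction I rule: finite_induct)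
  case (insert i I)
  then obtain k where k: "\<forall>i\<in>I. \<pi> ^ k * g i \<in> V"
    by auto
  obtain n where n: "\<pi> ^ n * g i \<in> V"
    using F_cases insert.prems by blast
  have "\<pi> ^ (n + k) * g j \<in> V" if "j \<in> insert i I" for j
    using that k V_mult[OF unif_power_in_V n, of k] V_mult[OF unif_power_in_V, of "\<pi> ^ k * g j" n]
    by (auto simp: power_add algebra_simps)
  then show ?case
    by blast
qed simp

text \<open>V is completely integrally closed: a negative value of x is multiplied by n in
  \<open>x ^ n\<close> and outgrows the fixed k.\<close>

lemma power_bounded_in_V:
  assumes "x \<in> F" "\<And>n. \<pi> ^ k * x ^ n \<in> V"
  shows "x \<in> V"
proof (rule ccontr)
  assume x: "x \<notin> V"
  obtain m where m: "\<pi> ^ m * x \<in> V"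
    using F_cases assms(1) by blast
  have "x \<noteq> 0"
    using x V_zero by blast
  then obtain j u where u: "u \<in> V" "inverse u \<in> V" "\<pi> ^ m * x = \<pi> ^ j * u"
    using V_cases[OF m] unif_nonzero by auto
  have "j < m"
  proof (rule ccontr)
    assume "\<not> j < m"
    then have "x = \<pi> ^ (j - m) * u"
      using u(3) unif_nonzero by (simp add: power_diff field_simps)
    then show False
      using x u V_mult unif_power_in_V by blast
  qed
  define d where "d = m - j - 1"
  have "m = Suc d + j"
    using \<open>j < m\<close> by (simp add: d_def)
  then have xu: "x * \<pi> ^ Suc d = u"
    using u(3) unif_nonzero by (simp add: power_add field_simps)
  \<comment> \<open>Here x has value -(d + 1). With exponent k + 1 the element
    \<open>\<pi> ^ k * x ^ ?n\<close> has value k - (d + 1)(k + 1), which the factor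
    \<open>\<pi> ^ (d * ?n)\<close> raises to exactly -1.\<close>
  let ?n = "Suc k"
  have "\<pi> ^ (d * ?n) * (\<pi> ^ k * x ^ ?n * inverse u ^ ?n) \<in> V"
    by (rule V_mult[OF unif_power_in_V V_mult[OF assms(2) V_power[OF u(2)]]])
  also have "\<pi> ^ (d * ?n) * (\<pi> ^ k * x ^ ?n * inverse u ^ ?n) = inverse \<pi>"
  proof -
    have "u ^ ?n = x ^ ?n * (\<pi> ^ (d * ?n) * \<pi> ^ ?n)"
      by (simp only: xu[symmetric] power_mult_distrib power_mult[symmetric] power_add[symmetric]) (simp add: algebra_simps)
    moreover have "u \<noteq> 0"
      using xu unif_nonzero \<open>x \<noteq> 0\<close> by auto
    ultimately show ?thesis
      using unif_nonzero \<open>x \<noteq> 0\<close> by (simp add: power_inverse field_simps)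
  qed
  finally show False
    using unif_nonunit by simp
qed

definition Tr :: "'k \<Rightarrow> 'k"
  where "Tr x = (\<Sum>\<sigma>\<in>G. \<sigma> x)"

lemma Tr_add: "Tr (x + y) = Tr x + Tr y"
  by (simp add: Tr_def G_add sum.distrib)

lemma Tr_zero: "Tr 0 = 0"
  by (simp add: Tr_def G_zero)

lemma Tr_sum: "Tr (sum g I) = (\<Sum>i\<in>I. Tr (g i))"
  by (induction I rule: infinite_finite_induct) (simp_all add: Tr_add Tr_zero)

lemma Tr_apply: "\<sigma> \<in> G \<Longrightarrow> Tr (\<sigma> x) = Tr x"
  unfolding Tr_def
  using sum.reindex_bij_betw[OF bij_betw_comp_right, of \<sigma> "\<lambda>\<tau>. \<tau> x"] by simp

lemma apply_sum_G: "\<sigma> \<in> G \<Longrightarrow> \<sigma> (\<Sum>\<tau>\<in>G. \<tau> x) = (\<Sum>\<tau>\<in>G. \<tau> x)"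
  using sum.reindex_bij_betw[OF bij_betw_comp_left, of \<sigma> "\<lambda>\<tau>. \<tau> x"] by (simp add: G_sum)

lemma Tr_in_F: "Tr x \<in> F"
  by (simp add: Tr_def F_def apply_sum_G)

lemma Tr_F_mult: "c \<in> F \<Longrightarrow> Tr (c * x) = c * Tr x"
  by (simp add: Tr_def G_mult G_F sum_distrib_left)

subsection \<open>Separability functions\<close>

text \<open>The functions on \<open>G\<close> induced by the elements \<open>\<Sum>i. a\<^sub>i \<otimes> b\<^sub>i\<close> of \<open>R \<otimes> R\<close>.\<close>

inductive_set E :: "'k set \<Rightarrow> (('k \<Rightarrow> 'k) \<Rightarrow> 'k) set" for R
  where
    zero: "(\<And>\<rho>. \<rho> \<in> G \<Longrightarrow> h \<rho> = 0) \<Longrightarrow> h \<in> E R"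
  | step: "\<lbrakk>g \<in> E R; a \<in> R; b \<in> R; \<And>\<rho>. \<rho> \<in> G \<Longrightarrow> h \<rho> = a * \<rho> b + g \<rho>\<rbrakk> \<Longrightarrow> h \<in> E R"

lemma E_cong:
  assumes "g \<in> E R" "\<And>\<rho>. \<rho> \<in> G \<Longrightarrow> h \<rho> = g \<rho>"
  shows "h \<in> E R"
  using assms by (cases rule: E.cases) (auto intro: E.intros)

lemma E_add:
  assumes "g \<in> E R" "h \<in> E R"
  shows "(\<lambda>\<rho>. g \<rho> + h \<rho>) \<in> E R"
  using assms(1)
proof (induction rule: E.induct)
  case (zero g)
  then show ?case
    using E_cong[OF assms(2)] by simp
next
  case (step g a b g')
  then show ?case
    by (auto intro!: E.step[OF step.IH, of a b])
qed

lemma E_monomial_mult: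
  assumes R: "\<And>x y. \<lbrakk>x \<in> R; y \<in> R\<rbrakk> \<Longrightarrow> x * y \<in> R"
    and "h \<in> E R" "a \<in> R" "b \<in> R"
  shows "(\<lambda>\<rho>. a * \<rho> b * h \<rho>) \<in> E R"
  using assms(2)
proof (induction rule: E.induct)
  case (step g a' b' h)
  show ?case
    by (rule E.step[OF step.IH, of "a * a'" "b * b'"])
      (use step assms in \<open>auto simp: algebra_simps G_mult\<close>)
qed (simp add: E.zero)

lemma E_mult:
  assumes R: "\<And>x y. \<lbrakk>x \<in> R; y \<in> R\<rbrakk> \<Longrightarrow> x * y \<in> R"
    and "g \<in> E R" "h \<in> E R"
  shows "(\<lambda>\<rho>. g \<rho> * h \<rho>) \<in> E R"
  using assms(2)
proof (induction rule: E.induct)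
  case (step g a b g')
  show ?case
    by (rule E_cong[OF E_add[OF E_monomial_mult[OF R assms(3) step.hyps(2,3)] step.IH]])
      (use step in \<open>auto simp: algebra_simps\<close>)
qed (simp add: E.zero)

lemma E_monomial: "\<lbrakk>a \<in> R; b \<in> R; \<And>\<rho>. \<rho> \<in> G \<Longrightarrow> h \<rho> = a * \<rho> b\<rbrakk> \<Longrightarrow> h \<in> E R"
  by (rule E.step[OF E.zero, of "\<lambda>_. 0"]) auto

definition \<delta> :: "('k \<Rightarrow> 'k) \<Rightarrow> ('k \<Rightarrow> 'k) \<Rightarrow> 'k"
  where "\<delta> \<sigma> \<rho> = (if \<rho> = \<sigma> then 1 else 0)"

text \<open>Interpolation: the product over all \<sigma> other than the identity of functions that
  are 1 at the identity and 0 at \<sigma>.\<close>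

lemma delta_in_E:
  assumes one: "1 \<in> R" and R: "\<And>x y. \<lbrakk>x \<in> R; y \<in> R\<rbrakk> \<Longrightarrow> x * y \<in> R"
    and sep: "\<And>\<sigma>. \<lbrakk>\<sigma> \<in> G; \<sigma> \<noteq> id\<rbrakk> \<Longrightarrow> \<exists>g \<in> E R. g id = 1 \<and> g \<sigma> = 0"
  shows "\<delta> id \<in> E R"
proof -
  have "\<exists>g \<in> E R. g id = 1 \<and> (\<forall>\<sigma>\<in>H. g \<sigma> = 0)" if "finite H" "H \<subseteq> G - {id}" for H
    using that
  proof (induction H rule: finite_induct)
    case empty
    have "(\<lambda>_. 1) \<in> E R"
      by (rule E_monomial[OF one one]) (simp add: G_one)
    then show ?case
      by auto
  next
    case (insert \<sigma> H)
    obtain g where "g \<in> E R" "g id = 1" "\<forall>\<sigma>\<in>H. g \<sigma> = 0"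
      using insert.IH insert.prems by blast
    moreover obtain h where "h \<in> E R" "h id = 1" "h \<sigma> = 0"
      using insert.prems sep[of \<sigma>] by blast
    ultimately show ?case
      by (intro bexI[OF _ E_mult[OF R, of g h]]) (auto simp only: mult_1_right mult_zero_left mult_zero_right)
  qed
  then obtain g where "g \<in> E R" "g id = 1" "\<forall>\<sigma>\<in>G - {id}. g \<sigma> = 0"
    using finite_G by (meson finite_Diff order_refl)
  then show ?thesis
    by (intro E_cong[OF \<open>g \<in> E R\<close>]) (auto simp: \<delta>_def)
qed

text \<open>Replacing each right tensor factor b by \<open>finv \<sigma> b\<close> shifts the
  argument from \<rho> to \<open>\<rho> \<circ> finv \<sigma>\<close>.\<close>

lemma delta_translate:
  assumes "\<delta> id \<in> E R" "\<sigma> \<in> G" and R: "\<And>x. x \<in> R \<Longrightarrow> finv \<sigma> x \<in> R"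
  shows "\<delta> \<sigma> \<in> E R"
proof -
  have *: "(\<lambda>\<rho>. g (\<rho> \<circ> finv \<sigma>)) \<in> E R" if "g \<in> E R" for g
    using that
  proof (induction rule: E.induct)
    case (zero h)
    show ?case
      by (rule E.zero) (rule zero[OF comp_in_G[OF _ inv_in_G[OF assms(2)]]])
  next
    case (step g a b h)
    show ?case
      by (rule E.step[OF step.IH step.hyps(2) R[OF step.hyps(3)]])
        (use step.hyps(4)[OF comp_in_G[OF _ inv_in_G[OF assms(2)]]] in \<open>simp add: comp_def\<close>)
  qed
  have "\<rho> \<circ> finv \<sigma> = id \<longleftrightarrow> \<rho> = \<sigma>" for \<rho>
    using assms(2) by (metis G_comp_inv G_inv_comp comp_assoc comp_id id_comp)
  then show ?thesis
    using *[OF assms(1)] by (simp add: \<delta>_def[abs_def])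
qed

text \<open>If \<sigma> moves y, then (\<rho> y - \<sigma> y) / (y - \<sigma> y), as a function of
  \<rho>, separates the identity from \<sigma>. This is the splitting of K \<otimes> K into copies
  of K, and it takes the place of linear independence of characters.\<close>

lemma delta_in_E_UNIV: "\<delta> id \<in> E UNIV"
proof (rule delta_in_E)
  fix \<sigma>
  assume "\<sigma> \<in> G" "\<sigma> \<noteq> id"
  then obtain y where y: "\<sigma> y \<noteq> y"
    by (auto simp: fun_eq_iff)
  define c where "c = inverse (y - \<sigma> y)"
  have "(\<lambda>\<rho>. c * \<rho> y + (- c * \<sigma> y) * \<rho> 1) \<in> E UNIV"
    by (intro E_add E_monomial[where R = UNIV, OF UNIV_I UNIV_I]) (rule refl)+
  moreover have "c * id y + (- c * \<sigma> y) * id 1 = c * (y - \<sigma> y)"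
    by (simp add: algebra_simps)
  ultimately show "\<exists>g \<in> E UNIV. g id = 1 \<and> g \<sigma> = 0"
    using y by (intro bexI[where x = "\<lambda>\<rho>. c * \<rho> y + (- c * \<sigma> y) * \<rho> 1"])
      (simp_all add: c_def G_one \<open>\<sigma> \<in> G\<close>)
qed auto

text \<open>Summation over G turns the function of a \<otimes> b into a Tr(b), while
  \<open>\<delta> id\<close> has sum 1.\<close>

lemma Tr_nonzero: "\<exists>b. Tr b \<noteq> 0"
proof (rule ccontr)
  assume *: "\<nexists>b. Tr b \<noteq> 0"
  have "(\<Sum>\<rho>\<in>G. g \<rho>) = 0" if "g \<in> E UNIV" for g
    using that
  proof (induction rule: E.induct)
    case (step g a b h)
    then have "(\<Sum>\<rho>\<in>G. h \<rho>) = a * Tr b"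
      by (simp add: sum.distrib Tr_def sum_distrib_left)
    then show ?case
      using * by simp
  qed simp
  then have "(\<Sum>\<rho>\<in>G. \<delta> id \<rho>) = 0"
    using delta_in_E_UNIV by blast
  moreover have "(\<Sum>\<rho>\<in>G. \<delta> id \<rho>) = 1"
    using finite_G id_in_G by (simp add: \<delta>_def)
  ultimately show False
    by simp
qed

subsection \<open>Bounded sets\<close>

text \<open>Every F-linear form on K is Tr(b x) for some b, so this says that the coordinates of Z
  have bounded denominators. Phrased by traces, it is available before S is known to be a
  ring.\<close>

definition bdd :: "'k set \<Rightarrow> bool"
  where "bdd Z \<longleftrightarrow> (\<forall>b. \<exists>k. \<forall>x\<in>Z. \<pi> ^ k * Tr (b * x) \<in> V)"

lemma V_scale_mono: "\<lbrakk>\<pi> ^ k * x \<in> V; k \<le> l\<rbrakk> \<Longrightarrow> \<pi> ^ l * x \<in> V"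
  using V_mult[OF unif_power_in_V, of "\<pi> ^ k * x" "l - k"]
  by (simp add: mult.assoc[symmetric] power_add[symmetric])

lemma bdd_subset: "\<lbrakk>bdd Z; Y \<subseteq> Z\<rbrakk> \<Longrightarrow> bdd Y"
  unfolding bdd_def by (meson subsetD)

lemma bdd_singleton: "bdd {x}"
  unfolding bdd_def using F_cases[OF Tr_in_F] by (metis singletonD)

lemma bdd_insert:
  assumes "bdd Z"
  shows "bdd (insert x Z)"
  unfolding bdd_def
proof
  fix b
  obtain k l where "\<forall>x\<in>Z. \<pi> ^ k * Tr (b * x) \<in> V" "\<pi> ^ l * Tr (b * x) \<in> V"
    using assms bdd_singleton[of x] unfolding bdd_def by blast
  then have "\<forall>y\<in>insert x Z. \<pi> ^ (max k l) * Tr (b * y) \<in> V"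
    by (auto intro: V_scale_mono)
  then show "\<exists>k. \<forall>y\<in>insert x Z. \<pi> ^ k * Tr (b * y) \<in> V"
    by blast
qed

lemma bdd_finite: "finite Z \<Longrightarrow> bdd Z"
  by (induction Z rule: finite_induct) (rule bdd_subset[OF bdd_singleton], simp, rule bdd_insert)

lemma bdd_apply:
  assumes "bdd Z" "\<sigma> \<in> G"
  shows "bdd (\<sigma> ` Z)"
proof -
  have "Tr (b * \<sigma> x) = Tr (finv \<sigma> b * x)" for b x
    using Tr_apply[OF assms(2), of "finv \<sigma> b * x"] assms(2) by (simp add: G_mult G_apply_inv)
  then show ?thesis
    using assms(1) by (auto simp: bdd_def)
qed

lemma bdd_scale: "bdd Z \<Longrightarrow> bdd ((*) c ` Z)"
  unfolding bdd_def by (simp add: mult.assoc[symmetric])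

text \<open>With \<open>\<delta> id = \<Sum>i. a\<^sub>i \<otimes> b\<^sub>i\<close> one has \<open>Tr (y x) = \<Sum>i. Tr (y a\<^sub>i) Tr (b\<^sub>i x)\<close>.\<close>

lemma bdd_mult:
  assumes "bdd Z" "bdd Y"
  shows "bdd {x * y | x y. x \<in> Z \<and> y \<in> Y}"
proof -
  \<comment> \<open>\<Phi> is additive in g. The function of a \<otimes> b contributes Tr(y a) Tr(b
    x), whereas \<open>\<delta> id\<close> keeps only the diagonal \<sigma> = \<tau> and leaves Tr(y
    x). In the bound, c is the test element from the definition of \<open>bdd\<close>.\<close>
  define \<Phi> where "\<Phi> g y x = (\<Sum>\<sigma>\<in>G. \<Sum>\<tau>\<in>G. \<sigma> y * \<tau> x * \<sigma> (g (finv \<sigma> \<circ> \<tau>)))" for g y x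
  have in_G: "finv \<sigma> \<circ> \<tau> \<in> G" if "\<sigma> \<in> G" "\<tau> \<in> G" for \<sigma> \<tau>
    using that by (simp add: comp_in_G inv_in_G)
  have bound: "\<exists>k. \<forall>x\<in>Z. \<forall>y\<in>Y. \<pi> ^ k * \<Phi> g (c * y) x \<in> V" if "g \<in> E UNIV" for g c
    using that
  proof (induction rule: E.induct)
    case (zero h)
    then have "\<Phi> h y x = 0" for x y
      by (simp add: \<Phi>_def in_G G_zero)
    then show ?case
      by (auto intro: V_zero)
  next
    case (step g a b h)
    obtain k where k: "\<And>x y. x \<in> Z \<Longrightarrow> y \<in> Y \<Longrightarrow> \<pi> ^ k * \<Phi> g (c * y) x \<in> V"
      using step.IH by blast
    obtain l where l: "\<And>y. y \<in> Y \<Longrightarrow> \<pi> ^ l * Tr ((c * a) * y) \<in> V"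
      using assms(2) unfolding bdd_def by blast
    obtain m where m: "\<And>x. x \<in> Z \<Longrightarrow> \<pi> ^ m * Tr (b * x) \<in> V"
      using assms(1) unfolding bdd_def by blast
    have eq: "\<Phi> h y x = Tr (y * a) * Tr (b * x) + \<Phi> g y x" for x y
    proof -
      have "\<Phi> h y x = (\<Sum>\<sigma>\<in>G. \<Sum>\<tau>\<in>G. \<sigma> (y * a) * \<tau> (b * x) + \<sigma> y * \<tau> x * \<sigma> (g (finv \<sigma> \<circ> \<tau>)))"
        unfolding \<Phi>_def
        by (intro sum.cong refl)
          (simp add: step.hyps(4) in_G G_add G_mult G_apply_inv algebra_simps)
      then show ?thesis
        by (simp add: sum.distrib Tr_def sum_product \<Phi>_def)
    qed
    have "\<pi> ^ (k + l + m) * \<Phi> h (c * y) x \<in> V" if "x \<in> Z" "y \<in> Y" for x y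
    proof -
      have "\<pi> ^ (k + l + m) * \<Phi> h (c * y) x =
          \<pi> ^ k * ((\<pi> ^ l * Tr ((c * a) * y)) * (\<pi> ^ m * Tr (b * x))) + \<pi> ^ (l + m) * (\<pi> ^ k * \<Phi> g (c * y) x)"
        by (simp add: eq power_add algebra_simps)
      then show ?thesis
        using k[OF that] l[OF that(2)] m[OF that(1)]
        by (simp add: V_add V_mult unif_power_in_V)
    qed
    then show ?case
      by blast
  qed
  have "\<Phi> (\<delta> id) y x = Tr (y * x)" for x y
  proof -
    have "finv \<sigma> \<circ> \<tau> = id \<longleftrightarrow> \<tau> = \<sigma>" if "\<sigma> \<in> G" "\<tau> \<in> G" for \<sigma> \<tau>
      using that by (metis G_comp_inv G_inv_comp comp_assoc comp_id id_comp)
    then have "\<Phi> (\<delta> id) y x = (\<Sum>\<sigma>\<in>G. \<Sum>\<tau>\<in>G. if \<tau> = \<sigma> then \<sigma> y * \<tau> x else 0)"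
      unfolding \<Phi>_def by (intro sum.cong refl) (auto simp: \<delta>_def G_one G_zero)
    then show ?thesis
      by (simp add: finite_G Tr_def G_mult)
  qed
  then show ?thesis
    using bound[OF delta_in_E_UNIV] unfolding bdd_def
    by (simp add: mult.assoc) (metis mult.assoc mult.commute)
qed

section \<open>The integral closure of V\<close>

definition S :: "'k set"
  where "S = {x. \<exists>p. Polynomial.lead_coeff p = 1 \<and> (\<forall>i. Polynomial.coeff p i \<in> V) \<and> poly p x = 0}"

text \<open>Equivalent to integrality, see \<open>S_iff\<close>. In this form closure under sums,
  products and G follows from \<open>bdd_mult\<close> and \<open>bdd_apply\<close>.\<close>

definition power_bdd :: "'k \<Rightarrow> bool"
  where "power_bdd x \<longleftrightarrow> bdd (range (\<lambda>n. x ^ n))"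

text \<open>A monic equation of degree d writes every power as a V-combination of the first d
  powers, so the denominators of those finitely many traces bound all the others.\<close>

lemma integral_imp_power_bdd:
  assumes "x \<in> S"
  shows "power_bdd x"
  unfolding power_bdd_def bdd_def
proof
  fix b
  obtain p where p: "Polynomial.lead_coeff p = 1" "\<And>i. Polynomial.coeff p i \<in> V" "poly p x = 0"
    using assms unfolding S_def by blast
  define d where "d = Polynomial.degree p"
  have xd: "x ^ d = - (\<Sum>i<d. Polynomial.coeff p i * x ^ i)"
    using p(1,3) unfolding poly_altdef d_def[symmetric] lessThan_Suc_atMost[symmetric]
    by (simp add: eq_neg_iff_add_eq_0 add.commute)
  obtain k where k: "\<forall>y \<in> (\<lambda>n. x ^ n) ` {..<d}. \<pi> ^ k * Tr (b * y) \<in> V"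
    using bdd_finite[of "(\<lambda>n. x ^ n) ` {..<d}"] unfolding bdd_def by blast
  have "\<pi> ^ k * Tr (b * x ^ n) \<in> V" for n
  proof (induction n rule: less_induct)
    case (less n)
    show ?case
    proof (cases "n < d")
      case True
      then show ?thesis
        using k by blast
    next
      case False
      then have "x ^ n = x ^ d * x ^ (n - d)"
        by (simp add: power_add[symmetric])
      also have "\<dots> = (\<Sum>i<d. - Polynomial.coeff p i * x ^ (i + (n - d)))"
        by (simp add: xd sum_distrib_right sum_negf[symmetric] power_add mult.assoc)
      finally have "Tr (b * x ^ n) = (\<Sum>i<d. Tr (- Polynomial.coeff p i * (b * x ^ (i + (n - d)))))"
        by (simp add: sum_distrib_left Tr_sum[symmetric] algebra_simps)
      also have "\<dots> = (\<Sum>i<d. - Polynomial.coeff p i * Tr (b * x ^ (i + (n - d))))"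
        by (intro sum.cong refl Tr_F_mult V_in_F V_minus p)
      finally have "\<pi> ^ k * Tr (b * x ^ n) =
          (\<Sum>i<d. - Polynomial.coeff p i * (\<pi> ^ k * Tr (b * x ^ (i + (n - d)))))"
        by (simp add: sum_distrib_left algebra_simps)
      also have "\<dots> \<in> V"
        using False by (intro V_sum V_mult V_minus p less) auto
      finally show ?thesis .
    qed
  qed
  then show "\<exists>k. \<forall>y\<in>range (\<lambda>n. x ^ n). \<pi> ^ k * Tr (b * y) \<in> V"
    by blast
qed

lemma power_bdd_mult:
  assumes "power_bdd x" "power_bdd y"
  shows "power_bdd (x * y)"
  using bdd_mult[OF assms[unfolded power_bdd_def]] unfolding power_bdd_def
  by (rule bdd_subset) (auto simp: power_mult_distrib)

text \<open>The binomial expansion has coefficients in V, and the products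
  \<open>x ^ i * y ^ j\<close> form a bounded set by \<open>bdd_mult\<close>.\<close>

lemma power_bdd_add:
  assumes "power_bdd x" "power_bdd y"
  shows "power_bdd (x + y)"
  unfolding power_bdd_def bdd_def
proof
  fix b
  obtain k where k: "\<And>i j. \<pi> ^ k * Tr (b * (x ^ i * y ^ j)) \<in> V"
    using bdd_mult[OF assms[unfolded power_bdd_def]] unfolding bdd_def by blast
  have "\<pi> ^ k * Tr (b * (x + y) ^ n) \<in> V" for n
  proof -
    have "Tr (b * (x + y) ^ n) = (\<Sum>i\<le>n. Tr (of_nat (n choose i) * (b * (x ^ i * y ^ (n - i)))))"
      by (simp add: binomial_ring sum_distrib_left Tr_sum[symmetric] algebra_simps)
    also have "\<dots> = (\<Sum>i\<le>n. of_nat (n choose i) * Tr (b * (x ^ i * y ^ (n - i))))"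
      by (intro sum.cong refl Tr_F_mult V_in_F V_of_nat)
    finally have "\<pi> ^ k * Tr (b * (x + y) ^ n) =
        (\<Sum>i\<le>n. of_nat (n choose i) * (\<pi> ^ k * Tr (b * (x ^ i * y ^ (n - i)))))"
      by (simp add: sum_distrib_left algebra_simps)
    also have "\<dots> \<in> V"
      by (intro V_sum V_mult V_of_nat k)
    finally show ?thesis .
  qed
  then show "\<exists>k. \<forall>z\<in>range (\<lambda>n. (x + y) ^ n). \<pi> ^ k * Tr (b * z) \<in> V"
    by blast
qed

lemma power_bdd_apply: "\<lbrakk>power_bdd x; \<sigma> \<in> G\<rbrakk> \<Longrightarrow> power_bdd (\<sigma> x)"
  unfolding power_bdd_def using bdd_apply[of "range (\<lambda>n. x ^ n)" \<sigma>]
  by (simp add: image_image G_power)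

text \<open>For x in F the trace Tr(b x^n) is x^n Tr(b). With Tr(b) nonzero, the bound on traces
  becomes a bound on the powers themselves.\<close>

lemma power_bdd_F:
  assumes "x \<in> F" "power_bdd x"
  shows "x \<in> V"
proof -
  obtain b where b: "Tr b \<noteq> 0"
    using Tr_nonzero by blast
  obtain k where k: "\<And>n. \<pi> ^ k * Tr (b * x ^ n) \<in> V"
    using assms(2) unfolding power_bdd_def bdd_def by blast
  obtain m where m: "\<pi> ^ m * inverse (Tr b) \<in> V"
    using F_cases[of "inverse (Tr b)"] Tr_in_F[of b] by (auto simp: F_def G_inverse Ball_def)
  have "\<pi> ^ (m + k) * x ^ n \<in> V" for n
  proof -
    have "x ^ n \<in> F"
      using assms(1) unfolding F_def by (simp, metis G_power)
    then have "Tr (b * x ^ n) = x ^ n * Tr b"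
      using Tr_F_mult[of "x ^ n" b] by (simp add: mult.commute)
    then have "\<pi> ^ (m + k) * x ^ n = (\<pi> ^ m * inverse (Tr b)) * (\<pi> ^ k * Tr (b * x ^ n))"
      using b by (simp add: power_add)
    then show ?thesis
      using k m V_mult by simp
  qed
  then show ?thesis
    by (rule power_bounded_in_V[OF assms(1)])
qed

section \<open>Characteristic polynomials\<close>

definition char_poly :: "'k \<Rightarrow> 'k poly"
  where "char_poly x = (\<Prod>\<sigma>\<in>G. [:- \<sigma> x, 1:])"

lemma map_poly_G_mult:
  assumes "\<sigma> \<in> G"
  shows "map_poly \<sigma> (p * q) = map_poly \<sigma> p * map_poly \<sigma> q"
  by (rule poly_eqI)
    (simp add: coeff_map_poly G_zero assms Polynomial.coeff_mult G_sum G_mult)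

lemma map_poly_G_prod:
  assumes "\<sigma> \<in> G"
  shows "map_poly \<sigma> (prod g I) = (\<Prod>i\<in>I. map_poly \<sigma> (g i))"
  by (induction I rule: infinite_finite_induct)
    (simp_all add: map_poly_G_mult assms G_one map_poly_1)

lemma coeff_char_poly_in_F: "Polynomial.coeff (char_poly x) i \<in> F"
proof -
  have "\<sigma> (Polynomial.coeff (char_poly x) i) = Polynomial.coeff (char_poly x) i"
    if "\<sigma> \<in> G" for \<sigma>
  proof -
    have "map_poly \<sigma> (char_poly x) = (\<Prod>\<tau>\<in>G. [:- (\<sigma> \<circ> \<tau>) x, 1:])"
      unfolding char_poly_def map_poly_G_prod[OF that]
      by (intro prod.cong refl) (simp add: map_poly_pCons G_zero G_one G_minus that)
    also have "\<dots> = char_poly x"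
      unfolding char_poly_def
      by (rule prod.reindex_bij_betw[OF bij_betw_comp_left[OF that], of "\<lambda>\<tau>. [:- \<tau> x, 1:]"])
    finally show ?thesis
      by (metis G_zero coeff_map_poly that)
  qed
  then show ?thesis
    by (simp add: F_def)
qed

lemma degree_char_poly: "Polynomial.degree (char_poly x) = card G"
  unfolding char_poly_def by (subst degree_prod_eq_sum_degree) auto

lemma lead_coeff_char_poly: "Polynomial.lead_coeff (char_poly x) = 1"
  unfolding char_poly_def by (simp add: lead_coeff_prod)

lemma poly_char_poly: "poly (char_poly x) x = 0"
  unfolding char_poly_def poly_prod using finite_G id_in_G by (auto intro!: prod_zero bexI[of _ id])

text \<open>I need not contain 1, so that the lemma covers the radical P as well as the ring of
  power-bounded elements. The induction therefore subtracts the leading 1 from the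
  coefficients.\<close>

lemma coeff_char_poly:
  assumes zero: "0 \<in> I" and add: "\<And>x y. \<lbrakk>x \<in> I; y \<in> I\<rbrakk> \<Longrightarrow> x + y \<in> I"
    and minus: "\<And>x. x \<in> I \<Longrightarrow> - x \<in> I"
    and mult: "\<And>x y. \<lbrakk>x \<in> I; y \<in> I\<rbrakk> \<Longrightarrow> x * y \<in> I"
    and x: "\<And>\<sigma>. \<sigma> \<in> G \<Longrightarrow> \<sigma> x \<in> I"
    and i: "i < card G"
  shows "Polynomial.coeff (char_poly x) i \<in> I"
proof -
  have "\<forall>i. Polynomial.coeff (\<Prod>\<sigma>\<in>H. [:- \<sigma> x, 1:]) i - (if i = card H then 1 else 0) \<in> I"
    if "finite H" "H \<subseteq> G" for H
    using that
  proof (induction H rule: finite_induct)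
    case (insert \<sigma> H)
    let ?p = "\<Prod>\<sigma>\<in>H. [:- \<sigma> x, 1:]"
    define r where "r i = Polynomial.coeff ?p i - (if i = card H then 1 else 0)" for i
    have r: "r i \<in> I" for i
      using insert by (simp add: r_def)
    have p: "Polynomial.coeff ?p i = r i + (if i = card H then 1 else 0)" for i
      by (simp add: r_def)
    have sx: "- \<sigma> x \<in> I"
      using insert.prems minus x by auto
    have "Polynomial.coeff ([:- \<sigma> x, 1:] * ?p) i - (if i = Suc (card H) then 1 else 0)
        = - \<sigma> x * r i + (if i = card H then - \<sigma> x else 0) + (if i = 0 then 0 else r (i - 1))" for i
      using p by (cases i) (auto simp: coeff_pCons algebra_simps)
    moreover have "- \<sigma> x * r i + (if i = card H then - \<sigma> x else 0) + (if i = 0 then 0 else r (i - 1)) \<in> I" for i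
      by (intro add mult sx r) (simp_all add: zero sx r)
    ultimately have "Polynomial.coeff ([:- \<sigma> x, 1:] * ?p) i - (if i = Suc (card H) then 1 else 0) \<in> I" for i
      by simp
    then show ?case
      using insert by simp
  qed (auto simp: zero)
  from this[OF finite_G order_refl, rule_format, of i] show ?thesis
    using i by (simp add: char_poly_def)
qed

lemma power_bdd_V: "x \<in> V \<Longrightarrow> power_bdd x"
  by (rule integral_imp_power_bdd)
    (auto simp: S_def V_minus V_zero V_one coeff_pCons split: nat.split intro!: exI[of _ "[:- x, 1:]"])

text \<open>The coefficients of the characteristic polynomial are G-invariant and power-bounded,
  hence in V by \<open>power_bdd_F\<close>.\<close>

lemma power_bdd_imp_integral:
  assumes "power_bdd x"
  shows "x \<in> S"
proof -
  have "power_bdd (- 1)" "power_bdd 0"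
    using V_one V_minus V_zero by (blast intro: power_bdd_V)+
  then have minus: "power_bdd (- y)" if "power_bdd y" for y
    using power_bdd_mult[OF _ that, of "- 1"] by simp
  have "Polynomial.coeff (char_poly x) i \<in> {x. power_bdd x}" if "i < card G" for i
    by (rule coeff_char_poly[OF _ _ _ _ _ that])
      (use assms \<open>power_bdd 0\<close> in \<open>auto intro: power_bdd_add power_bdd_mult minus power_bdd_apply\<close>)
  then have "Polynomial.coeff (char_poly x) i \<in> V" for i
    using lead_coeff_char_poly[of x]
    by (cases i "card G" rule: linorder_cases)
      (auto intro: power_bdd_F coeff_char_poly_in_F V_one V_zero simp: degree_char_poly coeff_eq_0)
  then show ?thesis
    unfolding S_def using lead_coeff_char_poly poly_char_poly by blast
qed

lemma S_iff: "x \<in> S \<longleftrightarrow> power_bdd x"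
  using integral_imp_power_bdd power_bdd_imp_integral by blast

lemma V_in_S: "x \<in> V \<Longrightarrow> x \<in> S"
  by (simp add: S_iff power_bdd_V)

lemma S_zero: "0 \<in> S"
  by (rule V_in_S[OF V_zero])

lemma S_one: "1 \<in> S"
  by (rule V_in_S[OF V_one])

lemma S_unif: "\<pi> \<in> S"
  by (rule V_in_S[OF unif_in_V])

lemma S_add: "\<lbrakk>x \<in> S; y \<in> S\<rbrakk> \<Longrightarrow> x + y \<in> S"
  by (simp add: S_iff power_bdd_add)

lemma S_mult: "\<lbrakk>x \<in> S; y \<in> S\<rbrakk> \<Longrightarrow> x * y \<in> S"
  by (simp add: S_iff power_bdd_mult)

lemma S_minus: "x \<in> S \<Longrightarrow> - x \<in> S"
  using S_mult[OF V_in_S[OF V_minus[OF V_one]]] by fastforce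

lemma S_diff: "\<lbrakk>x \<in> S; y \<in> S\<rbrakk> \<Longrightarrow> x - y \<in> S"
  using S_add[of x "- y"] S_minus by simp

lemma S_power: "x \<in> S \<Longrightarrow> x ^ n \<in> S"
  by (induction n) (auto intro: S_one S_mult)

lemma S_sum: "(\<And>i. i \<in> I \<Longrightarrow> g i \<in> S) \<Longrightarrow> sum g I \<in> S"
  by (induction I rule: infinite_finite_induct) (auto intro: S_zero S_add)

lemma S_prod: "(\<And>i. i \<in> I \<Longrightarrow> g i \<in> S) \<Longrightarrow> prod g I \<in> S"
  by (induction I rule: infinite_finite_induct) (auto intro: S_one S_mult)

lemma S_apply: "\<lbrakk>x \<in> S; \<sigma> \<in> G\<rbrakk> \<Longrightarrow> \<sigma> x \<in> S"
  by (simp add: S_iff power_bdd_apply)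

lemma S_F: "\<lbrakk>x \<in> S; x \<in> F\<rbrakk> \<Longrightarrow> x \<in> V"
  by (simp add: S_iff power_bdd_F)

lemma S_scale:
  obtains k where "\<pi> ^ k * x \<in> S"
proof -
  obtain k where k: "\<forall>i\<in>{..card G}. \<pi> ^ k * Polynomial.coeff (char_poly x) i \<in> V"
    using F_finite_scale[of "{..card G}"] coeff_char_poly_in_F by blast
  define p where "p = (\<Prod>\<sigma>\<in>G. [:- \<sigma> (\<pi> ^ k * x), 1:])"
  let ?c = "Polynomial.coeff (char_poly x)"
  \<comment> \<open>With n = \<open>card G\<close>, this is the polynomial \<pi>^(kn) \<chi>(X /
    \<pi>^k), where \<chi> is \<open>char_poly x\<close>. Below the leading term at least one factor
    \<pi>^k is present, which is what clears the denominator of the coefficient.\<close>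
  define q where "q = (\<Sum>i\<le>card G. Polynomial.monom (\<pi> ^ (k * (card G - i)) * ?c i) i)"
  have cG: "?c (card G) = 1"
    using lead_coeff_char_poly[of x] by (simp add: degree_char_poly)
  have coeff_q: "Polynomial.coeff q i = (if i \<le> card G then \<pi> ^ (k * (card G - i)) * ?c i else 0)" for i
    by (simp add: q_def coeff_sum)
  have "Polynomial.degree q = card G"
    by (rule antisym, rule degree_le, simp add: coeff_q, rule le_degree, simp add: coeff_q cG)
  then have "Polynomial.lead_coeff q = 1"
    by (simp add: coeff_q cG)
  moreover have "Polynomial.coeff q i \<in> V" for i
  proof (cases "i < card G")
    case True
    then have "k * (card G - i) = k * (card G - i - 1) + k"
      by (cases "card G - i") auto
    then have "Polynomial.coeff q i = \<pi> ^ (k * (card G - i - 1)) * (\<pi> ^ k * ?c i)"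
      using True by (simp add: coeff_q power_add mult.assoc)
    moreover have "\<pi> ^ k * ?c i \<in> V"
      using k True by simp
    ultimately show ?thesis
      using V_mult[OF unif_power_in_V] by simp
  qed (auto simp: coeff_q cG V_zero V_one)
  moreover have "poly q (\<pi> ^ k * x) = 0"
  proof -
    have "poly q (\<pi> ^ k * x) = (\<Sum>i\<le>card G. \<pi> ^ (k * (card G - i)) * ?c i * (\<pi> ^ (k * i) * x ^ i))"
      by (simp add: q_def poly_sum poly_monom power_mult_distrib power_mult)
    also have "\<dots> = (\<Sum>i\<le>card G. \<pi> ^ (k * card G) * (?c i * x ^ i))"
    proof (intro sum.cong refl)
      fix i
      assume "i \<in> {..card G}"
      then have "k * card G = k * (card G - i) + k * i"
        by (simp add: diff_mult_distrib2)
      then show "\<pi> ^ (k * (card G - i)) * ?c i * (\<pi> ^ (k * i) * x ^ i) = \<pi> ^ (k * card G) * (?c i * x ^ i)"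
        by (simp add: power_add)
    qed
    also have "\<dots> = \<pi> ^ (k * card G) * poly (char_poly x) x"
      by (simp add: poly_altdef degree_char_poly sum_distrib_left)
    finally show ?thesis
      by (simp add: poly_char_poly)
  qed
  ultimately have "\<pi> ^ k * x \<in> S"
    unfolding S_def by blast
  then show ?thesis
    by (rule that)
qed

lemma Tr_S: "x \<in> S \<Longrightarrow> Tr x \<in> V"
  by (rule S_F[OF _ Tr_in_F]) (auto simp: Tr_def intro: S_sum S_apply)

lemma bdd_S: "bdd S"
  unfolding bdd_def
proof
  fix b
  obtain k where k: "\<pi> ^ k * b \<in> S"
    using S_scale by blast
  have "\<pi> ^ k * Tr (b * x) \<in> V" if "x \<in> S" for x
    using Tr_S[OF S_mult[OF k that]] Tr_F_mult[OF V_in_F[OF unif_power_in_V], of k "b * x"]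
    by (simp add: mult.assoc)
  then show "\<exists>k. \<forall>x\<in>S. \<pi> ^ k * Tr (b * x) \<in> V"
    by blast
qed

text \<open>Complete integral closedness of S: the powers of x lie in the bounded set c^-1
  S.\<close>

lemma almost_integral:
  assumes "c \<noteq> 0" "\<And>n. c * x ^ n \<in> S"
  shows "x \<in> S"
proof -
  have "range (\<lambda>n. x ^ n) \<subseteq> (*) (inverse c) ` S"
  proof
    fix y
    assume "y \<in> range (\<lambda>n. x ^ n)"
    then obtain n where "y = inverse c * (c * x ^ n)"
      using assms(1) by (auto simp: mult.assoc[symmetric])
    then show "y \<in> (*) (inverse c) ` S"
      using assms(2) by blast
  qed
  then show ?thesis
    unfolding S_iff power_bdd_def by (rule bdd_subset[OF bdd_scale[OF bdd_S]])
qed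

section \<open>Finite generation of S over V\<close>

primrec vspan :: "'k list \<Rightarrow> 'k set"
  where
    "vspan [] = {0}"
  | "vspan (u # us) = {v * u + w | v w. v \<in> V \<and> w \<in> vspan us}"

text \<open>Writing \<open>\<delta> id\<close> as a sum of a_i \<otimes> b_i gives x as the sum of
  a_i Tr(b_i x). On S the traces have bounded denominators, so suitable a_i / \<pi>^k generate a
  module containing S.\<close>

lemma S_subset_vspan: "\<exists>us. S \<subseteq> vspan us"
proof -
  have "\<exists>us. \<forall>x\<in>S. (\<Sum>\<rho>\<in>G. g \<rho> * \<rho> x) \<in> vspan us" if "g \<in> E UNIV" for g
    using that
  proof (induction rule: E.induct)
    case (zero h)
    then show ?case
      by (intro exI[of _ "[]"]) auto
  next
    case (step g a b h)
    obtain us where us: "\<And>x. x \<in> S \<Longrightarrow> (\<Sum>\<rho>\<in>G. g \<rho> * \<rho> x) \<in> vspan us"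
      using step.IH by blast
    obtain k where k: "\<And>x. x \<in> S \<Longrightarrow> \<pi> ^ k * Tr (b * x) \<in> V"
      using bdd_S unfolding bdd_def by blast
    have eq: "(\<Sum>\<rho>\<in>G. h \<rho> * \<rho> x) = (\<pi> ^ k * Tr (b * x)) * (inverse (\<pi> ^ k) * a) + (\<Sum>\<rho>\<in>G. g \<rho> * \<rho> x)" for x
    proof -
      have "(\<Sum>\<rho>\<in>G. h \<rho> * \<rho> x) = (\<Sum>\<rho>\<in>G. a * \<rho> (b * x) + g \<rho> * \<rho> x)"
        by (intro sum.cong refl) (simp add: step.hyps(4) G_mult algebra_simps)
      then show ?thesis
        using unif_nonzero by (simp add: sum.distrib sum_distrib_left[symmetric] Tr_def[symmetric])
    qed
    have "\<forall>x\<in>S. (\<Sum>\<rho>\<in>G. h \<rho> * \<rho> x) \<in> vspan ((inverse (\<pi> ^ k) * a) # us)"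
      unfolding eq vspan.simps using us k by blast
    then show ?case
      by blast
  qed
  from this[OF delta_in_E_UNIV] obtain us where us: "\<forall>x\<in>S. (\<Sum>\<rho>\<in>G. \<delta> id \<rho> * \<rho> x) \<in> vspan us"
    by blast
  have "(\<Sum>\<rho>\<in>G. \<delta> id \<rho> * \<rho> x) = x" for x
  proof -
    have "(\<Sum>\<rho>\<in>G. \<delta> id \<rho> * \<rho> x) = (\<Sum>\<rho>\<in>G. if \<rho> = id then \<rho> x else 0)"
      by (intro sum.cong refl) (simp add: \<delta>_def)
    then show ?thesis
      using finite_G id_in_G by simp
  qed
  then show ?thesis
    using us by auto
qed

end

section \<open>Submodules of finitely generated modules over a principal ideal ring\<close>

lemma (in ring) Span_Cons_iff:
  "x \<in> Span K (u # Us) \<longleftrightarrow> (\<exists>k\<in>K. \<exists>w\<in>Span K Us. x = k \<otimes> u \<oplus> w)"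
  by (simp add: line_extension_mem_iff)

lemma (in ring) Span_subring_closed:
  assumes "subring K R" "set Us \<subseteq> carrier R"
  shows "Span K Us \<subseteq> carrier R" "\<zero> \<in> Span K Us"
    and "\<lbrakk>x \<in> Span K Us; y \<in> Span K Us\<rbrakk> \<Longrightarrow> x \<oplus> y \<in> Span K Us"
    and "\<lbrakk>k \<in> K; x \<in> Span K Us\<rbrakk> \<Longrightarrow> k \<otimes> x \<in> Span K Us"
proof -
  note K = subringE[OF assms(1)]
  have "Span K Us \<subseteq> carrier R \<and> \<zero> \<in> Span K Us \<and>
      (\<forall>x\<in>Span K Us. \<forall>y\<in>Span K Us. x \<oplus> y \<in> Span K Us) \<and>
      (\<forall>k\<in>K. \<forall>x\<in>Span K Us. k \<otimes> x \<in> Span K Us)"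
    using assms(2)
  proof (induction Us)
    case Nil
    show ?case
      using K(1) by auto
  next
    case (Cons u Us)
    then have u: "u \<in> carrier R" and IH: "Span K Us \<subseteq> carrier R" "\<zero> \<in> Span K Us"
      "\<And>x y. \<lbrakk>x \<in> Span K Us; y \<in> Span K Us\<rbrakk> \<Longrightarrow> x \<oplus> y \<in> Span K Us"
      "\<And>k x. \<lbrakk>k \<in> K; x \<in> Span K Us\<rbrakk> \<Longrightarrow> k \<otimes> x \<in> Span K Us"
      by auto
    have "Span K (u # Us) \<subseteq> carrier R"
      using u IH(1) K(1) unfolding subset_iff Span_Cons_iff by blast
    moreover have "\<zero> \<in> Span K (u # Us)"
      unfolding Span_Cons_iff using u IH(2) K(2) by (intro bexI[of _ \<zero>]) auto
    moreover have "x \<oplus> y \<in> Span K (u # Us)" if xy: "x \<in> Span K (u # Us)" "y \<in> Span K (u # Us)" for x y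
    proof -
      obtain k w k' w' where *: "k \<in> K" "w \<in> Span K Us" "x = k \<otimes> u \<oplus> w"
        "k' \<in> K" "w' \<in> Span K Us" "y = k' \<otimes> u \<oplus> w'"
        using xy unfolding Span_Cons_iff by blast
      then have "x \<oplus> y = (k \<oplus> k') \<otimes> u \<oplus> (w \<oplus> w')"
        using u K(1) IH(1) by (simp add: subset_iff l_distr a_ac)
      then show ?thesis
        unfolding Span_Cons_iff using * K(7) IH(3) by blast
    qed
    moreover have "k \<otimes> x \<in> Span K (u # Us)" if kx: "k \<in> K" "x \<in> Span K (u # Us)" for k x
    proof -
      obtain k' w where *: "k' \<in> K" "w \<in> Span K Us" "x = k' \<otimes> u \<oplus> w"
        using kx unfolding Span_Cons_iff by blast
      then have "k \<otimes> x = (k \<otimes> k') \<otimes> u \<oplus> k \<otimes> w"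
        using u K(1) IH(1) kx by (simp add: subset_iff r_distr m_assoc)
      then show ?thesis
        unfolding Span_Cons_iff using * kx K(6) IH(4) by blast
    qed
    ultimately show ?case
      by blast
  qed
  then show "Span K Us \<subseteq> carrier R" "\<zero> \<in> Span K Us"
    "\<lbrakk>x \<in> Span K Us; y \<in> Span K Us\<rbrakk> \<Longrightarrow> x \<oplus> y \<in> Span K Us"
    "\<lbrakk>k \<in> K; x \<in> Span K Us\<rbrakk> \<Longrightarrow> k \<otimes> x \<in> Span K Us"
    by blast+
qed

lemma (in ring) Span_subset_submodule:
  assumes "subring K R" "set Us \<subseteq> N" "\<zero> \<in> N"
    and "\<And>x y. \<lbrakk>x \<in> N; y \<in> N\<rbrakk> \<Longrightarrow> x \<oplus> y \<in> N"
    and "\<And>k x. \<lbrakk>k \<in> K; x \<in> N\<rbrakk> \<Longrightarrow> k \<otimes> x \<in> N"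
  shows "Span K Us \<subseteq> N"
  using assms(2)
proof (induction Us)
  case (Cons u Us)
  then show ?case
    using assms(4,5) unfolding subset_iff Span_Cons_iff by (metis list.set_intros)
qed (use assms(3) in auto)

text \<open>The coefficients of u in elements of N form an ideal of K. An element of N realizing its
  generator d, together with generators of \<open>N \<inter> Span K Us\<close> from the induction,
  generates N. The ambient ring is arbitrary because this is used in the field K and in the crossed
  product alike.\<close>

lemma (in ring) submodule_of_Span:
  assumes K: "subring K R"
    and PID: "\<And>I. \<lbrakk>I \<subseteq> K; \<zero> \<in> I; \<And>x y. \<lbrakk>x \<in> I; y \<in> I\<rbrakk> \<Longrightarrow> x \<oplus> y \<in> I;
        \<And>k x. \<lbrakk>k \<in> K; x \<in> I\<rbrakk> \<Longrightarrow> k \<otimes> x \<in> I\<rbrakk> \<Longrightarrow> \<exists>d\<in>I. \<forall>x\<in>I. \<exists>k\<in>K. x = k \<otimes> d"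
    and "set Us \<subseteq> carrier R" "N \<subseteq> Span K Us" "\<zero> \<in> N"
    and "\<And>x y. \<lbrakk>x \<in> N; y \<in> N\<rbrakk> \<Longrightarrow> x \<oplus> y \<in> N"
    and "\<And>k x. \<lbrakk>k \<in> K; x \<in> N\<rbrakk> \<Longrightarrow> k \<otimes> x \<in> N"
  shows "\<exists>Ws. set Ws \<subseteq> N \<and> N = Span K Ws"
  using assms(3-)
proof (induction Us arbitrary: N)
  case Nil
  then have "N = Span K []"
    by auto
  then show ?case
    by (metis empty_iff empty_set subsetI)
next
  case (Cons u Us)
  note KE = subringE[OF K]
  have u: "u \<in> carrier R" and Us: "set Us \<subseteq> carrier R"
    using Cons.prems by auto
  note Sp = Span_subring_closed[OF K Us]
  note NE = Cons.prems(3-5)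
  have m1: "\<ominus> \<one> \<in> K"
    using KE(3,5) by auto
  define I where "I = {k \<in> K. \<exists>w\<in>Span K Us. k \<otimes> u \<oplus> w \<in> N}"
  have "\<exists>d\<in>I. \<forall>x\<in>I. \<exists>k\<in>K. x = k \<otimes> d"
  proof (rule PID)
    show "I \<subseteq> K"
      by (auto simp: I_def simp del: Span.simps)
    show "\<zero> \<in> I"
      unfolding I_def using NE(1) KE(2) Sp(2) u by (auto simp del: Span.simps intro!: bexI[of _ \<zero>])
    show "x \<oplus> y \<in> I" if "x \<in> I" "y \<in> I" for x y
    proof -
      obtain v w where *: "x \<in> K" "y \<in> K" "v \<in> Span K Us" "w \<in> Span K Us" "x \<otimes> u \<oplus> v \<in> N" "y \<otimes> u \<oplus> w \<in> N"
        using \<open>x \<in> I\<close> \<open>y \<in> I\<close> by (auto simp: I_def simp del: Span.simps)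
      have "(x \<oplus> y) \<otimes> u \<oplus> (v \<oplus> w) = (x \<otimes> u \<oplus> v) \<oplus> (y \<otimes> u \<oplus> w)"
        using * u KE(1) Sp(1) by (simp add: subset_iff l_distr a_ac)
      then have "(x \<oplus> y) \<otimes> u \<oplus> (v \<oplus> w) \<in> N"
        using NE(2) * by simp
      then show ?thesis
        unfolding I_def using KE(7)[OF *(1,2)] Sp(3)[OF *(3,4)] by blast
    qed
    show "k \<otimes> x \<in> I" if "k \<in> K" "x \<in> I" for k x
    proof -
      obtain v where *: "x \<in> K" "v \<in> Span K Us" "x \<otimes> u \<oplus> v \<in> N"
        using \<open>x \<in> I\<close> by (auto simp: I_def simp del: Span.simps)
      have "(k \<otimes> x) \<otimes> u \<oplus> (k \<otimes> v) = k \<otimes> (x \<otimes> u \<oplus> v)"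
        using * u KE(1) Sp(1) \<open>k \<in> K\<close> by (simp add: subset_iff r_distr m_assoc)
      then have "(k \<otimes> x) \<otimes> u \<oplus> (k \<otimes> v) \<in> N"
        using NE(3) * \<open>k \<in> K\<close> by simp
      then show ?thesis
        unfolding I_def using KE(6)[OF \<open>k \<in> K\<close> *(1)] Sp(4)[OF \<open>k \<in> K\<close> *(2)] by blast
    qed
  qed
  then obtain d where d: "d \<in> I" "\<And>x. x \<in> I \<Longrightarrow> \<exists>k\<in>K. x = k \<otimes> d"
    by blast
  then obtain w0 where w0: "d \<in> K" "w0 \<in> Span K Us" "d \<otimes> u \<oplus> w0 \<in> N"
    by (auto simp: I_def simp del: Span.simps)
  have "\<exists>Ws. set Ws \<subseteq> N \<inter> Span K Us \<and> N \<inter> Span K Us = Span K Ws"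
    by (rule Cons.IH[OF Us]) (use NE Sp in \<open>auto simp del: Span.simps\<close>)
  then obtain Ws where Ws: "set Ws \<subseteq> N \<inter> Span K Us" "N \<inter> Span K Us = Span K Ws"
    by blast
  let ?Ws = "(d \<otimes> u \<oplus> w0) # Ws"
  have "set ?Ws \<subseteq> N"
    using Ws w0 by auto
  moreover have "N \<subseteq> Span K ?Ws"
  proof
    fix x
    assume x: "x \<in> N"
    then obtain k w where kw: "k \<in> K" "w \<in> Span K Us" "x = k \<otimes> u \<oplus> w"
      using Cons.prems(2) Span_Cons_iff by blast
    then have "k \<in> I"
      using x by (auto simp: I_def simp del: Span.simps)
    then obtain c where c: "c \<in> K" "k = c \<otimes> d"
      using d(2) by blast
    \<comment> \<open>This is x minus c times the chosen element of N; the multiples of u cancel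
      since k is c d. Subtraction is multiplication by the scalar \<open>\<ominus> \<one>\<close> of
      K, for which N is known to be closed.\<close>
    let ?y = "w \<oplus> (\<ominus> \<one> \<otimes> (c \<otimes> w0))"
    have car: "c \<in> carrier R" "d \<in> carrier R" "w \<in> carrier R" "w0 \<in> carrier R"
      using c w0 kw KE(1) Sp(1) by auto
    have "?y \<in> Span K Us"
      using m1 c w0 kw by (intro Sp(3,4))
    have "?y = x \<oplus> (\<ominus> \<one> \<otimes> (c \<otimes> (d \<otimes> u \<oplus> w0)))"
      using car u by (simp add: kw c l_minus r_distr m_assoc minus_add a_ac r_neg1 r_neg2 r_neg)
    also have "\<dots> \<in> N"
      by (rule NE(2)[OF x NE(3)[OF m1 NE(3)[OF c(1) w0(3)]]])
    finally have "?y \<in> N \<inter> Span K Us"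
      using \<open>?y \<in> Span K Us\<close> by blast
    moreover have "x = c \<otimes> (d \<otimes> u \<oplus> w0) \<oplus> ?y"
      using car u by (simp add: kw c l_minus r_distr m_assoc a_ac r_neg1 r_neg2 r_neg)
    ultimately show "x \<in> Span K ?Ws"
      unfolding Span_Cons_iff Ws(2) using c by blast
  qed
  ultimately show ?case
    using Span_subset_submodule[OF K _ NE, of ?Ws] by blast
qed

lemma a_inv_type_algebra: "a_inv ring_of_type_algebra x = - (x :: 'a::comm_ring_1)"
proof -
  interpret R: ring "ring_of_type_algebra :: 'a ring"
    by (rule ring_from_type_algebra)
  show ?thesis
    by (rule R.minus_equality) (simp_all add: ring_of_type_algebra_def)
qed

context dvr_galois
begin

text \<open>The least power of \<pi> in a nonzero ideal generates it.\<close>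

lemma V_principal:
  assumes "I \<subseteq> V" "0 \<in> I" "\<And>k x. \<lbrakk>k \<in> V; x \<in> I\<rbrakk> \<Longrightarrow> k * x \<in> I"
  shows "\<exists>d\<in>I. \<forall>x\<in>I. \<exists>k\<in>V. x = k * d"
proof (cases "I = {0}")
  case False
  then have "\<exists>n. \<pi> ^ n \<in> I"
  proof -
    obtain x where "x \<in> I" "x \<noteq> 0"
      using False assms(2) by blast
    then obtain n u where u: "inverse u \<in> V" "x = \<pi> ^ n * u"
      using V_cases assms(1) by blast
    then have "inverse u * x = \<pi> ^ n"
      using \<open>x \<noteq> 0\<close> by auto
    then show ?thesis
      using assms(3) u(1) \<open>x \<in> I\<close> by metis
  qed
  define n where "n = (LEAST n. \<pi> ^ n \<in> I)"
  have n: "\<pi> ^ n \<in> I"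
    unfolding n_def by (rule LeastI_ex) fact
  have "\<exists>k\<in>V. x = k * \<pi> ^ n" if x: "x \<in> I" for x
  proof (cases "x = 0")
    case False
    then obtain m u where u: "u \<in> V" "inverse u \<in> V" "x = \<pi> ^ m * u"
      using V_cases assms(1) x by blast
    then have "inverse u * x = \<pi> ^ m"
      using False by auto
    then have "\<pi> ^ m \<in> I"
      using assms(3) u x by metis
    then have "n \<le> m"
      unfolding n_def by (rule Least_le)
    then have "x = (\<pi> ^ (m - n) * u) * \<pi> ^ n"
      using u by (simp add: power_add[symmetric] algebra_simps)
    then show ?thesis
      using V_mult[OF unif_power_in_V u(1)] by blast
  qed (use V_zero in force)
  then show ?thesis
    using n by blast
qed (use V_one in force)

lemma subring_V: "subring V ring_of_type_algebra"
  by (rule ring.subringI[OF ring_from_type_algebra])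
    (auto simp: a_inv_type_algebra V_minus,
      auto simp: ring_of_type_algebra_def V_one V_add V_mult)

lemma vspan_eq_Span: "vspan us = ring.Span ring_of_type_algebra V us"
proof (induction us)
  case Nil
  then show ?case
    unfolding ring.Span.simps[OF ring_from_type_algebra] by (simp add: ring_of_type_algebra_def)
next
  case (Cons u us)
  then show ?case
    unfolding set_eq_iff ring.Span_Cons_iff[OF ring_from_type_algebra]
    by (auto simp: ring_of_type_algebra_def)
qed

lemma submodule_S_generated:
  assumes "N \<subseteq> S" "0 \<in> N" "\<And>x y. \<lbrakk>x \<in> N; y \<in> N\<rbrakk> \<Longrightarrow> x + y \<in> N"
    "\<And>k x. \<lbrakk>k \<in> V; x \<in> N\<rbrakk> \<Longrightarrow> k * x \<in> N"
  shows "\<exists>us. set us \<subseteq> N \<and> N \<subseteq> vspan us"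
proof -
  obtain us where us: "S \<subseteq> vspan us"
    using S_subset_vspan by blast
  have "\<exists>Ws. set Ws \<subseteq> N \<and> N = ring.Span ring_of_type_algebra V Ws"
    by (rule ring.submodule_of_Span[OF ring_from_type_algebra subring_V _ _ , of us])
      (use assms us V_principal in \<open>auto simp: ring_of_type_algebra_def vspan_eq_Span\<close>)
  then show ?thesis
    by (auto simp: vspan_eq_Span)
qed

subsection \<open>Maximal ideals\<close>

text \<open>Ideals of S in the arithmetic of the type \<open>'k\<close>. The lemmas
  \<open>ideal_iff_idl\<close> and \<open>maximalideal_iff_maxidl\<close> connect them with ideals
  of \<open>ring_on S\<close>.\<close>

definition idl :: "'k set \<Rightarrow> bool"
  where "idl I \<longleftrightarrow> I \<subseteq> S \<and> 0 \<in> I \<and> (\<forall>x\<in>I. \<forall>y\<in>I. x + y \<in> I) \<and> (\<forall>a\<in>S. \<forall>x\<in>I. a * x \<in> I)"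

definition maxidl :: "'k set \<Rightarrow> bool"
  where "maxidl M \<longleftrightarrow> idl M \<and> 1 \<notin> M \<and> (\<forall>J. idl J \<and> M \<subseteq> J \<and> 1 \<notin> J \<longrightarrow> J = M)"

lemma idlI:
  assumes "I \<subseteq> S" "0 \<in> I" "\<And>x y. \<lbrakk>x \<in> I; y \<in> I\<rbrakk> \<Longrightarrow> x + y \<in> I" "\<And>a x. \<lbrakk>a \<in> S; x \<in> I\<rbrakk> \<Longrightarrow> a * x \<in> I"
  shows "idl I"
  using assms by (auto simp: idl_def)

lemma idlD:
  assumes "idl I"
  shows "x \<in> I \<Longrightarrow> x \<in> S" "0 \<in> I" "\<lbrakk>x \<in> I; y \<in> I\<rbrakk> \<Longrightarrow> x + y \<in> I" "\<lbrakk>a \<in> S; x \<in> I\<rbrakk> \<Longrightarrow> a * x \<in> I"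
    "\<lbrakk>a \<in> S; x \<in> I\<rbrakk> \<Longrightarrow> x * a \<in> I"
  using assms by (auto simp: idl_def mult.commute)

lemma idl_minus: "\<lbrakk>idl I; x \<in> I\<rbrakk> \<Longrightarrow> - x \<in> I"
  using idlD(4)[of I "- 1" x] S_minus[OF S_one] by simp

lemma idl_diff: "\<lbrakk>idl I; x \<in> I; y \<in> I\<rbrakk> \<Longrightarrow> x - y \<in> I"
  using idlD(3)[of I x "- y"] idl_minus by simp

lemma maxidl_idl: "maxidl M \<Longrightarrow> idl M"
  by (simp add: maxidl_def)

lemma maxidl_one: "maxidl M \<Longrightarrow> 1 \<notin> M"
  by (simp add: maxidl_def)

lemma maxidl_eq: "\<lbrakk>maxidl M; maxidl N; M \<subseteq> N\<rbrakk> \<Longrightarrow> N = M"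
  by (simp add: maxidl_def)

lemma maxidl_exists:
  assumes "idl I" "1 \<notin> I"
  shows "\<exists>M. maxidl M \<and> I \<subseteq> M"
proof -
  let ?A = "{J. idl J \<and> I \<subseteq> J \<and> 1 \<notin> J}"
  have "\<exists>M\<in>?A. \<forall>J\<in>?A. M \<subseteq> J \<longrightarrow> J = M"
  proof (rule subset_Zorn_nonempty)
    show "?A \<noteq> {}"
      using assms by blast
    fix C
    assume C: "C \<noteq> {}" "subset.chain ?A C"
    have "idl (\<Union>C)"
    proof (rule idlI)
      show "\<Union>C \<subseteq> S"
        using C by (auto simp: subset_chain_def idl_def)
      show "0 \<in> \<Union>C"
        using C by (fastforce simp: subset_chain_def idl_def)
      show "x + y \<in> \<Union>C" if xy: "x \<in> \<Union>C" "y \<in> \<Union>C" for x y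
      proof -
        obtain J K where JK: "x \<in> J" "y \<in> K" "J \<in> C" "K \<in> C"
          using xy by blast
        then have "J \<subseteq> K \<or> K \<subseteq> J"
          using C(2) unfolding subset_chain_def by blast
        moreover have "idl J" "idl K"
          using C(2) JK unfolding subset_chain_def by blast+
        ultimately show ?thesis
          using JK idlD(3) by (meson UnionI subsetD)
      qed
      show "a * x \<in> \<Union>C" if "a \<in> S" "x \<in> \<Union>C" for a x
        using that C by (fastforce simp: subset_chain_def idl_def)
    qed
    then show "\<Union>C \<in> ?A"
      using C unfolding subset_chain_def by blast
  qed
  then obtain M where M: "M \<in> ?A" "\<forall>J\<in>?A. M \<subseteq> J \<longrightarrow> J = M"
    by blast
  then have "maxidl M"
    unfolding maxidl_def by blast
  then show ?thesis
    using M(1) by blast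
qed

lemma maxidl_inverse:
  assumes "maxidl M" "x \<in> S" "x \<notin> M"
  shows "\<exists>a\<in>S. \<exists>m\<in>M. a * x + m = 1"
proof (rule ccontr)
  assume *: "\<not> ?thesis"
  note M = idlD[OF maxidl_idl[OF assms(1)]]
  define J where "J = {a * x + m | a m. a \<in> S \<and> m \<in> M}"
  have "idl J"
  proof (rule idlI)
    show "J \<subseteq> S"
      using assms(2) M(1) by (auto simp: J_def intro: S_add S_mult)
    show "0 \<in> J"
      unfolding J_def using S_zero M(2) by force
    show "y + z \<in> J" if yz: "y \<in> J" "z \<in> J" for y z
    proof -
      obtain a m b n where "a \<in> S" "m \<in> M" "b \<in> S" "n \<in> M" "y = a * x + m" "z = b * x + n"
        using yz by (auto simp: J_def)
      then show ?thesis
        unfolding J_def using S_add M(3)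
        by (intro CollectI exI[of _ "a + b"] exI[of _ "m + n"]) (simp add: algebra_simps)
    qed
    show "c * y \<in> J" if cy: "c \<in> S" "y \<in> J" for c y
    proof -
      obtain a m where "a \<in> S" "m \<in> M" "y = a * x + m"
        using cy by (auto simp: J_def)
      then show ?thesis
        unfolding J_def using S_mult M(4) cy(1)
        by (intro CollectI exI[of _ "c * a"] exI[of _ "c * m"]) (simp add: algebra_simps)
    qed
  qed
  moreover have "M \<subseteq> J"
    unfolding J_def using S_zero by force
  moreover have "1 \<notin> J"
    using * by (auto simp: J_def)
  moreover have "x \<in> J"
    unfolding J_def using S_one M(2) by force
  ultimately show False
    using assms(1,3) unfolding maxidl_def by blast
qed

lemma maxidl_prime:
  assumes "maxidl M" "x \<in> S" "y \<in> S" "x * y \<in> M"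
  shows "x \<in> M \<or> y \<in> M"
proof (rule ccontr)
  assume *: "\<not> ?thesis"
  note M = idlD[OF maxidl_idl[OF assms(1)]]
  obtain a m where am: "a \<in> S" "m \<in> M" "a * x + m = 1"
    using maxidl_inverse[OF assms(1,2)] * by blast
  have "y = a * (x * y) + m * y"
    using am(3) by (metis distrib_right mult.assoc mult_1)
  then have "y \<in> M"
    using M(3)[OF M(4)[OF am(1) assms(4)] M(5)[OF assms(3) am(2)]] by simp
  then show False
    using * by blast
qed

lemma maxidl_prime_prod:
  assumes "maxidl M" "finite I" "\<And>i. i \<in> I \<Longrightarrow> g i \<in> S" "prod g I \<in> M"
  shows "\<exists>i\<in>I. g i \<in> M"
  using assms(2-)
proof (induction I rule: finite_induct)
  case empty
  then show ?case
    using maxidl_one[OF assms(1)] by simp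
next
  case (insert i I)
  then have "g i * prod g I \<in> M"
    by simp
  then have "g i \<in> M \<or> prod g I \<in> M"
    by (intro maxidl_prime[OF assms(1)] S_prod) (use insert in auto)
  then show ?case
    using insert by blast
qed

lemma maxidl_prime_power: "\<lbrakk>maxidl M; x \<in> S; x ^ n \<in> M\<rbrakk> \<Longrightarrow> x \<in> M"
  using maxidl_prime_prod[of M "{..<n}" "\<lambda>_. x"] by auto

lemma idl_apply:
  assumes "idl I" "\<sigma> \<in> G"
  shows "idl (\<sigma> ` I)"
proof (rule idlI)
  show "\<sigma> ` I \<subseteq> S"
    using assms idlD(1) S_apply by blast
  show "0 \<in> \<sigma> ` I"
    using assms idlD(2) G_zero by force
  show "x + y \<in> \<sigma> ` I" if "x \<in> \<sigma> ` I" "y \<in> \<sigma> ` I" for x y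
    using that assms idlD(3) G_add by (smt (verit, best) image_iff)
  show "a * x \<in> \<sigma> ` I" if ax: "a \<in> S" "x \<in> \<sigma> ` I" for a x
  proof -
    obtain y where "y \<in> I" "x = \<sigma> y"
      using ax by blast
    then have "a * x = \<sigma> (finv \<sigma> a * y)" "finv \<sigma> a * y \<in> I"
      using assms ax inv_in_G by (auto simp: G_mult G_apply_inv intro: idlD S_apply)
    then show ?thesis
      by blast
  qed
qed

lemma apply_mem_image_iff: "\<sigma> \<in> G \<Longrightarrow> \<sigma> x \<in> \<sigma> ` I \<longleftrightarrow> x \<in> I"
  by (metis (no_types) G_inv_apply image_iff)

lemma mem_image_iff: "\<sigma> \<in> G \<Longrightarrow> x \<in> \<sigma> ` I \<longleftrightarrow> finv \<sigma> x \<in> I"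
  by (metis (no_types) G_inv_apply G_apply_inv image_iff)

lemma image_inv_image: "\<sigma> \<in> G \<Longrightarrow> \<sigma> ` finv \<sigma> ` I = I" "\<sigma> \<in> G \<Longrightarrow> finv \<sigma> ` \<sigma> ` I = I"
  by (simp_all add: image_comp G_comp_inv G_inv_comp)

lemma maxidl_apply:
  assumes "maxidl M" "\<sigma> \<in> G"
  shows "maxidl (\<sigma> ` M)"
  unfolding maxidl_def
proof (intro conjI allI impI)
  show "idl (\<sigma> ` M)"
    using assms maxidl_idl idl_apply by blast
  show "1 \<notin> \<sigma> ` M"
    using apply_mem_image_iff[OF assms(2), of 1 M] maxidl_one[OF assms(1)] assms(2) by (simp add: G_one)
  fix J
  assume J: "idl J \<and> \<sigma> ` M \<subseteq> J \<and> 1 \<notin> J"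
  have "idl (finv \<sigma> ` J)"
    using J idl_apply inv_in_G assms(2) by blast
  moreover have "M \<subseteq> finv \<sigma> ` J"
    using J image_mono[of "\<sigma> ` M" J "finv \<sigma>"] image_inv_image(2)[OF assms(2)] by simp
  moreover have "1 \<notin> finv \<sigma> ` J"
    using apply_mem_image_iff[OF inv_in_G[OF assms(2)], of 1 J] J G_one[OF inv_in_G[OF assms(2)]] by simp
  ultimately have "finv \<sigma> ` J = M"
    using assms(1) unfolding maxidl_def by blast
  then show "J = \<sigma> ` M"
    using image_inv_image(1)[OF assms(2), of J] by simp
qed

lemma norm_in_V:
  assumes "x \<in> S"
  shows "(\<Prod>\<sigma>\<in>G. \<sigma> x) \<in> V"
proof (rule S_F)
  show "(\<Prod>\<sigma>\<in>G. \<sigma> x) \<in> S"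
    by (rule S_prod) (rule S_apply[OF assms])
  have "\<tau> (\<Prod>\<sigma>\<in>G. \<sigma> x) = (\<Prod>\<sigma>\<in>G. \<sigma> x)" if "\<tau> \<in> G" for \<tau>
    using prod.reindex_bij_betw[OF bij_betw_comp_left[OF that], of "\<lambda>\<sigma>. \<sigma> x"]
    by (simp add: G_prod that)
  then show "(\<Prod>\<sigma>\<in>G. \<sigma> x) \<in> F"
    by (simp add: F_def)
qed

lemma norm_split: "(\<Prod>\<sigma>\<in>G. \<sigma> x) = x * (\<Prod>\<sigma>\<in>G - {id}. \<sigma> x)"
  using prod.remove[OF finite_G id_in_G, of "\<lambda>\<sigma>. \<sigma> x"] by simp

lemma norm_cofactor_in_S: "x \<in> S \<Longrightarrow> (\<Prod>\<sigma>\<in>G - {id}. \<sigma> x) \<in> S"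
  by (rule S_prod) (use S_apply in blast)

lemma norm_in_idl: "\<lbrakk>idl I; x \<in> I\<rbrakk> \<Longrightarrow> (\<Prod>\<sigma>\<in>G. \<sigma> x) \<in> I"
  unfolding norm_split using idlD(1,5) norm_cofactor_in_S by blast

lemma norm_nonzero: "x \<noteq> 0 \<Longrightarrow> (\<Prod>\<sigma>\<in>G. \<sigma> x) \<noteq> 0"
  using finite_G by (simp add: G_eq_zero_iff)

lemma maxidl_V_cases:
  assumes M: "maxidl M" and v: "v \<in> M" "v \<in> V" "v \<noteq> 0"
  obtains n u where "n > 0" "u \<in> V" "v = \<pi> ^ n * u" "\<pi> ^ n \<in> M"
proof -
  obtain n u where nu: "u \<in> V" "inverse u \<in> V" "v = \<pi> ^ n * u"
    using V_cases v by blast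
  have "inverse u * v = \<pi> ^ n"
    using nu v(3) by auto
  then have n: "\<pi> ^ n \<in> M"
    using idlD(4)[OF maxidl_idl[OF M] V_in_S[OF nu(2)] v(1)] by simp
  then have "n > 0"
    using maxidl_one[OF M] by (cases n) auto
  then show ?thesis
    using that nu n by blast
qed

text \<open>Otherwise a \<pi> + m = 1 with m in M. If m is nonzero, its norm is a nonzero element of
  V in M, which puts a power of \<pi> into M. If m = 0, then \<pi>^-1 lies in S and F, hence in
  V.\<close>

lemma unif_in_maxidl:
  assumes M: "maxidl M"
  shows "\<pi> \<in> M"
proof (rule ccontr)
  assume *: "\<pi> \<notin> M"
  obtain a m where am: "a \<in> S" "m \<in> M" "a * \<pi> + m = 1"
    using maxidl_inverse[OF M S_unif *] by blast
  have "m = 0"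
  proof (rule ccontr)
    assume "m \<noteq> 0"
    have "(\<Prod>\<sigma>\<in>G. \<sigma> m) \<in> M" "(\<Prod>\<sigma>\<in>G. \<sigma> m) \<in> V"
      using am(2) norm_in_idl[OF maxidl_idl[OF M]] norm_in_V idlD(1)[OF maxidl_idl[OF M]] by blast+
    then obtain n where "\<pi> ^ n \<in> M"
      using maxidl_V_cases[OF M _ _ norm_nonzero[OF \<open>m \<noteq> 0\<close>]] by metis
    then show False
      using * maxidl_prime_power[OF M S_unif] by blast
  qed
  then have "inverse \<pi> = a"
    using am(3) by (metis add.right_neutral inverse_unique mult.commute)
  moreover have "inverse \<pi> \<in> F"
    by (simp add: F_def G_inverse G_unif)
  ultimately show False
    using S_F am(1) unif_nonunit by metis
qed

lemma maxidl_V: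
  assumes M: "maxidl M" and v: "v \<in> M" "v \<in> V"
  shows "\<exists>w\<in>V. v = \<pi> * w"
proof (cases "v = 0")
  case False
  then obtain n u where nu: "n > 0" "u \<in> V" "v = \<pi> ^ n * u"
    using maxidl_V_cases[OF M v] by blast
  then have "v = \<pi> * (\<pi> ^ (n - 1) * u)"
    by (cases n) auto
  then show ?thesis
    using V_mult[OF unif_power_in_V nu(2)] by blast
qed (use V_zero in force)

text \<open>The element is a product of factors picked from each N outside M; primeness keeps the
  product outside M.\<close>

lemma prime_avoidance:
  assumes "finite A" "\<And>N. N \<in> A \<Longrightarrow> maxidl N" "maxidl M" "M \<notin> A"
  shows "\<exists>q\<in>S. q \<notin> M \<and> (\<forall>N\<in>A. q \<in> N)"
  using assms(1,2,4)
proof (induction A rule: finite_induct)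
  case empty
  then show ?case
    using S_one maxidl_one[OF assms(3)] by auto
next
  case (insert N A)
  then obtain q where q: "q \<in> S" "q \<notin> M" "\<forall>N\<in>A. q \<in> N"
    by auto
  have N: "maxidl N" "\<not> N \<subseteq> M"
    using insert.prems maxidl_eq[OF _ assms(3)] by auto
  then obtain r where r: "r \<in> N" "r \<notin> M"
    by blast
  have "r \<in> S"
    using r N idlD(1) maxidl_idl by blast
  then have "q * r \<notin> M"
    using maxidl_prime[OF assms(3) q(1)] q r by blast
  moreover have "q * r \<in> K" if "K \<in> insert N A" for K
    using that q r \<open>r \<in> S\<close> insert.prems(1) by (auto intro: idlD(4,5) maxidl_idl)
  ultimately show ?case
    using S_mult[OF q(1) \<open>r \<in> S\<close>] by blast
qed

text \<open>If N is not conjugate to M, some q lies in all conjugates of M but not in N, and a q + n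
  = 1 with n in N. The norm of n lies in \<open>N \<inter> V\<close>, hence in \<pi> V and in M, so
  some conjugate of M contains n. It also contains q, hence 1.\<close>

lemma maxidl_transitive:
  assumes "maxidl M" "maxidl N"
  shows "\<exists>\<sigma>\<in>G. N = \<sigma> ` M"
proof (rule ccontr)
  assume *: "\<not> ?thesis"
  let ?A = "(\<lambda>\<sigma>. \<sigma> ` M) ` G"
  have "finite ?A" "\<And>K. K \<in> ?A \<Longrightarrow> maxidl K" "N \<notin> ?A"
    using finite_G maxidl_apply[OF assms(1)] * by auto
  then obtain q where q: "q \<in> S" "q \<notin> N" "\<forall>K\<in>?A. q \<in> K"
    using prime_avoidance[of ?A N] assms(2) by blast
  obtain a n where an: "a \<in> S" "n \<in> N" "a * q + n = 1"
    using maxidl_inverse[OF assms(2) q(1,2)] by blast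
  have nS: "n \<in> S"
    using an(2) idlD(1) maxidl_idl assms(2) by blast
  have "(\<Prod>\<sigma>\<in>G. \<sigma> n) \<in> N" "(\<Prod>\<sigma>\<in>G. \<sigma> n) \<in> V"
    using an(2) norm_in_idl[OF maxidl_idl[OF assms(2)]] norm_in_V[OF nS] by blast+
  then obtain w where "w \<in> V" "(\<Prod>\<sigma>\<in>G. \<sigma> n) = \<pi> * w"
    using maxidl_V[OF assms(2)] by blast
  then have "(\<Prod>\<sigma>\<in>G. \<sigma> n) \<in> M"
    using idlD(5)[OF maxidl_idl[OF assms(1)] V_in_S unif_in_maxidl[OF assms(1)]] by simp
  then obtain \<sigma> where \<sigma>: "\<sigma> \<in> G" "\<sigma> n \<in> M"
    using maxidl_prime_prod[OF assms(1) finite_G, of "\<lambda>\<sigma>. \<sigma> n"] nS S_apply by blast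
  have iG: "finv \<sigma> \<in> G"
    using \<sigma> inv_in_G by blast
  have "n \<in> finv \<sigma> ` M"
    using \<sigma> mem_image_iff[OF iG] by (simp add: G_inv_inv)
  moreover have "q \<in> finv \<sigma> ` M"
    using q(3) iG by blast
  ultimately have "1 \<in> finv \<sigma> ` M"
    using an idlD(3,4) maxidl_idl[OF maxidl_apply[OF assms(1) iG]] by metis
  then show False
    using maxidl_one[OF maxidl_apply[OF assms(1) iG]] by blast
qed

lemma finite_maxidl: "finite {M. maxidl M}"
proof (cases "\<exists>M. maxidl M")
  case True
  then obtain M where "maxidl M"
    by blast
  then have "{M. maxidl M} \<subseteq> (\<lambda>\<sigma>. \<sigma> ` M) ` G"
    using maxidl_transitive by blast
  then show ?thesis
    using finite_G finite_surj by blast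
qed simp

lemma maxidl_ex: "\<exists>M. maxidl M"
  using maxidl_exists[of "{0}"] idlI[of "{0}"] S_zero by auto

lemma separating_element:
  assumes "maxidl M"
  obtains q where "q \<in> S" "q \<notin> M" "\<And>N. \<lbrakk>maxidl N; N \<noteq> M\<rbrakk> \<Longrightarrow> q \<in> N"
proof -
  have "\<exists>q\<in>S. q \<notin> M \<and> (\<forall>N\<in>{N. maxidl N} - {M}. q \<in> N)"
    using finite_maxidl assms by (intro prime_avoidance) auto
  then show ?thesis
    using that by blast
qed

subsection \<open>Ideal powers and ramification\<close>

inductive_set idp :: "'k set \<Rightarrow> 'k set \<Rightarrow> 'k set" for I J
  where
    prod: "\<lbrakk>i \<in> I; j \<in> J\<rbrakk> \<Longrightarrow> i * j \<in> idp I J"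
  | sum: "\<lbrakk>x \<in> idp I J; y \<in> idp I J\<rbrakk> \<Longrightarrow> x + y \<in> idp I J"

primrec idpow :: "'k set \<Rightarrow> nat \<Rightarrow> 'k set"
  where
    "idpow M 0 = S"
  | "idpow M (Suc n) = idp (idpow M n) M"

lemma idl_idp:
  assumes "idl I" "idl J"
  shows "idl (idp I J)"
proof (rule idlI)
  show "idp I J \<subseteq> S"
  proof
    fix x
    assume "x \<in> idp I J"
    then show "x \<in> S"
      by induction (use assms in \<open>auto intro: S_add S_mult idlD(1)\<close>)
  qed
  show "0 \<in> idp I J"
    using idp.prod[OF idlD(2)[OF assms(1)] idlD(2)[OF assms(2)]] by simp
  show "a * x \<in> idp I J" if "a \<in> S" "x \<in> idp I J" for a x
    using that(2)
  proof induction
    case (prod i j)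
    then show ?case
      using idp.prod[OF idlD(4)[OF assms(1) that(1) prod(1)] prod(2)] by (simp add: mult.assoc)
  next
    case (sum x y)
    then show ?case
      by (simp add: distrib_left idp.sum)
  qed
qed (rule idp.sum)

lemma idp_subset: "\<lbrakk>idl I; idl J\<rbrakk> \<Longrightarrow> idp I J \<subseteq> I"
proof
  fix x
  assume I: "idl I" "idl J" and "x \<in> idp I J"
  show "x \<in> I"
    using \<open>x \<in> idp I J\<close> by induction (use I in \<open>auto intro: idlD\<close>)
qed

lemma idl_sum: "\<lbrakk>idl I; \<And>i. i \<in> A \<Longrightarrow> g i \<in> I\<rbrakk> \<Longrightarrow> sum g A \<in> I"
  by (induction A rule: infinite_finite_induct) (simp_all add: idlD)

lemma idl_S: "idl S"
  by (rule idlI) (auto intro: S_zero S_add S_mult)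

lemma idl_idpow: "idl M \<Longrightarrow> idl (idpow M n)"
  by (induction n) (auto intro: idl_S idl_idp)

lemma idpow_antimono:
  assumes "idl M" "m \<le> n"
  shows "idpow M n \<subseteq> idpow M m"
  using assms(2)
  by (induction rule: dec_induct) (use idp_subset[OF idl_idpow[OF assms(1)] assms(1)] in auto)

lemma mult_in_idpow_2: "\<lbrakk>idl M; x \<in> M; y \<in> M\<rbrakk> \<Longrightarrow> x * y \<in> idpow M 2"
  using idp.prod[OF idp.prod[OF S_one, of x M], of y M] by (simp add: numeral_2_eq_2)

section \<open>The Jacobson radical P of S and the ideal \<pi> S\<close>

definition P :: "'k set"
  where "P = {x. \<forall>M. maxidl M \<longrightarrow> x \<in> M}"

lemma idl_P: "idl P"
proof (rule idlI)
  obtain M where "maxidl M"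
    using maxidl_ex by blast
  then show "P \<subseteq> S"
    using idlD(1) maxidl_idl by (auto simp: P_def)
qed (auto simp: P_def maxidl_idl intro: idlD)

lemma unif_in_P: "\<pi> \<in> P"
  by (simp add: P_def unif_in_maxidl)

text \<open>A G-stable ideal inside one maximal ideal lies in all of them by transitivity, hence in
  P.\<close>

lemma G_stable_idl:
  assumes I: "idl I" "\<And>\<sigma>. \<sigma> \<in> G \<Longrightarrow> \<sigma> ` I \<subseteq> I" and "\<not> I \<subseteq> P"
  shows "1 \<in> I"
proof (rule ccontr)
  assume "1 \<notin> I"
  then obtain N where N: "maxidl N" "I \<subseteq> N"
    using maxidl_exists I(1) by blast
  obtain M where M: "maxidl M" "\<not> I \<subseteq> M"
    using assms(3) by (auto simp: P_def)
  obtain \<sigma> where \<sigma>: "\<sigma> \<in> G" "M = \<sigma> ` N"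
    using maxidl_transitive N(1) M(1) by blast
  have "I = \<sigma> ` finv \<sigma> ` I"
    using image_inv_image(1)[OF \<sigma>(1)] by simp
  also have "\<dots> \<subseteq> \<sigma> ` I"
    using I(2)[OF inv_in_G[OF \<sigma>(1)]] by blast
  also have "\<dots> \<subseteq> M"
    using N(2) \<sigma>(2) by blast
  finally show False
    using M(2) by blast
qed

lemma P_apply:
  assumes "x \<in> P" "\<sigma> \<in> G"
  shows "\<sigma> x \<in> P"
  unfolding P_def
proof (intro CollectI allI impI)
  fix M
  assume "maxidl M"
  then have "x \<in> finv \<sigma> ` M"
    using maxidl_apply[OF _ inv_in_G[OF assms(2)]] assms(1) by (auto simp: P_def)
  then show "\<sigma> x \<in> M"
    using assms(2) by (auto simp: G_apply_inv)
qed

lemma P_V: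
  assumes "x \<in> P" "x \<in> V"
  shows "\<exists>w\<in>V. x = \<pi> * w"
  using maxidl_ex maxidl_V assms by (auto simp: P_def)

definition piS :: "'k set"
  where "piS = (*) \<pi> ` S"

lemma idl_piS: "idl piS"
proof (rule idlI)
  show "piS \<subseteq> S"
    by (auto simp: piS_def intro: S_mult S_unif)
  show "0 \<in> piS"
    using S_zero by (force simp: piS_def)
  show "x + y \<in> piS" if "x \<in> piS" "y \<in> piS" for x y
    using that S_add by (auto simp: piS_def distrib_left[symmetric])
  show "a * x \<in> piS" if "a \<in> S" "x \<in> piS" for a x
    using that S_mult by (auto simp: piS_def mult.left_commute[of a])
qed

lemma unif_S_in_piS: "x \<in> S \<Longrightarrow> \<pi> * x \<in> piS"
  by (auto simp: piS_def)

lemma piS_subset_P: "piS \<subseteq> P"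
  using idlD(5)[OF idl_P _ unif_in_P] by (auto simp: piS_def)

text \<open>All coefficients of the characteristic polynomial below the leading one lie in P and V,
  hence in \<pi> V.\<close>

lemma P_nil:
  assumes x: "x \<in> P"
  shows "x ^ card G \<in> piS"
proof -
  have xS: "x \<in> S"
    using x idlD(1)[OF idl_P] by blast
  let ?c = "Polynomial.coeff (char_poly x)"
  have "?c (card G) = 1"
    using lead_coeff_char_poly[of x] by (simp add: degree_char_poly)
  then have eq: "x ^ card G = - (\<Sum>i<card G. ?c i * x ^ i)"
    using poly_char_poly[of x] unfolding poly_altdef degree_char_poly lessThan_Suc_atMost[symmetric]
    by (simp add: eq_neg_iff_add_eq_0 add.commute)
  have "?c i * x ^ i \<in> piS" if i: "i < card G" for i
  proof -
    have "?c i \<in> P"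
      by (rule coeff_char_poly[OF _ _ _ _ _ i])
        (use idl_P x P_apply in \<open>auto intro: idlD idl_minus\<close>)
    moreover have "?c i \<in> V"
      using calculation idlD(1)[OF idl_P] S_F coeff_char_poly_in_F by blast
    ultimately obtain w where "w \<in> V" "?c i = \<pi> * w"
      using P_V by blast
    then have "?c i \<in> piS"
      using V_in_S unif_S_in_piS by simp
    then show ?thesis
      by (rule idlD(5)[OF idl_piS S_power[OF xS]])
  qed
  then have "(\<Sum>i<card G. ?c i * x ^ i) \<in> piS"
    by (intro idl_sum[OF idl_piS]) auto
  then show ?thesis
    unfolding eq by (rule idl_minus[OF idl_piS])
qed

text \<open>The socle of \<open>S / \<pi> S\<close> is nonzero because \<open>P / \<pi> S\<close> is finitely generated and nil.\<close>

lemma socle_element: "\<exists>b\<in>S. b \<notin> piS \<and> (\<forall>x\<in>P. b * x \<in> piS)"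
proof -
  obtain ps where ps: "set ps \<subseteq> P" "P \<subseteq> vspan ps"
    using submodule_S_generated[of P] idl_P V_in_S by (auto simp: idl_def)
  have "\<exists>b\<in>S. b \<notin> piS \<and> (\<forall>x\<in>set ps. b * x \<in> piS)"
    using ps(1)
  proof (induction ps)
    case Nil
    have "1 \<notin> piS"
      using piS_subset_P maxidl_ex maxidl_one by (auto simp: P_def)
    then show ?case
      using S_one by auto
  next
    case (Cons p ps)
    then obtain b where b: "b \<in> S" "b \<notin> piS" "\<forall>x\<in>set ps. b * x \<in> piS"
      by auto
    have p: "p \<in> P" "p \<in> S"
      using Cons.prems idlD(1)[OF idl_P] by auto
    have "b * p ^ card G \<in> piS"
      using P_nil[OF p(1)] b(1) idlD(4)[OF idl_piS] by blast
    moreover have "\<not> b * p ^ 0 \<in> piS"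
      using b(2) by simp
    \<comment> \<open>The exponent at which multiplication by p first leads into \<pi> S. Then
      \<open>b * p ^ t\<close> is still outside \<pi> S, kills p modulo \<pi> S, and keeps killing
      the other generators.\<close>
    ultimately obtain t where t: "b * p ^ t \<notin> piS" "b * p ^ Suc t \<in> piS"
      using dec_induct[of 0 "card G" "\<lambda>t. b * p ^ t \<notin> piS"] by blast
    have "b * p ^ t * x \<in> piS" if "x \<in> set (p # ps)" for x
    proof (cases "x = p")
      case True
      then show ?thesis
        using t(2) by (simp add: mult.assoc mult.commute[of p])
    next
      case False
      then have "p ^ t * (b * x) \<in> piS"
        using b(3) that by (intro idlD(4)[OF idl_piS S_power[OF p(2)]]) auto
      then show ?thesis
        by (simp add: algebra_simps)
    qed
    then show ?case
      using t(1) S_mult[OF b(1) S_power[OF p(2)]] by blast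
  qed
  then obtain b where b: "b \<in> S" "b \<notin> piS" "\<forall>x\<in>set ps. b * x \<in> piS"
    by blast
  have "\<forall>x\<in>vspan ps. b * x \<in> piS"
    using b(3)
  proof (induction ps)
    case Nil
    then show ?case
      using idlD(2)[OF idl_piS] by simp
  next
    case (Cons p ps)
    have "b * (v * p + w) \<in> piS" if "v \<in> V" "w \<in> vspan ps" for v w
    proof -
      have "v * (b * p) \<in> piS" "b * w \<in> piS"
        using Cons that V_in_S idlD(4)[OF idl_piS] by auto
      then show ?thesis
        using idlD(3)[OF idl_piS] by (simp add: algebra_simps)
    qed
    then show ?case
      by auto
  qed
  then show ?thesis
    using b ps(2) by blast
qed

section \<open>The fractional ideal P^-1 and the product P^-1 P\<close>

definition Pinv :: "'k set"
  where "Pinv = {c. \<forall>x\<in>P. c * x \<in> S}"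

inductive_set PinvP :: "'k set"
  where
    zero: "0 \<in> PinvP"
  | step: "\<lbrakk>c \<in> Pinv; p \<in> P; x \<in> PinvP\<rbrakk> \<Longrightarrow> c * p + x \<in> PinvP"

lemma Pinv_mult: "\<lbrakk>a \<in> S; c \<in> Pinv\<rbrakk> \<Longrightarrow> a * c \<in> Pinv"
  by (auto simp: Pinv_def mult.assoc intro: S_mult)

lemma Pinv_apply:
  assumes "c \<in> Pinv" "\<sigma> \<in> G"
  shows "\<sigma> c \<in> Pinv"
  unfolding Pinv_def
proof (intro CollectI ballI)
  fix x
  assume "x \<in> P"
  then have "c * finv \<sigma> x \<in> S"
    using assms P_apply inv_in_G by (simp add: Pinv_def)
  then have "\<sigma> (c * finv \<sigma> x) \<in> S"
    by (rule S_apply[OF _ assms(2)])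
  then show "\<sigma> c * x \<in> S"
    using assms(2) by (simp add: G_mult G_apply_inv)
qed

text \<open>P^-1 P is G-stable, so it is S unless it lies in P. In the latter case P^-1 maps P into
  itself, so its elements are almost integral and lie in S. The quotient b / \<pi> of a socle
  element b is in P^-1 but not in S.\<close>

lemma one_in_PinvP: "1 \<in> PinvP"
proof (rule G_stable_idl)
  show "idl PinvP"
  proof (rule idlI)
    show "PinvP \<subseteq> S"
    proof
      fix x
      assume "x \<in> PinvP"
      then show "x \<in> S"
        by induction (auto simp: Pinv_def intro: S_zero S_add)
    qed
    show "x + y \<in> PinvP" if "x \<in> PinvP" "y \<in> PinvP" for x y
      using that by induction (auto simp: add.assoc intro: PinvP.intros)
    show "a * x \<in> PinvP" if "a \<in> S" "x \<in> PinvP" for a x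
      using that(2)
    proof induction
      case (step c p x)
      then show ?case
        using PinvP.step[OF Pinv_mult[OF that(1)], of c p] by (simp add: algebra_simps)
    qed (simp add: PinvP.zero)
  qed (rule PinvP.zero)
  show "\<sigma> ` PinvP \<subseteq> PinvP" if "\<sigma> \<in> G" for \<sigma>
  proof (rule image_subsetI)
    fix x
    assume "x \<in> PinvP"
    then show "\<sigma> x \<in> PinvP"
    proof induction
      case (step c p x)
      then show ?case
        using that PinvP.step[OF Pinv_apply[OF _ that] P_apply[OF _ that], of c p]
        by (simp add: G_add G_mult)
    qed (simp add: G_zero that PinvP.zero)
  qed
  show "\<not> PinvP \<subseteq> P"
  proof
    assume *: "PinvP \<subseteq> P"
    obtain b where b: "b \<in> S" "b \<notin> piS" "\<forall>x\<in>P. b * x \<in> piS"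
      using socle_element by blast
    define c where "c = b / \<pi>"
    have c: "c \<in> Pinv"
      using b(3) unif_nonzero by (auto simp: c_def Pinv_def piS_def)
    have "c * x \<in> P" if "x \<in> P" for x
      using PinvP.step[OF c that PinvP.zero] * by auto
    then have "c ^ n * \<pi> \<in> P" for n
      by (induction n) (auto simp: unif_in_P mult.assoc)
    then have "\<pi> * c ^ n \<in> S" for n
      using idlD(1)[OF idl_P] by (metis mult.commute)
    then have "c \<in> S"
      using almost_integral unif_nonzero by blast
    then show False
      using b(2) unif_S_in_piS[of c] unif_nonzero by (simp add: c_def)
  qed
qed

text \<open>Guarantees that the \<open>GREATEST\<close> in \<open>ramification_index\<close> ranges
  over a bounded set. If \<pi> were in all powers of M, then for q outside M but in the other
  maximal ideals and c in P^-1, every \<pi> (c q)^k would lie in S, since c q maps M into S. Hence c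
  q is in S, so q P^-1 P lies in P, and q lies in P because P^-1 P contains 1.\<close>

lemma idpow_bounded:
  assumes M: "maxidl M"
  shows "\<exists>k. \<pi> \<notin> idpow M k"
proof (rule ccontr)
  assume "\<nexists>k. \<pi> \<notin> idpow M k"
  then have all: "\<pi> \<in> idpow M k" for k
    by blast
  obtain q where q: "q \<in> S" "q \<notin> M" "\<And>N. \<lbrakk>maxidl N; N \<noteq> M\<rbrakk> \<Longrightarrow> q \<in> N"
    using separating_element[OF M] by blast
  have qM: "q * m \<in> P" if "m \<in> M" for m
    unfolding P_def using that q idlD(1)[OF maxidl_idl[OF M]] by (auto intro: idlD maxidl_idl M)
  have cq: "c * q \<in> S" if c: "c \<in> Pinv" for c
  proof -
    have "\<forall>x\<in>idpow M k. (c * q) ^ k * x \<in> S" for k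
    proof (induction k)
      case (Suc k)
      show ?case
      proof
        fix x
        assume "x \<in> idpow M (Suc k)"
        then have "x \<in> idp (idpow M k) M"
          by simp
        then show "(c * q) ^ Suc k * x \<in> S"
        proof induction
          case (prod i j)
          then have "((c * q) ^ k * i) * (c * (q * j)) \<in> S"
            using Suc c qM by (auto simp: Pinv_def intro: S_mult)
          then show ?case
            by (simp add: algebra_simps)
        next
          case (sum x y)
          then show ?case
            by (simp add: distrib_left S_add)
        qed
      qed
    qed simp
    then have "\<pi> * (c * q) ^ n \<in> S" for n
      using all by (metis mult.commute)
    then show ?thesis
      using almost_integral unif_nonzero by blast
  qed
  have "q * x \<in> P" if "x \<in> PinvP" for x
    using that
  proof induction
    case (step c p x)
    then have "(c * q) * p \<in> P"
      using cq idlD(4)[OF idl_P] by blast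
    then have "(c * q) * p + q * x \<in> P"
      using idlD(3)[OF idl_P _ step.IH] by blast
    then show ?case
      by (simp add: algebra_simps)
  qed (simp add: idlD(2)[OF idl_P])
  then have "q \<in> P"
    using one_in_PinvP by fastforce
  then show False
    using q(2) M by (simp add: P_def)
qed

text \<open>If \<open>P \<noteq> \<pi> S\<close>, then the \<open>G\<close>-stable ideal \<open>\<pi> P\<^sup>-\<^sup>1\<close> is proper, hence contained in \<open>P\<close>, and
  \<open>\<pi> = \<pi> P\<^sup>-\<^sup>1 P \<in> P\<^sup>2\<close>.\<close>

lemma P_eq_piS:
  assumes unr: "\<And>M. maxidl M \<Longrightarrow> \<pi> \<notin> idpow M 2"
  shows "P = piS"
proof (rule ccontr)
  assume "P \<noteq> piS"
  then have nsub: "\<not> P \<subseteq> piS"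
    using piS_subset_P by blast
  let ?I = "(*) \<pi> ` Pinv"
  have "?I \<subseteq> P"
  proof (rule ccontr)
    assume *: "\<not> ?I \<subseteq> P"
    have "1 \<in> ?I"
    proof (rule G_stable_idl[OF _ _ *])
      show "idl ?I"
      proof (rule idlI)
        show "?I \<subseteq> S"
          using unif_in_P by (auto simp: Pinv_def mult.commute)
        show "0 \<in> ?I"
          by (rule image_eqI[of _ _ 0]) (auto simp: Pinv_def S_zero)
        show "x + y \<in> ?I" if xy: "x \<in> ?I" "y \<in> ?I" for x y
        proof -
          obtain c d where "c \<in> Pinv" "d \<in> Pinv" "x = \<pi> * c" "y = \<pi> * d"
            using xy by blast
          then have "x + y = \<pi> * (c + d)" "c + d \<in> Pinv"
            by (auto simp: Pinv_def distrib_left distrib_right S_add)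
          then show ?thesis
            by blast
        qed
        show "a * x \<in> ?I" if "a \<in> S" "x \<in> ?I" for a x
          using that Pinv_mult by (auto simp: mult.left_commute[of a])
      qed
      show "\<sigma> ` ?I \<subseteq> ?I" if "\<sigma> \<in> G" for \<sigma>
        using that Pinv_apply by (auto simp: G_mult G_unif)
    qed
    then obtain c where c: "c \<in> Pinv" "1 = \<pi> * c"
      by blast
    have "x \<in> piS" if "x \<in> P" for x
    proof -
      have "x = \<pi> * (c * x)"
        using c(2) by (simp add: mult.assoc[symmetric])
      moreover have "\<pi> * (c * x) \<in> piS"
        by (rule unif_S_in_piS) (use c(1) that in \<open>simp add: Pinv_def\<close>)
      ultimately show ?thesis
        by metis
    qed
    then show False
      using nsub by blast
  qed
  obtain M where M: "maxidl M"
    using maxidl_ex by blast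
  note M2 = idl_idpow[OF maxidl_idl[OF M], of 2]
  have "\<pi> * x \<in> idpow M 2" if "x \<in> PinvP" for x
    using that
  proof induction
    case (step c p x)
    then have "\<pi> * c \<in> M" "p \<in> M"
      using \<open>?I \<subseteq> P\<close> M by (auto simp: P_def)
    then have "(\<pi> * c) * p \<in> idpow M 2"
      by (rule mult_in_idpow_2[OF maxidl_idl[OF M]])
    then have "(\<pi> * c) * p + \<pi> * x \<in> idpow M 2"
      using idlD(3)[OF M2 _ step.IH] by blast
    then show ?case
      by (simp add: algebra_simps)
  qed (simp add: idlD(2)[OF M2])
  then show False
    using one_in_PinvP unr[OF M] by fastforce
qed

end

subsection \<open>Valuations\<close>

locale unramified_dvr_galois = dvr_galois V \<pi> G
  for V :: "'k::field set" and \<pi> :: 'k and G :: "('k \<Rightarrow> 'k) set" +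
  assumes P_eq: "P = piS"
begin

text \<open>q M lies in every maximal ideal, hence in P = \<pi> S. As q is a unit at M, the
  localization at M has its maximal ideal generated by \<pi>.\<close>

lemma local_uniformizer:
  assumes M: "maxidl M"
  obtains q where "q \<in> S" "q \<notin> M" "\<And>m. m \<in> M \<Longrightarrow> \<exists>s\<in>S. q * m = \<pi> * s"
    "\<And>N. \<lbrakk>maxidl N; N \<noteq> M\<rbrakk> \<Longrightarrow> q \<in> N"
proof -
  obtain q where q: "q \<in> S" "q \<notin> M" "\<And>N. \<lbrakk>maxidl N; N \<noteq> M\<rbrakk> \<Longrightarrow> q \<in> N"
    using separating_element[OF M] by blast
  have "\<exists>s\<in>S. q * m = \<pi> * s" if "m \<in> M" for m
  proof -
    have "q * m \<in> P"
      unfolding P_def using that q idlD(1)[OF maxidl_idl[OF M]] by (auto intro: idlD maxidl_idl M)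
    then show ?thesis
      by (auto simp: P_eq piS_def)
  qed
  then show ?thesis
    using that q by blast
qed

text \<open>The unit group of the localization of S at M, inside K.\<close>

definition loc_units :: "'k set \<Rightarrow> 'k set"
  where "loc_units M = {a / s | a s. a \<in> S - M \<and> s \<in> S - M}"

lemma S_minus_M_mult: "\<lbrakk>maxidl M; a \<in> S - M; b \<in> S - M\<rbrakk> \<Longrightarrow> a * b \<in> S - M"
  using maxidl_prime S_mult by blast

lemma S_minus_M_nonzero: "\<lbrakk>maxidl M; a \<in> S - M\<rbrakk> \<Longrightarrow> a \<noteq> 0"
  using idlD(2) maxidl_idl by blast

lemma loc_units_mult:
  assumes "maxidl M" "x \<in> loc_units M" "y \<in> loc_units M"
  shows "x * y \<in> loc_units M"
proof -
  obtain a s b t where "x = a / s" "y = b / t" "a \<in> S - M" "s \<in> S - M" "b \<in> S - M" "t \<in> S - M"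
    using assms unfolding loc_units_def by blast
  then have "x * y = (a * b) / (s * t)" "a * b \<in> S - M" "s * t \<in> S - M"
    using S_minus_M_mult[OF assms(1)] by auto
  then show ?thesis
    unfolding loc_units_def by blast
qed

lemma loc_units_inverse: "x \<in> loc_units M \<Longrightarrow> inverse x \<in> loc_units M"
  unfolding loc_units_def by (force simp: inverse_eq_divide)

lemma S_minus_M_loc_unit: "\<lbrakk>maxidl M; a \<in> S - M\<rbrakk> \<Longrightarrow> a \<in> loc_units M"
  unfolding loc_units_def using S_one maxidl_one by (intro CollectI exI[of _ a] exI[of _ 1]) auto

text \<open>Splitting \<pi> off x lowers the exponent of \<pi> in the multiple x y by one. Thus k
  bounds the number of splittings before a value of x is available.\<close>

lemma S_factorization:
  assumes M: "maxidl M" and "x \<in> S" "y \<in> S" "x * y = \<pi> ^ k * s" "s \<in> S - M"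
  shows "\<exists>n. \<exists>u\<in>loc_units M. x = \<pi> ^ n * u"
  using assms(2-)
proof (induction k arbitrary: x s)
  case 0
  then have "x \<notin> M"
    using idlD(5)[OF maxidl_idl[OF M], of y x] by auto
  then show ?case
    using S_minus_M_loc_unit[OF M] 0 by (intro exI[of _ 0] bexI[of _ x]) auto
next
  case (Suc k)
  show ?case
  proof (cases "x \<in> M")
    case True
    obtain q where q: "q \<in> S" "q \<notin> M" "\<And>m. m \<in> M \<Longrightarrow> \<exists>s\<in>S. q * m = \<pi> * s"
      using local_uniformizer[OF M] by metis
    obtain x' where x': "x' \<in> S" "q * x = \<pi> * x'"
      using q(3) True by blast
    have "\<pi> * (x' * y) = q * (x * y)"
      using x'(2) by (metis mult.assoc)
    also have "\<dots> = \<pi> * (\<pi> ^ k * (q * s))"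
      by (simp add: Suc.prems(3) algebra_simps)
    finally have "x' * y = \<pi> ^ k * (q * s)"
      using unif_nonzero by simp
    moreover have "q * s \<in> S - M"
      using S_minus_M_mult[OF M] q Suc.prems(4) by blast
    ultimately obtain n u where u: "u \<in> loc_units M" "x' = \<pi> ^ n * u"
      using Suc.IH x'(1) Suc.prems(2) by blast
    have "q \<in> loc_units M" "q \<noteq> 0"
      using q S_minus_M_loc_unit[OF M] S_minus_M_nonzero[OF M] by blast+
    then have "x = \<pi> ^ Suc n * (u * inverse q)"
      using x'(2) u by (simp add: field_simps)
    moreover have "u * inverse q \<in> loc_units M"
      using \<open>q \<in> loc_units M\<close> loc_units_mult[OF M u(1)] loc_units_inverse by blast
    ultimately show ?thesis
      by blast
  next
    case False
    then show ?thesis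
      using S_minus_M_loc_unit[OF M] Suc.prems by (intro exI[of _ 0] bexI[of _ x]) auto
  qed
qed

text \<open>The norm is a multiple of x and equals a power of \<pi> times a unit of V.\<close>

lemma S_nonzero_factorization:
  assumes M: "maxidl M" and x: "x \<in> S" "x \<noteq> 0"
  shows "\<exists>n. \<exists>u\<in>loc_units M. x = \<pi> ^ n * u"
proof -
  obtain k u where ku: "u \<in> V" "inverse u \<in> V" "(\<Prod>\<sigma>\<in>G. \<sigma> x) = \<pi> ^ k * u"
    using V_cases[OF norm_in_V norm_nonzero] x by blast
  then have "u \<noteq> 0"
    using norm_nonzero[OF x(2)] by auto
  then have "x * ((\<Prod>\<sigma>\<in>G - {id}. \<sigma> x) * inverse u) = \<pi> ^ k * 1"
    using ku(3) unfolding norm_split by (simp add: field_simps)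
  then show ?thesis
    using S_factorization[OF M x(1)] norm_cofactor_in_S[OF x(1)] V_in_S[OF ku(2)] S_mult S_one maxidl_one[OF M]
    by blast
qed

lemma factorization:
  assumes M: "maxidl M" and x: "x \<noteq> 0"
  shows "\<exists>n::int. \<exists>u\<in>loc_units M. x = \<pi> powi n * u"
proof -
  obtain k where k: "\<pi> ^ k * x \<in> S"
    using S_scale by blast
  then obtain n u where u: "u \<in> loc_units M" "\<pi> ^ k * x = \<pi> ^ n * u"
    using S_nonzero_factorization[OF M k] x unif_nonzero by auto
  then have "x = \<pi> powi (int n - int k) * u"
    using unif_nonzero by (simp add: power_int_diff field_simps)
  then show ?thesis
    using u(1) by blast
qed

lemma unif_power_loc_unit:
  assumes M: "maxidl M" and n: "\<pi> powi n \<in> loc_units M"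
  shows "n = 0"
proof -
  have *: False if "\<pi> ^ k \<in> loc_units M" "k > 0" for k
  proof -
    obtain a s where as: "a \<in> S - M" "s \<in> S - M" "\<pi> ^ k = a / s"
      using \<open>\<pi> ^ k \<in> loc_units M\<close> unfolding loc_units_def by blast
    then have "a = \<pi> * (\<pi> ^ (k - 1) * s)"
      using \<open>k > 0\<close> S_minus_M_nonzero[OF M] by (cases k) (auto simp: field_simps)
    moreover have "\<pi> ^ (k - 1) * s \<in> S"
      using as S_mult V_in_S unif_power_in_V by blast
    ultimately have "a \<in> M"
      using idlD(5)[OF maxidl_idl[OF M] _ unif_in_maxidl[OF M]] by simp
    then show False
      using as by blast
  qed
  show ?thesis
  proof (cases "n \<ge> 0")
    case True
    then show ?thesis
      using *[of "nat n"] n by (cases "n = 0") (auto simp: power_int_def)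
  next
    case False
    have "\<pi> powi (- n) \<in> loc_units M"
      using loc_units_inverse[OF n] by (simp add: power_int_minus)
    then show ?thesis
      using *[of "nat (- n)"] False by (auto simp: power_int_def)
  qed
qed

text \<open>The normalized valuation at M. Its value at 0 is unspecified, hence the recurring
  assumption that arguments are nonzero.\<close>

definition ord :: "'k set \<Rightarrow> 'k \<Rightarrow> int"
  where "ord M x = (THE n. \<exists>u\<in>loc_units M. x = \<pi> powi n * u)"

lemma loc_units_nonzero: "\<lbrakk>maxidl M; u \<in> loc_units M\<rbrakk> \<Longrightarrow> u \<noteq> 0"
  unfolding loc_units_def using S_minus_M_nonzero by auto

lemma ord_eqI:
  assumes M: "maxidl M" and u: "u \<in> loc_units M" "x = \<pi> powi n * u"
  shows "ord M x = n"
  unfolding ord_def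
proof (rule the_equality)
  show "\<exists>u\<in>loc_units M. x = \<pi> powi n * u"
    using u by blast
  fix m
  assume "\<exists>u\<in>loc_units M. x = \<pi> powi m * u"
  then obtain w where w: "w \<in> loc_units M" "x = \<pi> powi m * w"
    by blast
  have "\<pi> powi (m - n) = u * inverse w"
    using u(2) w(2) unif_nonzero loc_units_nonzero[OF M w(1)] by (simp add: power_int_diff field_simps)
  then have "\<pi> powi (m - n) \<in> loc_units M"
    using loc_units_mult[OF M u(1) loc_units_inverse[OF w(1)]] by simp
  then show "m = n"
    using unif_power_loc_unit[OF M] by fastforce
qed

lemma ord_decomp:
  assumes "maxidl M" "x \<noteq> 0"
  obtains u where "u \<in> loc_units M" "x = \<pi> powi (ord M x) * u"
  using factorization[OF assms] ord_eqI[OF assms(1)] by metis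

lemma ord_mult:
  assumes M: "maxidl M" and "x \<noteq> 0" "y \<noteq> 0"
  shows "ord M (x * y) = ord M x + ord M y"
proof -
  obtain u w where uw: "u \<in> loc_units M" "x = \<pi> powi (ord M x) * u" "w \<in> loc_units M" "y = \<pi> powi (ord M y) * w"
    using ord_decomp[OF M] assms by metis
  have "x * y = (\<pi> powi (ord M x) * u) * (\<pi> powi (ord M y) * w)"
    using uw(2,4) by simp
  also have "\<dots> = \<pi> powi (ord M x + ord M y) * (u * w)"
    using unif_nonzero by (simp add: power_int_add)
  finally show ?thesis
    by (rule ord_eqI[OF M loc_units_mult[OF M uw(1,3)]])
qed

lemma ord_prod:
  assumes M: "maxidl M" and "finite I" "\<And>i. i \<in> I \<Longrightarrow> g i \<noteq> 0"
  shows "ord M (prod g I) = (\<Sum>i\<in>I. ord M (g i))"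
  using assms(2,3)
proof (induction I rule: finite_induct)
  case empty
  show ?case
    using ord_eqI[OF M S_minus_M_loc_unit[OF M], of 1 1 0] S_one maxidl_one[OF M] by simp
qed (simp add: ord_mult[OF M])

lemma ord_unif: "maxidl M \<Longrightarrow> ord M \<pi> = 1"
  using ord_eqI[OF _ S_minus_M_loc_unit, of M 1 \<pi> 1] S_one maxidl_one by simp

lemma ord_unit: "\<lbrakk>maxidl M; x \<in> S; x \<notin> M\<rbrakk> \<Longrightarrow> ord M x = 0"
  using ord_eqI[OF _ S_minus_M_loc_unit, of M x x 0] by simp

lemma ord_inverse:
  assumes M: "maxidl M" and "x \<noteq> 0"
  shows "ord M (inverse x) = - ord M x"
  using ord_mult[OF M assms(2), of "inverse x"] assms(2) ord_unit[OF M S_one maxidl_one[OF M]] by simp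

lemma ord_apply:
  assumes M: "maxidl M" and \<sigma>: "\<sigma> \<in> G" and x: "x \<noteq> 0"
  shows "ord (\<sigma> ` M) (\<sigma> x) = ord M x"
proof -
  obtain u where u: "u \<in> loc_units M" "x = \<pi> powi (ord M x) * u"
    using ord_decomp[OF M x] by metis
  obtain a s where as: "u = a / s" "a \<in> S - M" "s \<in> S - M"
    using u(1) unfolding loc_units_def by blast
  have "\<sigma> a \<in> S - \<sigma> ` M" "\<sigma> s \<in> S - \<sigma> ` M" "\<sigma> u = \<sigma> a / \<sigma> s"
    using as \<sigma> S_apply apply_mem_image_iff[OF \<sigma>] by (auto simp: G_divide)
  then have "\<sigma> u \<in> loc_units (\<sigma> ` M)"
    unfolding loc_units_def by blast
  moreover have "\<sigma> x = \<pi> powi (ord M x) * \<sigma> u"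
    by (subst u(2)) (simp add: G_mult G_power_int G_unif \<sigma>)
  ultimately show ?thesis
    by (rule ord_eqI[OF maxidl_apply[OF M \<sigma>]])
qed

lemma ord_nonneg_denominator:
  assumes M: "maxidl M" and "x \<noteq> 0" "ord M x \<ge> 0"
  obtains a s where "a \<in> S - M" "s \<in> S - M" "s * x = \<pi> ^ nat (ord M x) * a"
proof -
  obtain u where u: "u \<in> loc_units M" "x = \<pi> powi (ord M x) * u"
    using ord_decomp[OF M assms(2)] by metis
  obtain a s where as: "u = a / s" "a \<in> S - M" "s \<in> S - M"
    using u(1) unfolding loc_units_def by blast
  have "\<pi> powi (ord M x) = \<pi> ^ nat (ord M x)"
    using assms(3) by (simp add: power_int_def)
  then have "s * x = \<pi> ^ nat (ord M x) * a"
    using u(2) as S_minus_M_nonzero[OF M as(3)] by (simp add: field_simps)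
  then show ?thesis
    using that as by blast
qed

lemma ord_S_nonneg:
  assumes M: "maxidl M" and x: "x \<in> S" "x \<noteq> 0"
  shows "ord M x \<ge> 0"
proof -
  obtain n u where "u \<in> loc_units M" "x = \<pi> ^ n * u"
    using S_nonzero_factorization[OF M x] by blast
  then have "ord M x = int n"
    by (intro ord_eqI[OF M]) auto
  then show ?thesis
    by simp
qed

lemma ord_M_pos:
  assumes M: "maxidl M" and x: "x \<in> M" "x \<noteq> 0"
  shows "ord M x \<ge> 1"
proof (rule ccontr)
  assume *: "\<not> ?thesis"
  have xS: "x \<in> S"
    using x(1) idlD(1)[OF maxidl_idl[OF M]] by blast
  then have ord: "ord M x = 0"
    using * ord_S_nonneg[OF M _ x(2)] by fastforce
  then obtain a s where as: "a \<in> S - M" "s \<in> S - M" "s * x = \<pi> ^ nat (ord M x) * a"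
    using ord_nonneg_denominator[OF M x(2)] by (metis order_refl)
  then have "s * x = a"
    by (simp add: ord)
  then show False
    using as idlD(4)[OF maxidl_idl[OF M]] x(1) by blast
qed

lemma ord_pos_imp_M: "\<lbrakk>maxidl M; x \<in> S; ord M x \<ge> 1\<rbrakk> \<Longrightarrow> x \<in> M"
  using ord_unit by force

text \<open>S is the intersection of its localizations: the ideal of denominators of x is contained
  in no maximal ideal.\<close>

lemma mem_SI:
  assumes "x \<noteq> 0" "\<And>M. maxidl M \<Longrightarrow> ord M x \<ge> 0"
  shows "x \<in> S"
proof -
  let ?D = "{t \<in> S. t * x \<in> S}"
  have "1 \<in> ?D"
  proof (rule ccontr)
    assume "1 \<notin> ?D"
    moreover have "idl ?D"
      by (rule idlI) (auto simp: S_zero distrib_right mult.assoc intro: S_add S_mult)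
    ultimately obtain M where M: "maxidl M" "?D \<subseteq> M"
      using maxidl_exists by blast
    obtain a s where as: "a \<in> S - M" "s \<in> S - M" "s * x = \<pi> ^ nat (ord M x) * a"
      by (rule ord_nonneg_denominator[OF M(1) assms(1) assms(2)[OF M(1)]])
    then have "s \<in> ?D"
      using S_mult V_in_S unif_power_in_V by auto
    then show False
      using as M(2) by blast
  qed
  then show ?thesis
    by simp
qed

text \<open>Some s outside M makes s x a multiple of \<pi>^2. Writing 1 = b s + m with m in M, both
  b (s x) and m x lie in the square of M.\<close>

lemma ord_in_idpow_2:
  assumes M: "maxidl M" and x: "x \<in> S" "x \<noteq> 0" "ord M x \<ge> 2"
  shows "x \<in> idpow M 2"
proof -
  note M2 = idl_idpow[OF maxidl_idl[OF M], of 2]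
  have \<pi>M: "\<pi> \<in> M"
    by (rule unif_in_maxidl[OF M])
  obtain a s where as: "a \<in> S - M" "s \<in> S - M" "s * x = \<pi> ^ nat (ord M x) * a"
    using ord_nonneg_denominator[OF M x(2)] x(3) by (metis order_trans zero_le_numeral)
  define k where "k = nat (ord M x) - 2"
  have "nat (ord M x) = Suc (Suc k)"
    using x(3) by (simp add: k_def)
  then have sx: "s * x = (\<pi> ^ k * a) * (\<pi> * \<pi>)"
    using as(3) by (simp add: algebra_simps)
  obtain b m where bm: "b \<in> S" "m \<in> M" "b * s + m = 1"
    using maxidl_inverse[OF M] as(2) by blast
  have "x = b * (s * x) + m * x"
    using bm(3) by (metis distrib_right mult.assoc mult_1)
  also have "b * (s * x) = (b * (\<pi> ^ k * a)) * (\<pi> * \<pi>)"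
    by (simp add: sx mult.assoc)
  finally have "x = (b * (\<pi> ^ k * a)) * (\<pi> * \<pi>) + m * x" .
  moreover have "b * (\<pi> ^ k * a) \<in> S"
    using bm as by (auto intro: S_mult V_in_S unif_power_in_V)
  moreover have "x \<in> M"
    using ord_pos_imp_M[OF M x(1)] x(3) by simp
  ultimately show ?thesis
    using mult_in_idpow_2[OF maxidl_idl[OF M]] \<pi>M bm(2) idlD(3,4)[OF M2] by metis
qed

text \<open>Each factor from M turns one q into one \<pi>, and the same \<open>q * q\<close> serves
  all summands.\<close>

lemma idpow_2_denominator:
  assumes M: "maxidl M" and q: "\<And>m. m \<in> M \<Longrightarrow> \<exists>s\<in>S. q * m = \<pi> * s" and x: "x \<in> idpow M 2"
  shows "\<exists>s\<in>S. q * q * x = \<pi> * \<pi> * s"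
proof -
  have "x \<in> idp (idp S M) M"
    using x by (simp add: numeral_2_eq_2)
  then show ?thesis
  proof induction
    case (prod i j)
    have "i \<in> M"
      using prod(1) by induction (use idlD[OF maxidl_idl[OF M]] in auto)
    then obtain s t where "s \<in> S" "t \<in> S" "q * i = \<pi> * s" "q * j = \<pi> * t"
      using q prod(2) by blast
    then have "(q * i) * (q * j) = (\<pi> * s) * (\<pi> * t)"
      by simp
    then have "q * q * (i * j) = \<pi> * \<pi> * (s * t)"
      by (simp add: algebra_simps)
    then show ?case
      using S_mult \<open>s \<in> S\<close> \<open>t \<in> S\<close> by blast
  next
    case (sum x y)
    then show ?case
      by (metis S_add distrib_left)
  qed
qed

lemma idpow_2_ord:
  assumes M: "maxidl M" and x: "x \<in> idpow M 2" "x \<noteq> 0"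
  shows "ord M x \<ge> 2"
proof -
  obtain q where q: "q \<in> S" "q \<notin> M" "\<And>m. m \<in> M \<Longrightarrow> \<exists>s\<in>S. q * m = \<pi> * s"
    using local_uniformizer[OF M] by metis
  obtain s where s: "s \<in> S" "q * q * x = \<pi> * \<pi> * s"
    using idpow_2_denominator[OF M q(3) x(1)] by blast
  have q0: "q \<noteq> 0"
    using q S_minus_M_nonzero[OF M] by blast
  then have "s \<noteq> 0"
    using s(2) x(2) by auto
  have "ord M x = ord M (q * q * x)"
    using q0 x(2) ord_unit[OF M q(1,2)] by (simp add: ord_mult[OF M])
  also have "\<dots> = 2 + ord M s"
    unfolding s(2) using unif_nonzero \<open>s \<noteq> 0\<close> by (simp add: ord_mult[OF M] ord_unif[OF M])
  finally show ?thesis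
    using ord_S_nonneg[OF M s(1) \<open>s \<noteq> 0\<close>] by simp
qed

lemma pole_element:
  assumes M: "maxidl M"
  obtains b where "b \<noteq> 0" "ord M b = - 1" "\<And>N. \<lbrakk>maxidl N; N \<noteq> M\<rbrakk> \<Longrightarrow> ord N b \<ge> 1"
proof -
  obtain q where q: "q \<in> S" "q \<notin> M" "\<And>N. \<lbrakk>maxidl N; N \<noteq> M\<rbrakk> \<Longrightarrow> q \<in> N"
    using local_uniformizer[OF M] by metis
  have q0: "q \<noteq> 0"
    using q S_minus_M_nonzero[OF M] by blast
  \<comment> \<open>The square secures value at least 2 - 1 = 1 at the other maximal ideals, where q
    / \<pi> could have value 0; at M the element q is a unit and the value is -1.\<close>
  let ?b = "q * q * inverse \<pi>"
  have ord: "ord N ?b = 2 * ord N q - 1" if "maxidl N" for N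
    using q0 unif_nonzero that by (simp add: ord_mult ord_inverse ord_unif)
  have "ord M ?b = - 1"
    using ord[OF M] ord_unit[OF M q(1,2)] by simp
  moreover have "ord N ?b \<ge> 1" if "maxidl N" "N \<noteq> M" for N
    using ord[OF that(1)] ord_M_pos[OF that(1) q(3)[OF that] q0] by simp
  ultimately show ?thesis
    using that[of ?b] q0 unif_nonzero by simp
qed

end

subsection \<open>Inertia groups are trivial\<close>

text \<open>Separability of the residue extension, in the form that x is a simple root modulo M of a
  polynomial over V.\<close>

locale etale_dvr_galois = unramified_dvr_galois V \<pi> G
  for V :: "'k::field set" and \<pi> :: 'k and G :: "('k \<Rightarrow> 'k) set" +
  assumes separable: "\<lbrakk>maxidl M; x \<in> S\<rbrakk> \<Longrightarrow>
    \<exists>g. (\<forall>i. Polynomial.coeff g i \<in> V) \<and> poly g x \<in> M \<and> poly (pderiv g) x \<notin> M"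
begin

lemma poly_in_S:
  assumes "\<And>i. Polynomial.coeff g i \<in> S" "x \<in> S"
  shows "poly g x \<in> S"
  unfolding poly_altdef by (intro S_sum S_mult S_power assms)

text \<open>First-order Taylor expansion with remainder (y - x)^2 h, where h is built along the
  Horner scheme and so stays in S.\<close>

lemma taylor:
  assumes "\<And>i. Polynomial.coeff g i \<in> V" "x \<in> S" "y \<in> S"
  shows "\<exists>h\<in>S. poly g y - poly g x = (y - x) * (poly (pderiv g) x + (y - x) * h)"
  using assms(1)
proof (induction g)
  case 0
  show ?case
    using S_zero by auto
next
  case (pCons a g)
  have g: "Polynomial.coeff g i \<in> V" for i
    using pCons.prems[of "Suc i"] by simp
  obtain h where h: "h \<in> S" "poly g y - poly g x = (y - x) * (poly (pderiv g) x + (y - x) * h)"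
    using pCons.IH[OF g] by blast
  have "Polynomial.coeff (pderiv g) i \<in> S" for i
    unfolding coeff_pderiv by (intro V_in_S V_mult V_of_nat g)
  then have "poly (pderiv g) x + y * h \<in> S"
    using poly_in_S assms h(1) by (intro S_add S_mult) auto
  moreover have "poly (pCons a g) y - poly (pCons a g) x = y * (poly g y - poly g x) + (y - x) * poly g x"
    by (simp add: algebra_simps)
  then have "poly (pCons a g) y - poly (pCons a g) x =
      (y - x) * (poly (pderiv (pCons a g)) x + (y - x) * (poly (pderiv g) x + y * h))"
    by (simp only: h(2) pderiv_pCons poly_add poly_pCons) (simp add: algebra_simps)
  ultimately show ?case
    by blast
qed

text \<open>The n-th power of the maximal ideal of the localization at M, that is \<pi>^n times the
  localization. Unlike a condition on \<open>ord\<close>, it includes 0 and handles differences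
  directly.\<close>

definition loc_pow :: "'k set \<Rightarrow> nat \<Rightarrow> 'k set"
  where "loc_pow M n = {x. \<exists>s\<in>S - M. \<exists>t\<in>S. s * x = \<pi> ^ n * t}"

lemma loc_powI: "\<lbrakk>s \<in> S - M; t \<in> S; s * x = \<pi> ^ n * t\<rbrakk> \<Longrightarrow> x \<in> loc_pow M n"
  unfolding loc_pow_def by blast

lemma loc_pow_diff:
  assumes M: "maxidl M" and "x \<in> loc_pow M n" "y \<in> loc_pow M n"
  shows "x - y \<in> loc_pow M n"
proof -
  obtain s t s' t' where *: "s \<in> S - M" "t \<in> S" "s * x = \<pi> ^ n * t" "s' \<in> S - M" "t' \<in> S" "s' * y = \<pi> ^ n * t'"
    using assms unfolding loc_pow_def by blast
  have "(s * s') * (x - y) = s' * (s * x) - s * (s' * y)"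
    by (simp add: algebra_simps)
  then have "(s * s') * (x - y) = \<pi> ^ n * (s' * t - s * t')"
    unfolding *(3,6) by (simp add: algebra_simps)
  then show ?thesis
    using * by (intro loc_powI[of "s * s'" M "s' * t - s * t'"] S_minus_M_mult[OF M] S_diff S_mult) auto
qed

lemma loc_pow_cancel:
  assumes M: "maxidl M" and "w \<in> S - M" "w * x \<in> loc_pow M n"
  shows "x \<in> loc_pow M n"
proof -
  obtain s t where "s \<in> S - M" "t \<in> S" "s * (w * x) = \<pi> ^ n * t"
    using assms(3) unfolding loc_pow_def by blast
  then show ?thesis
    using S_minus_M_mult[OF M _ assms(2), of s] by (intro loc_powI[of "s * w" M t]) (auto simp: mult.assoc)
qed

lemma loc_pow_Suc:
  assumes M: "maxidl M" and m: "m \<in> M" and x: "x \<in> loc_pow M n"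
  shows "m * x \<in> loc_pow M (Suc n)"
proof -
  obtain q where q: "q \<in> S" "q \<notin> M" "\<And>m. m \<in> M \<Longrightarrow> \<exists>s\<in>S. q * m = \<pi> * s"
    using local_uniformizer[OF M] by metis
  obtain u where u: "u \<in> S" "q * m = \<pi> * u"
    using q(3) m by blast
  obtain s t where st: "s \<in> S - M" "t \<in> S" "s * x = \<pi> ^ n * t"
    using x unfolding loc_pow_def by blast
  have "(q * s) * (m * x) = (q * m) * (s * x)"
    by (simp add: algebra_simps)
  also have "\<dots> = (\<pi> * u) * (\<pi> ^ n * t)"
    by (simp only: u(2) st(3))
  also have "\<dots> = \<pi> ^ Suc n * (u * t)"
    by (simp add: algebra_simps)
  finally show ?thesis
    using q u st by (intro loc_powI[of "q * s" M "u * t"] S_minus_M_mult[OF M] S_mult) auto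
qed

lemma loc_pow_unif:
  assumes x: "x \<in> loc_pow M n"
  shows "\<pi> * x \<in> loc_pow M (Suc n)"
proof -
  obtain s t where st: "s \<in> S - M" "t \<in> S" "s * x = \<pi> ^ n * t"
    using x unfolding loc_pow_def by blast
  have "s * (\<pi> * x) = \<pi> * (s * x)"
    by (simp add: algebra_simps)
  then show ?thesis
    using st by (intro loc_powI[of s M t]) (simp_all add: mult.assoc)
qed

lemma loc_pow_all_zero:
  assumes M: "maxidl M" and "\<And>n. x \<in> loc_pow M n"
  shows "x = 0"
proof (rule ccontr)
  assume x: "x \<noteq> 0"
  obtain s t where st: "s \<in> S - M" "t \<in> S" "s * x = \<pi> ^ nat (ord M x + 1) * t"
    using assms(2) unfolding loc_pow_def by blast
  have s0: "s \<noteq> 0"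
    using S_minus_M_nonzero[OF M st(1)] .
  have t0: "t \<noteq> 0"
    using st(3) x s0 by auto
  have ord_pow: "ord M (\<pi> ^ k) = int k" for k
    using ord_prod[OF M, of "{..<k}" "\<lambda>_. \<pi>"] unif_nonzero ord_unif[OF M] by simp
  have "ord M x = ord M (s * x)"
    using ord_mult[OF M s0 x] ord_unit[OF M] st(1) by simp
  also have "\<dots> = int (nat (ord M x + 1)) + ord M t"
    unfolding st(3) using ord_mult[OF M _ t0] unif_nonzero ord_pow by simp
  finally show False
    using ord_S_nonneg[OF M st(2) t0] by linarith
qed

text \<open>If \<open>\<sigma>\<close> acts trivially on \<open>S / M\<close> and \<open>(\<sigma> - 1) S \<subseteq> M\<^sup>n\<close>, then \<open>\<sigma> - 1\<close> induces a \<open>V\<close>-derivation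
  into \<open>M\<^sup>n / M\<^sup>n\<^sup>+\<^sup>1\<close>, which kills \<open>M\<close> and hence vanishes by separability of \<open>S / M\<close>.\<close>

lemma inertia_trivial:
  assumes M: "maxidl M" and \<sigma>: "\<sigma> \<in> G" and triv: "\<And>x. x \<in> S \<Longrightarrow> \<sigma> x - x \<in> M"
  shows "\<sigma> = id"
proof -
  note MI = idlD[OF maxidl_idl[OF M]]
  have \<sigma>M: "\<sigma> x \<in> S - M" if x: "x \<in> S - M" for x
  proof -
    have "\<sigma> x \<notin> M"
    proof
      assume "\<sigma> x \<in> M"
      moreover have "\<sigma> x - x \<in> M"
        using x triv by blast
      ultimately have "\<sigma> x - (\<sigma> x - x) \<in> M"
        by (rule idl_diff[OF maxidl_idl[OF M]])
      then show False
        using x by simp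
    qed
    then show ?thesis
      using x S_apply \<sigma> by blast
  qed
  have "\<forall>x\<in>S. \<sigma> x - x \<in> loc_pow M n" for n
  proof (induction n)
    case 0
    then show ?case
      using S_one maxidl_one[OF M] S_diff S_apply \<sigma> by (auto simp: loc_pow_def intro!: bexI[of _ 1])
  next
    case (Suc n)
    have onM: "\<sigma> m - m \<in> loc_pow M (Suc n)" if m: "m \<in> M" for m
    proof -
      obtain q where q: "q \<in> S" "q \<notin> M" "\<And>m. m \<in> M \<Longrightarrow> \<exists>s\<in>S. q * m = \<pi> * s"
        using local_uniformizer[OF M] by metis
      obtain s where s: "s \<in> S" "q * m = \<pi> * s"
        using q(3) m by blast
      have "\<sigma> q * \<sigma> m = \<pi> * \<sigma> s"
        by (metis G_mult G_unif \<sigma> s(2))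
      \<comment> \<open>Each term on the right is an element of M times a difference already in
        \<open>loc_pow M n\<close>, so it gains one power; on the left, \<sigma> q is a unit at
        M.\<close>
      then have "\<sigma> q * (\<sigma> m - m) = \<pi> * (\<sigma> s - s) - m * (\<sigma> q - q)"
        using s(2) by (simp add: algebra_simps)
      moreover have "\<pi> * (\<sigma> s - s) - m * (\<sigma> q - q) \<in> loc_pow M (Suc n)"
        using Suc s(1) q(1) by (intro loc_pow_diff[OF M loc_pow_unif loc_pow_Suc[OF M m]]) auto
      ultimately have "\<sigma> q * (\<sigma> m - m) \<in> loc_pow M (Suc n)"
        by simp
      then show ?thesis
        using loc_pow_cancel[OF M \<sigma>M] q by blast
    qed
    show ?case
    proof
      fix x
      assume x: "x \<in> S"
      obtain g where g: "\<And>i. Polynomial.coeff g i \<in> V" "poly g x \<in> M" "poly (pderiv g) x \<notin> M"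
        using separable[OF M x] by blast
      have \<sigma>x: "\<sigma> x \<in> S"
        using x \<sigma> S_apply by blast
      obtain h where h: "h \<in> S" "poly g (\<sigma> x) - poly g x = (\<sigma> x - x) * (poly (pderiv g) x + (\<sigma> x - x) * h)"
        using taylor[OF g(1) x \<sigma>x] by blast
      have "\<sigma> (poly g x) = poly g (\<sigma> x)"
        unfolding poly_altdef by (simp add: G_sum G_mult G_power G_V \<sigma> g(1))
      \<comment> \<open>\<sigma> fixes the coefficients of g, so the Taylor difference is \<sigma> m
        - m for m = \<open>poly g x\<close> in M. The cofactor is a unit at M since it agrees with
        g'(x) modulo M, and it can be cancelled.\<close>
      then have "(\<sigma> x - x) * (poly (pderiv g) x + (\<sigma> x - x) * h) \<in> loc_pow M (Suc n)"
        using onM[OF g(2)] h(2) by simp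
      moreover have "poly (pderiv g) x + (\<sigma> x - x) * h \<in> S - M"
      proof -
        have hM: "(\<sigma> x - x) * h \<in> M"
          using MI(5)[OF h(1) triv[OF x]] .
        have "poly (pderiv g) x \<in> S"
          by (rule poly_in_S[OF _ x]) (unfold coeff_pderiv, intro V_in_S V_mult V_of_nat g)
        moreover have "poly (pderiv g) x + (\<sigma> x - x) * h \<notin> M"
          using idl_diff[OF maxidl_idl[OF M] _ hM, of "poly (pderiv g) x + (\<sigma> x - x) * h"] g(3) by auto
        ultimately show ?thesis
          using S_add MI(1)[OF hM] by blast
      qed
      ultimately show "\<sigma> x - x \<in> loc_pow M (Suc n)"
        using loc_pow_cancel[OF M] by (metis mult.commute)
    qed
  qed
  then have fixS: "\<sigma> x = x" if "x \<in> S" for x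
    using loc_pow_all_zero[OF M, of "\<sigma> x - x"] that by auto
  have "\<sigma> x = x" for x
  proof -
    obtain k where k: "\<pi> ^ k * x \<in> S"
      using S_scale by blast
    have "\<pi> ^ k * \<sigma> x = \<pi> ^ k * x"
      using fixS[OF k] by (simp add: G_mult G_power G_unif \<sigma>)
    then show ?thesis
      using unif_nonzero by simp
  qed
  then show ?thesis
    by auto
qed

text \<open>For fixed \<sigma>, the values at the identity of functions in \<open>E S\<close>
  vanishing at \<sigma> form an ideal containing all x - \<sigma> x. If it were inside some M, then
  \<sigma> would be in the inertia group of M.\<close>

lemma delta_in_E_S: "\<delta> id \<in> E S"
proof (rule delta_in_E[OF S_one S_mult])
  fix \<sigma>
  assume \<sigma>: "\<sigma> \<in> G" "\<sigma> \<noteq> id"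
  let ?I = "{g id | g. g \<in> E S \<and> g \<sigma> = 0}"
  have E_S: "g \<rho> \<in> S" if "g \<in> E S" "\<rho> \<in> G" for g \<rho>
    using that
  proof (induction rule: E.induct)
    case (step g a b h)
    then show ?case
      using S_add S_mult S_apply by simp
  qed (simp add: S_zero)
  have "idl ?I"
  proof (rule idlI)
    show "?I \<subseteq> S"
      using E_S id_in_G by blast
    show "0 \<in> ?I"
      by (rule CollectI, rule exI[of _ "\<lambda>_. 0"]) (simp add: E.zero)
    show "x + y \<in> ?I" if xy: "x \<in> ?I" "y \<in> ?I" for x y
    proof -
      obtain g h where "x = g id" "y = h id" "g \<in> E S" "h \<in> E S" "g \<sigma> = 0" "h \<sigma> = 0"
        using xy by blast
      then show ?thesis
        using E_add[of g S h] by (intro CollectI exI[of _ "\<lambda>\<rho>. g \<rho> + h \<rho>"] conjI) simp_all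
    qed
    show "a * x \<in> ?I" if ax: "a \<in> S" "x \<in> ?I" for a x
    proof -
      obtain g where g: "x = g id" "g \<in> E S" "g \<sigma> = 0"
        using ax by blast
      have "(\<lambda>\<rho>. a * \<rho> 1 * g \<rho>) \<in> E S"
        by (rule E_monomial_mult[OF S_mult g(2) ax(1) S_one])
      then show ?thesis
        using g by (intro CollectI exI[of _ "\<lambda>\<rho>. a * \<rho> 1 * g \<rho>"] conjI) simp_all
    qed
  qed
  have "1 \<in> ?I"
  proof (rule ccontr)
    assume "1 \<notin> ?I"
    then obtain M where M: "maxidl M" "?I \<subseteq> M"
      using maxidl_exists \<open>idl ?I\<close> by blast
    have "\<sigma> x - x \<in> M" if x: "x \<in> S" for x
    proof -
      have "(\<lambda>\<rho>. 1 * \<rho> x + (- \<sigma> x) * \<rho> 1) \<in> E S"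
        by (intro E_add) (rule E_monomial[OF S_one x refl], rule E_monomial[OF S_minus[OF S_apply[OF x \<sigma>(1)]] S_one refl])
      moreover have "1 * \<sigma> x + (- \<sigma> x) * \<sigma> 1 = 0"
        by (simp add: G_one \<sigma>(1))
      ultimately have "1 * id x + (- \<sigma> x) * id 1 \<in> ?I"
        by (intro CollectI exI[of _ "\<lambda>\<rho>. 1 * \<rho> x + (- \<sigma> x) * \<rho> 1"] conjI refl)
      then have "x - \<sigma> x \<in> M"
        using M(2) by auto
      then show ?thesis
        using idl_minus[OF maxidl_idl[OF M(1)], of "x - \<sigma> x"] by simp
    qed
    then show False
      using inertia_trivial[OF M(1) \<sigma>(1)] \<sigma>(2) by blast
  qed
  then show "\<exists>g \<in> E S. g id = 1 \<and> g \<sigma> = 0"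
    by force
qed

lemma delta_in_E_S_translate: "\<sigma> \<in> G \<Longrightarrow> \<delta> \<sigma> \<in> E S"
  by (rule delta_translate[OF delta_in_E_S]) (auto intro: S_apply[OF _ inv_in_G])

end

subsection \<open>Crossed products\<close>

text \<open>The homogeneous element \<open>a x_\<sigma>\<close> of the crossed product.\<close>

definition xmono :: "'k::field \<Rightarrow> ('k \<Rightarrow> 'k) \<Rightarrow> ('k \<Rightarrow> 'k) \<Rightarrow> 'k"
  where "xmono a \<sigma> \<rho> = (if \<rho> = \<sigma> then a else 0)"

lemma cp_scalar_eq_xmono: "cp_scalar c = xmono c id"
  by (simp add: cp_scalar_def xmono_def fun_eq_iff)

locale crossed = etale_dvr_galois V \<pi> G
  for V :: "'k::field set" and \<pi> :: 'k and G :: "('k \<Rightarrow> 'k) set" +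
  fixes f :: "('k \<Rightarrow> 'k) \<Rightarrow> ('k \<Rightarrow> 'k) \<Rightarrow> 'k"
  assumes f_in_S: "\<lbrakk>\<sigma> \<in> G; \<tau> \<in> G\<rbrakk> \<Longrightarrow> f \<sigma> \<tau> \<in> S"
    and f_nonzero: "\<lbrakk>\<sigma> \<in> G; \<tau> \<in> G\<rbrakk> \<Longrightarrow> f \<sigma> \<tau> \<noteq> 0"
    and cocycle: "\<lbrakk>\<sigma> \<in> G; \<tau> \<in> G; \<gamma> \<in> G\<rbrakk> \<Longrightarrow> \<sigma> (f \<tau> \<gamma>) * f \<sigma> (\<tau> \<circ> \<gamma>) = f \<sigma> \<tau> * f (\<sigma> \<circ> \<tau>) \<gamma>"
    and f_id_left: "\<sigma> \<in> G \<Longrightarrow> f id \<sigma> = 1"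
    and f_id_right: "\<sigma> \<in> G \<Longrightarrow> f \<sigma> id = 1"
begin

abbreviation "CP \<equiv> crossed_product G f"

abbreviation "Ord \<equiv> crossed_product_order G f S"

lemma CP_simps:
  "carrier CP = {a. \<forall>\<sigma>. \<sigma> \<notin> G \<longrightarrow> a \<sigma> = 0}"
  "\<one>\<^bsub>CP\<^esub> = xmono 1 id"
  "\<zero>\<^bsub>CP\<^esub> = (\<lambda>\<sigma>. 0)"
  "a \<oplus>\<^bsub>CP\<^esub> b = (\<lambda>\<sigma>. a \<sigma> + b \<sigma>)"
  by (auto simp: crossed_product_def xmono_def fun_eq_iff)

lemma CP_mult_outside: "\<rho> \<notin> G \<Longrightarrow> (a \<otimes>\<^bsub>CP\<^esub> b) \<rho> = 0"
proof -
  assume "\<rho> \<notin> G"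
  then have "{(\<sigma>, \<tau>). \<sigma> \<in> G \<and> \<tau> \<in> G \<and> \<sigma> \<circ> \<tau> = \<rho>} = {}"
    using comp_in_G by blast
  then show ?thesis
    unfolding crossed_product_def by (simp only: monoid.simps sum.empty)
qed

lemma CP_mult:
  assumes "\<rho> \<in> G"
  shows "(a \<otimes>\<^bsub>CP\<^esub> b) \<rho> = (\<Sum>\<sigma>\<in>G. a \<sigma> * \<sigma> (b (finv \<sigma> \<circ> \<rho>)) * f \<sigma> (finv \<sigma> \<circ> \<rho>))"
proof -
  let ?Q = "{(\<sigma>, \<tau>). \<sigma> \<in> G \<and> \<tau> \<in> G \<and> \<sigma> \<circ> \<tau> = \<rho>}"
  have "bij_betw (\<lambda>\<sigma>. (\<sigma>, finv \<sigma> \<circ> \<rho>)) G ?Q"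
    by (rule bij_betw_byWitness[where f' = fst])
      (auto simp: comp_assoc[symmetric] G_comp_inv G_inv_comp comp_in_G inv_in_G assms)
  from sum.reindex_bij_betw[OF this, of "\<lambda>(\<sigma>, \<tau>). a \<sigma> * \<sigma> (b \<tau>) * f \<sigma> \<tau>"] show ?thesis
    by (simp add: crossed_product_def)
qed

lemma inv_comp_cancel: "\<lbrakk>\<sigma> \<in> G\<rbrakk> \<Longrightarrow> finv \<sigma> \<circ> (\<sigma> \<circ> \<tau>) = \<tau>" "\<lbrakk>\<sigma> \<in> G\<rbrakk> \<Longrightarrow> \<sigma> \<circ> (finv \<sigma> \<circ> \<tau>) = \<tau>"
  "\<lbrakk>\<sigma> \<in> G\<rbrakk> \<Longrightarrow> (\<tau> \<circ> \<sigma>) \<circ> finv \<sigma> = \<tau>" "\<lbrakk>\<sigma> \<in> G\<rbrakk> \<Longrightarrow> (\<tau> \<circ> finv \<sigma>) \<circ> \<sigma> = \<tau>"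
  by (simp_all add: fun_eq_iff G_inv_apply G_apply_inv)

lemma finv_comp: "\<lbrakk>\<sigma> \<in> G; \<tau> \<in> G\<rbrakk> \<Longrightarrow> finv (\<sigma> \<circ> \<tau>) = finv \<tau> \<circ> finv \<sigma>"
  by (rule o_inv_distrib) (auto intro: bij_G)

lemma CP_mult_closed: "a \<otimes>\<^bsub>CP\<^esub> b \<in> carrier CP"
  by (simp add: CP_simps CP_mult_outside)

lemma CP_assoc:
  "(a \<otimes>\<^bsub>CP\<^esub> b) \<otimes>\<^bsub>CP\<^esub> c = a \<otimes>\<^bsub>CP\<^esub> (b \<otimes>\<^bsub>CP\<^esub> c)"
proof
  fix \<rho>
  show "((a \<otimes>\<^bsub>CP\<^esub> b) \<otimes>\<^bsub>CP\<^esub> c) \<rho> = (a \<otimes>\<^bsub>CP\<^esub> (b \<otimes>\<^bsub>CP\<^esub> c)) \<rho>"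
  proof (cases "\<rho> \<in> G")
    case True
    let ?t = "\<lambda>\<tau> \<sigma>. a \<tau> * \<tau> (b (finv \<tau> \<circ> \<sigma>)) * f \<tau> (finv \<tau> \<circ> \<sigma>) * \<sigma> (c (finv \<sigma> \<circ> \<rho>)) * f \<sigma> (finv \<sigma> \<circ> \<rho>)"
    have "((a \<otimes>\<^bsub>CP\<^esub> b) \<otimes>\<^bsub>CP\<^esub> c) \<rho> = (\<Sum>\<sigma>\<in>G. \<Sum>\<tau>\<in>G. ?t \<tau> \<sigma>)"
      by (simp add: CP_mult True sum_distrib_right)
    also have "\<dots> = (\<Sum>\<tau>\<in>G. \<Sum>\<sigma>\<in>G. ?t \<tau> \<sigma>)"
      by (rule sum.swap)
    also have "\<dots> = (\<Sum>\<tau>\<in>G. a \<tau> * \<tau> ((b \<otimes>\<^bsub>CP\<^esub> c) (finv \<tau> \<circ> \<rho>)) * f \<tau> (finv \<tau> \<circ> \<rho>))"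
    proof (intro sum.cong refl)
      fix \<tau>
      assume \<tau>: "\<tau> \<in> G"
      \<comment> \<open>After this substitution the two triple products match term by term, up to
        one instance of the cocycle identity.\<close>
      have "(\<Sum>\<sigma>\<in>G. ?t \<tau> \<sigma>) = (\<Sum>\<mu>\<in>G. ?t \<tau> (\<tau> \<circ> \<mu>))"
        by (rule sum.reindex_bij_betw[OF bij_betw_comp_left[OF \<tau>], symmetric])
      also have "\<dots> = (\<Sum>\<mu>\<in>G. a \<tau> * \<tau> (b \<mu> * \<mu> (c (finv \<mu> \<circ> (finv \<tau> \<circ> \<rho>))) * f \<mu> (finv \<mu> \<circ> (finv \<tau> \<circ> \<rho>))) * f \<tau> (finv \<tau> \<circ> \<rho>))"
      proof (intro sum.cong refl)
        fix \<mu>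
        assume \<mu>: "\<mu> \<in> G"
        let ?\<gamma> = "finv \<mu> \<circ> (finv \<tau> \<circ> \<rho>)"
        have \<gamma>: "?\<gamma> \<in> G" "\<mu> \<circ> ?\<gamma> = finv \<tau> \<circ> \<rho>"
          using \<tau> \<mu> True by (auto simp: comp_in_G inv_in_G inv_comp_cancel)
        have coc: "\<tau> (f \<mu> ?\<gamma>) * f \<tau> (finv \<tau> \<circ> \<rho>) = f \<tau> \<mu> * f (\<tau> \<circ> \<mu>) ?\<gamma>"
          using cocycle[OF \<tau> \<mu> \<gamma>(1)] \<gamma>(2) by simp
        have "?t \<tau> (\<tau> \<circ> \<mu>) = a \<tau> * \<tau> (b \<mu>) * \<tau> (\<mu> (c ?\<gamma>)) * (f \<tau> \<mu> * f (\<tau> \<circ> \<mu>) ?\<gamma>)"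
          using \<tau> \<mu> by (simp add: inv_comp_cancel finv_comp comp_assoc)
        also have "\<dots> = a \<tau> * \<tau> (b \<mu> * \<mu> (c ?\<gamma>) * f \<mu> ?\<gamma>) * f \<tau> (finv \<tau> \<circ> \<rho>)"
          unfolding coc[symmetric] by (simp add: G_mult \<tau>)
        finally show "?t \<tau> (\<tau> \<circ> \<mu>) = \<dots>" .
      qed
      also have "\<dots> = a \<tau> * \<tau> ((b \<otimes>\<^bsub>CP\<^esub> c) (finv \<tau> \<circ> \<rho>)) * f \<tau> (finv \<tau> \<circ> \<rho>)"
        using \<tau> True by (simp add: CP_mult comp_in_G inv_in_G G_sum sum_distrib_left sum_distrib_right)
      finally show "(\<Sum>\<sigma>\<in>G. ?t \<tau> \<sigma>) = a \<tau> * \<tau> ((b \<otimes>\<^bsub>CP\<^esub> c) (finv \<tau> \<circ> \<rho>)) * f \<tau> (finv \<tau> \<circ> \<rho>)" .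
    qed
    also have "\<dots> = (a \<otimes>\<^bsub>CP\<^esub> (b \<otimes>\<^bsub>CP\<^esub> c)) \<rho>"
      by (simp add: CP_mult True)
    finally show ?thesis .
  qed (simp add: CP_mult_outside)
qed

lemma xmono_mult_left:
  assumes "\<sigma> \<in> G" "\<rho> \<in> G"
  shows "(xmono a \<sigma> \<otimes>\<^bsub>CP\<^esub> b) \<rho> = a * \<sigma> (b (finv \<sigma> \<circ> \<rho>)) * f \<sigma> (finv \<sigma> \<circ> \<rho>)"
proof -
  have "(xmono a \<sigma> \<otimes>\<^bsub>CP\<^esub> b) \<rho> =
      (\<Sum>\<tau>\<in>G. if \<tau> = \<sigma> then a * \<tau> (b (finv \<tau> \<circ> \<rho>)) * f \<tau> (finv \<tau> \<circ> \<rho>) else 0)"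
    unfolding CP_mult[OF assms(2)] by (intro sum.cong refl) (simp add: xmono_def)
  then show ?thesis
    using assms(1) finite_G by simp
qed

lemma xmono_in_CP: "\<sigma> \<in> G \<Longrightarrow> xmono a \<sigma> \<in> carrier CP"
  by (auto simp: CP_simps xmono_def)

lemma xmono_mult:
  assumes "\<sigma> \<in> G" "\<tau> \<in> G"
  shows "xmono a \<sigma> \<otimes>\<^bsub>CP\<^esub> xmono b \<tau> = xmono (a * \<sigma> b * f \<sigma> \<tau>) (\<sigma> \<circ> \<tau>)"
proof
  fix \<rho>
  have "finv \<sigma> \<circ> \<rho> = \<tau> \<longleftrightarrow> \<rho> = \<sigma> \<circ> \<tau>"
    using assms(1) by (metis inv_comp_cancel(1,2))
  then show "(xmono a \<sigma> \<otimes>\<^bsub>CP\<^esub> xmono b \<tau>) \<rho> = xmono (a * \<sigma> b * f \<sigma> \<tau>) (\<sigma> \<circ> \<tau>) \<rho>"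
    using assms comp_in_G[OF assms]
    by (cases "\<rho> \<in> G") (auto simp: xmono_mult_left CP_mult_outside xmono_def G_zero)
qed

lemma scalar_mult: "a \<in> carrier CP \<Longrightarrow> xmono c id \<otimes>\<^bsub>CP\<^esub> a = (\<lambda>\<rho>. c * a \<rho>)"
proof
  fix \<rho>
  assume "a \<in> carrier CP"
  then show "(xmono c id \<otimes>\<^bsub>CP\<^esub> a) \<rho> = c * a \<rho>"
    by (cases "\<rho> \<in> G") (auto simp: xmono_mult_left id_in_G f_id_left CP_mult_outside CP_simps)
qed

lemma mult_scalar:
  assumes "a \<in> carrier CP"
  shows "a \<otimes>\<^bsub>CP\<^esub> xmono c id = (\<lambda>\<rho>. a \<rho> * \<rho> c)"
proof
  fix \<rho>
  show "(a \<otimes>\<^bsub>CP\<^esub> xmono c id) \<rho> = a \<rho> * \<rho> c"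
  proof (cases "\<rho> \<in> G")
    case True
    have "finv \<sigma> \<circ> \<rho> = id \<longleftrightarrow> \<sigma> = \<rho>" if "\<sigma> \<in> G" for \<sigma>
      using that True by (metis G_inv_comp comp_id inv_comp_cancel(2))
    then have "(a \<otimes>\<^bsub>CP\<^esub> xmono c id) \<rho> = (\<Sum>\<sigma>\<in>G. if \<sigma> = \<rho> then a \<sigma> * \<sigma> c else 0)"
      unfolding CP_mult[OF True]
      by (intro sum.cong refl) (auto simp: xmono_def G_zero f_id_right G_inv_comp)
    then show ?thesis
      using True finite_G by simp
  qed (use assms in \<open>auto simp: CP_mult_outside CP_simps\<close>)
qed

lemma ring_CP: "ring CP"
proof (rule ringI)
  show "abelian_group CP"
  proof (rule abelian_groupI)
    fix x
    assume "x \<in> carrier CP"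
    then show "\<exists>y\<in>carrier CP. y \<oplus>\<^bsub>CP\<^esub> x = \<zero>\<^bsub>CP\<^esub>"
      by (intro bexI[of _ "\<lambda>\<sigma>. - x \<sigma>"]) (auto simp: CP_simps)
  qed (auto simp: CP_simps fun_eq_iff)
  show "monoid CP"
  proof (rule monoidI)
    fix x
    assume x: "x \<in> carrier CP"
    show "\<one>\<^bsub>CP\<^esub> \<otimes>\<^bsub>CP\<^esub> x = x"
      using scalar_mult[OF x, of 1] by (simp add: CP_simps)
    show "x \<otimes>\<^bsub>CP\<^esub> \<one>\<^bsub>CP\<^esub> = x"
    proof
      fix \<rho>
      show "(x \<otimes>\<^bsub>CP\<^esub> \<one>\<^bsub>CP\<^esub>) \<rho> = x \<rho>"
        using mult_scalar[OF x, of 1] x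
        by (cases "\<rho> \<in> G") (auto simp: CP_simps(2) G_one CP_mult_outside CP_simps(1))
    qed
  qed (auto simp: CP_mult_closed CP_assoc CP_simps(2) xmono_in_CP id_in_G)
  fix x y z
  assume "x \<in> carrier CP" "y \<in> carrier CP" "z \<in> carrier CP"
  show "(x \<oplus>\<^bsub>CP\<^esub> y) \<otimes>\<^bsub>CP\<^esub> z = x \<otimes>\<^bsub>CP\<^esub> z \<oplus>\<^bsub>CP\<^esub> y \<otimes>\<^bsub>CP\<^esub> z"
  proof
    fix \<rho>
    show "((x \<oplus>\<^bsub>CP\<^esub> y) \<otimes>\<^bsub>CP\<^esub> z) \<rho> = (x \<otimes>\<^bsub>CP\<^esub> z \<oplus>\<^bsub>CP\<^esub> y \<otimes>\<^bsub>CP\<^esub> z) \<rho>"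
      unfolding CP_simps(4)
      by (cases "\<rho> \<in> G") (simp_all add: CP_mult CP_mult_outside distrib_right sum.distrib)
  qed
  show "z \<otimes>\<^bsub>CP\<^esub> (x \<oplus>\<^bsub>CP\<^esub> y) = z \<otimes>\<^bsub>CP\<^esub> x \<oplus>\<^bsub>CP\<^esub> z \<otimes>\<^bsub>CP\<^esub> y"
  proof
    fix \<rho>
    show "(z \<otimes>\<^bsub>CP\<^esub> (x \<oplus>\<^bsub>CP\<^esub> y)) \<rho> = (z \<otimes>\<^bsub>CP\<^esub> x \<oplus>\<^bsub>CP\<^esub> z \<otimes>\<^bsub>CP\<^esub> y) \<rho>"
      unfolding CP_simps(4)
      by (cases "\<rho> \<in> G")
        (simp_all add: CP_mult CP_mult_outside distrib_left distrib_right sum.distrib G_add)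
  qed
qed

lemma CP_minus:
  assumes "a \<in> carrier CP"
  shows "\<ominus>\<^bsub>CP\<^esub> a = (\<lambda>\<rho>. - a \<rho>)"
proof -
  interpret ring CP
    by (rule ring_CP)
  show ?thesis
    by (rule minus_equality) (use assms in \<open>auto simp: CP_simps\<close>)
qed

subsection \<open>The groupoid of cocycle units\<close>

definition unit_at :: "('k \<Rightarrow> 'k) \<Rightarrow> 'k set \<Rightarrow> bool"
  where "unit_at \<sigma> M \<longleftrightarrow> f \<sigma> (finv \<sigma>) \<notin> M"

lemma S_mult_notin_iff: "\<lbrakk>maxidl M; x \<in> S; y \<in> S\<rbrakk> \<Longrightarrow> x * y \<notin> M \<longleftrightarrow> x \<notin> M \<and> y \<notin> M"
  using maxidl_prime idlD(4,5) maxidl_idl by metis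

lemma apply_mem_iff: "\<sigma> \<in> G \<Longrightarrow> \<sigma> x \<in> M \<longleftrightarrow> x \<in> finv \<sigma> ` M"
  by (simp add: mem_image_iff inv_in_G G_inv_inv)

lemma maxidl_apply_inv: "\<lbrakk>maxidl M; \<sigma> \<in> G\<rbrakk> \<Longrightarrow> maxidl (finv \<sigma> ` M)"
  by (rule maxidl_apply[OF _ inv_in_G])

lemma S_apply_f: "\<lbrakk>\<rho> \<in> G; \<sigma> \<in> G; \<tau> \<in> G\<rbrakk> \<Longrightarrow> \<rho> (f \<sigma> \<tau>) \<in> S"
  by (rule S_apply[OF f_in_S])

lemma comp_finv_comp: "\<lbrakk>\<sigma> \<in> G; \<tau> \<in> G\<rbrakk> \<Longrightarrow> \<tau> \<circ> finv (\<sigma> \<circ> \<tau>) = finv \<sigma>"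
  by (simp add: finv_comp inv_comp_cancel)

text \<open>This and the next two instances of the cocycle identity relate
  \<open>f \<sigma> \<tau>\<close> to values of f at pairs of mutually inverse elements, on which
  \<open>unit_at\<close> is based.\<close>

lemma cocycle_inv_comp:
  assumes "\<sigma> \<in> G" "\<tau> \<in> G"
  shows "\<sigma> (f \<tau> (finv (\<sigma> \<circ> \<tau>))) * f \<sigma> (finv \<sigma>) = f \<sigma> \<tau> * f (\<sigma> \<circ> \<tau>) (finv (\<sigma> \<circ> \<tau>))"
  using cocycle[OF assms inv_in_G[OF comp_in_G[OF assms]]] comp_finv_comp[OF assms] by simp

lemma cocycle_cancel_right:
  assumes "\<sigma> \<in> G" "\<tau> \<in> G"
  shows "\<sigma> (f \<tau> (finv \<tau>)) = f \<sigma> \<tau> * f (\<sigma> \<circ> \<tau>) (finv \<tau>)"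
  using cocycle[OF assms inv_in_G[OF assms(2)]] assms by (simp add: G_comp_inv f_id_right)

lemma cocycle_cancel_left:
  assumes "\<sigma> \<in> G" "\<tau> \<in> G"
  shows "\<sigma> (f (finv \<sigma>) (\<sigma> \<circ> \<tau>)) * f \<sigma> \<tau> = f \<sigma> (finv \<sigma>)"
  using cocycle[OF assms(1) inv_in_G[OF assms(1)] comp_in_G[OF assms]] assms
  by (simp add: G_comp_inv inv_comp_cancel f_id_left comp_in_G)

lemma unit_at_inv:
  assumes "\<sigma> \<in> G" "unit_at \<sigma> M"
  shows "unit_at (finv \<sigma>) (finv \<sigma> ` M)"
proof -
  have "\<sigma> (f (finv \<sigma>) \<sigma>) = f \<sigma> (finv \<sigma>)"
    using cocycle_cancel_left[OF assms(1) id_in_G] assms(1) by (simp add: f_id_right)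
  then show ?thesis
    using assms by (simp add: unit_at_def G_inv_inv apply_mem_iff[symmetric])
qed

text \<open>The product of \<open>x_\<sigma>\<close> and \<open>x_\<tau>\<close> is
  \<open>f \<sigma> \<tau>\<close> times the basis element of
  \<open>\<sigma> \<circ> \<tau>\<close>. If this is invertible at M, so is its left factor.\<close>

lemma unit_at_first_factor:
  assumes "maxidl M" "\<sigma> \<in> G" "\<tau> \<in> G" "f \<sigma> \<tau> \<notin> M" "unit_at (\<sigma> \<circ> \<tau>) M"
  shows "unit_at \<sigma> M"
proof -
  have "f \<sigma> \<tau> * f (\<sigma> \<circ> \<tau>) (finv (\<sigma> \<circ> \<tau>)) \<notin> M"
    using assms by (simp add: S_mult_notin_iff f_in_S comp_in_G inv_in_G unit_at_def)
  then have "\<sigma> (f \<tau> (finv (\<sigma> \<circ> \<tau>))) * f \<sigma> (finv \<sigma>) \<notin> M"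
    by (simp add: cocycle_inv_comp assms)
  then show ?thesis
    using assms S_apply_f[of \<sigma> \<tau> "finv (\<sigma> \<circ> \<tau>)"]
    by (simp add: S_mult_notin_iff f_in_S comp_in_G inv_in_G unit_at_def)
qed

lemma unit_at_imp_f_right:
  assumes "maxidl M" "\<sigma> \<in> G" "\<tau> \<in> G" "unit_at \<tau> (finv \<sigma> ` M)"
  shows "f \<sigma> \<tau> \<notin> M"
proof -
  have "\<sigma> (f \<tau> (finv \<tau>)) \<notin> M"
    using assms by (simp add: unit_at_def apply_mem_iff)
  then show ?thesis
    using assms by (simp add: cocycle_cancel_right S_mult_notin_iff f_in_S comp_in_G inv_in_G)
qed

lemma unit_at_imp_f_left:
  assumes "maxidl M" "\<sigma> \<in> G" "\<tau> \<in> G" "unit_at \<sigma> M"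
  shows "f \<sigma> \<tau> \<notin> M"
  using assms cocycle_cancel_left[OF assms(2,3)] S_apply_f[of \<sigma> "finv \<sigma>" "\<sigma> \<circ> \<tau>"]
    S_mult_notin_iff[OF assms(1), of "\<sigma> (f (finv \<sigma>) (\<sigma> \<circ> \<tau>))" "f \<sigma> \<tau>"]
  by (simp add: unit_at_def f_in_S comp_in_G inv_in_G)

lemma unit_at_comp:
  assumes M: "maxidl M" and G: "\<sigma> \<in> G" "\<tau> \<in> G" and u: "unit_at \<sigma> M" "unit_at \<tau> (finv \<sigma> ` M)"
  shows "unit_at (\<sigma> \<circ> \<tau>) M"
proof -
  have "f \<tau> (finv (\<sigma> \<circ> \<tau>)) \<notin> finv \<sigma> ` M"
    using unit_at_imp_f_left[OF maxidl_apply_inv[OF M G(1)] G(2) _ u(2)] G comp_in_G inv_in_G by blast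
  then have "\<sigma> (f \<tau> (finv (\<sigma> \<circ> \<tau>))) * f \<sigma> (finv \<sigma>) \<notin> M"
    using u(1) G S_apply_f[of \<sigma> \<tau> "finv (\<sigma> \<circ> \<tau>)"]
    by (simp add: S_mult_notin_iff[OF M] apply_mem_iff unit_at_def f_in_S comp_in_G inv_in_G)
  then show ?thesis
    using G by (simp add: cocycle_inv_comp S_mult_notin_iff[OF M] f_in_S comp_in_G inv_in_G unit_at_def)
qed

subsection \<open>Graded ideals\<close>

lemma Ord_iff: "a \<in> Ord \<longleftrightarrow> a \<in> carrier CP \<and> (\<forall>\<sigma>\<in>G. a \<sigma> \<in> S)"
  by (simp add: crossed_product_order_def)

text \<open>A radical condition is imposed only at the M where \<open>x_\<sigma>\<close> is
  invertible; elsewhere \<open>x_\<sigma>\<close> itself is locally in the radical. C collects the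
  maximal ideals at which the condition is waived altogether.\<close>

definition graded_comp :: "'k set set \<Rightarrow> ('k \<Rightarrow> 'k) \<Rightarrow> 'k set"
  where "graded_comp C \<sigma> = {a \<in> S. \<forall>M. maxidl M \<and> M \<notin> C \<and> unit_at \<sigma> M \<longrightarrow> a \<in> M}"

text \<open>For \<open>C = {}\<close> this is the Jacobson radical of the order.\<close>

definition graded_ideal :: "'k set set \<Rightarrow> (('k \<Rightarrow> 'k) \<Rightarrow> 'k) set"
  where "graded_ideal C = {a \<in> carrier CP. \<forall>\<sigma>\<in>G. a \<sigma> \<in> graded_comp C \<sigma>}"

text \<open>No arrow leads from outside C into C. As arrows have inverses, C is then a union of
  connected components of the groupoid.\<close>

definition unit_closed :: "'k set set \<Rightarrow> bool"
  where "unit_closed C \<longleftrightarrow> (\<forall>M \<sigma>. maxidl M \<and> \<sigma> \<in> G \<and> unit_at \<sigma> M \<and> M \<notin> C \<longrightarrow> finv \<sigma> ` M \<notin> C)"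

lemma idl_graded_comp: "idl (graded_comp C \<sigma>)"
  by (rule idlI) (auto simp: graded_comp_def intro: S_zero S_add S_mult idlD maxidl_idl)

lemma graded_ideal_subset: "graded_ideal C \<subseteq> Ord"
  by (auto simp: graded_ideal_def graded_comp_def Ord_iff)

text \<open>Where \<open>\<sigma> \<circ> \<tau>\<close> is invertible at M, either
  \<open>f \<sigma> \<tau>\<close> is in M or \<sigma> is invertible at M as well, and then a is in
  M. The ideal M stays the same throughout.\<close>

lemma graded_comp_mult_right:
  assumes "a \<in> graded_comp C \<sigma>" "\<sigma> \<in> G" "\<tau> \<in> G" "b \<in> S"
  shows "a * \<sigma> b * f \<sigma> \<tau> \<in> graded_comp C (\<sigma> \<circ> \<tau>)"
  unfolding graded_comp_def
proof (intro CollectI conjI allI impI)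
  have aS: "a \<in> S"
    using assms(1) by (simp add: graded_comp_def)
  show "a * \<sigma> b * f \<sigma> \<tau> \<in> S"
    using aS assms by (intro S_mult S_apply[OF assms(4,2)] f_in_S)
  fix M
  assume M: "maxidl M \<and> M \<notin> C \<and> unit_at (\<sigma> \<circ> \<tau>) M"
  note MI = idlD[OF maxidl_idl[of M]]
  show "a * \<sigma> b * f \<sigma> \<tau> \<in> M"
  proof (cases "f \<sigma> \<tau> \<in> M")
    case True
    then show ?thesis
      using M MI(4) aS S_mult S_apply[OF assms(4,2)] by blast
  next
    case False
    then have "a \<in> M"
      using assms M unit_at_first_factor[of M \<sigma> \<tau>] by (auto simp: graded_comp_def)
    then show ?thesis
      using M MI(5) S_apply[OF assms(4,2)] f_in_S[OF assms(2,3)] by blast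
  qed
qed

lemma graded_comp_mult_left:
  assumes C: "unit_closed C" and "a \<in> graded_comp C \<sigma>" "\<sigma> \<in> G" "\<tau> \<in> G" "b \<in> S"
  shows "b * \<tau> a * f \<tau> \<sigma> \<in> graded_comp C (\<tau> \<circ> \<sigma>)"
  unfolding graded_comp_def
proof (intro CollectI conjI allI impI)
  have \<tau>a: "\<tau> a \<in> S"
    using assms(2) S_apply[OF _ assms(4)] by (simp add: graded_comp_def)
  show "b * \<tau> a * f \<tau> \<sigma> \<in> S"
    using \<tau>a assms by (intro S_mult f_in_S)
  fix M
  assume M: "maxidl M \<and> M \<notin> C \<and> unit_at (\<tau> \<circ> \<sigma>) M"
  then have M1: "maxidl M"
    by blast
  note MI = idlD[OF maxidl_idl[OF M1]]
  show "b * \<tau> a * f \<tau> \<sigma> \<in> M"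
  proof (cases "f \<tau> \<sigma> \<in> M")
    case True
    then show ?thesis
      using MI(4) assms(5) S_mult \<tau>a by blast
  next
    case False
    then have u: "unit_at \<tau> M"
      using assms M unit_at_first_factor[of M \<tau> \<sigma>] by blast
    have N: "maxidl (finv \<tau> ` M)"
      using M1 assms(4) by (rule maxidl_apply_inv)
    have "unit_at (finv \<tau> \<circ> (\<tau> \<circ> \<sigma>)) (finv \<tau> ` M)"
      using M assms unit_at_inv[OF assms(4) u]
      by (intro unit_at_comp[OF N]) (auto simp: inv_in_G comp_in_G G_inv_inv image_inv_image)
    then have "unit_at \<sigma> (finv \<tau> ` M)"
      using assms by (simp add: inv_comp_cancel)
    moreover have "finv \<tau> ` M \<notin> C"
      using C M u assms(4) by (auto simp: unit_closed_def)
    ultimately have "a \<in> finv \<tau> ` M"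
      using assms(2) N by (auto simp: graded_comp_def)
    then have "\<tau> a \<in> M"
      using assms(4) by (simp add: apply_mem_iff)
    then show ?thesis
      using MI(4,5) f_in_S[OF assms(4,3)] assms(5) by blast
  qed
qed

lemma graded_ideal_mult:
  assumes "a \<in> carrier CP" "b \<in> carrier CP"
    and "\<And>\<sigma> \<tau>. \<lbrakk>\<sigma> \<in> G; \<tau> \<in> G\<rbrakk> \<Longrightarrow> a \<sigma> * \<sigma> (b \<tau>) * f \<sigma> \<tau> \<in> graded_comp C (\<sigma> \<circ> \<tau>)"
  shows "a \<otimes>\<^bsub>CP\<^esub> b \<in> graded_ideal C"
proof -
  have "(a \<otimes>\<^bsub>CP\<^esub> b) \<rho> \<in> graded_comp C \<rho>" if "\<rho> \<in> G" for \<rho>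
    unfolding CP_mult[OF that]
  proof (rule idl_sum[OF idl_graded_comp])
    fix \<sigma>
    assume "\<sigma> \<in> G"
    then show "a \<sigma> * \<sigma> (b (finv \<sigma> \<circ> \<rho>)) * f \<sigma> (finv \<sigma> \<circ> \<rho>) \<in> graded_comp C \<rho>"
      using assms(3)[of \<sigma> "finv \<sigma> \<circ> \<rho>"] that by (simp add: comp_in_G inv_in_G inv_comp_cancel)
  qed
  then show ?thesis
    by (simp add: graded_ideal_def CP_mult_closed)
qed

lemma graded_ideal_mult_right: "\<lbrakk>a \<in> graded_ideal C; b \<in> Ord\<rbrakk> \<Longrightarrow> a \<otimes>\<^bsub>CP\<^esub> b \<in> graded_ideal C"
  by (rule graded_ideal_mult) (auto simp: graded_ideal_def Ord_iff intro: graded_comp_mult_right)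

lemma graded_ideal_mult_left:
  "\<lbrakk>unit_closed C; a \<in> graded_ideal C; b \<in> Ord\<rbrakk> \<Longrightarrow> b \<otimes>\<^bsub>CP\<^esub> a \<in> graded_ideal C"
  by (rule graded_ideal_mult) (auto simp: graded_ideal_def Ord_iff intro: graded_comp_mult_left)

lemma graded_ideal_add: "\<lbrakk>a \<in> graded_ideal C; b \<in> graded_ideal C\<rbrakk> \<Longrightarrow> a \<oplus>\<^bsub>CP\<^esub> b \<in> graded_ideal C"
  using idlD(3)[OF idl_graded_comp] by (auto simp: graded_ideal_def CP_simps)

lemma graded_ideal_minus: "a \<in> graded_ideal C \<Longrightarrow> \<ominus>\<^bsub>CP\<^esub> a \<in> graded_ideal C"
  using idl_minus[OF idl_graded_comp] by (auto simp: graded_ideal_def CP_minus) (simp add: CP_simps)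

lemma graded_ideal_zero: "\<zero>\<^bsub>CP\<^esub> \<in> graded_ideal C"
  using idlD(2)[OF idl_graded_comp] by (auto simp: graded_ideal_def CP_simps)

lemma xmono_in_graded_ideal: "\<lbrakk>\<sigma> \<in> G; a \<in> graded_comp C \<sigma>\<rbrakk> \<Longrightarrow> xmono a \<sigma> \<in> graded_ideal C"
  using idlD(2)[OF idl_graded_comp] xmono_in_CP by (auto simp: graded_ideal_def xmono_def)

lemma xmono_in_Ord: "\<lbrakk>\<sigma> \<in> G; a \<in> S\<rbrakk> \<Longrightarrow> xmono a \<sigma> \<in> Ord"
  using xmono_in_CP S_zero by (auto simp: Ord_iff xmono_def)

lemma subring_Ord: "subring Ord CP"
proof (rule ring.subringI[OF ring_CP])
  show "Ord \<subseteq> carrier CP"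
    by (auto simp: Ord_iff)
  show "\<one>\<^bsub>CP\<^esub> \<in> Ord"
    unfolding CP_simps(2) by (rule xmono_in_Ord[OF id_in_G S_one])
  fix a b
  assume ab: "a \<in> Ord" "b \<in> Ord"
  show "\<ominus>\<^bsub>CP\<^esub> a \<in> Ord"
    using ab(1) S_minus by (auto simp: Ord_iff CP_minus) (simp add: CP_simps)
  show "a \<oplus>\<^bsub>CP\<^esub> b \<in> Ord"
    using ab S_add by (auto simp: Ord_iff CP_simps)
  have "(a \<otimes>\<^bsub>CP\<^esub> b) \<rho> \<in> S" if \<rho>: "\<rho> \<in> G" for \<rho>
    unfolding CP_mult[OF \<rho>]
  proof (rule S_sum)
    fix \<sigma>
    assume \<sigma>: "\<sigma> \<in> G"
    have "finv \<sigma> \<circ> \<rho> \<in> G"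
      using \<rho> \<sigma> by (simp add: comp_in_G inv_in_G)
    then show "a \<sigma> * \<sigma> (b (finv \<sigma> \<circ> \<rho>)) * f \<sigma> (finv \<sigma> \<circ> \<rho>) \<in> S"
      using ab \<sigma> by (intro S_mult S_apply[OF _ \<sigma>] f_in_S) (simp_all add: Ord_iff)
  qed
  then show "a \<otimes>\<^bsub>CP\<^esub> b \<in> Ord"
    by (simp add: Ord_iff CP_mult_closed)
qed

subsection \<open>Finitely generated submodules\<close>

lemma subring_scalars: "subring (cp_scalar ` V) CP"
proof (rule ring.subringI[OF ring_CP])
  show "cp_scalar ` V \<subseteq> carrier CP" "\<one>\<^bsub>CP\<^esub> \<in> cp_scalar ` V"
    using V_one by (auto simp: cp_scalar_eq_xmono CP_simps(2) xmono_in_CP id_in_G)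
  fix a b
  assume "a \<in> cp_scalar ` V" "b \<in> cp_scalar ` V"
  then obtain c d where cd: "c \<in> V" "d \<in> V" "a = xmono c id" "b = xmono d id"
    by (auto simp: cp_scalar_eq_xmono)
  have "\<ominus>\<^bsub>CP\<^esub> a = xmono (- c) id"
    unfolding cd(3) by (subst CP_minus[OF xmono_in_CP[OF id_in_G]]) (auto simp: xmono_def)
  then show "\<ominus>\<^bsub>CP\<^esub> a \<in> cp_scalar ` V"
    using V_minus[OF cd(1)] by (auto simp: cp_scalar_eq_xmono)
  have "a \<otimes>\<^bsub>CP\<^esub> b = xmono (c * d) id"
    using cd by (simp add: xmono_mult id_in_G f_id_left)
  then show "a \<otimes>\<^bsub>CP\<^esub> b \<in> cp_scalar ` V"
    using V_mult[OF cd(1,2)] by (auto simp: cp_scalar_eq_xmono)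
  have "a \<oplus>\<^bsub>CP\<^esub> b = xmono (c + d) id"
    unfolding cd by (auto simp: CP_simps xmono_def)
  then show "a \<oplus>\<^bsub>CP\<^esub> b \<in> cp_scalar ` V"
    using V_add[OF cd(1,2)] by (auto simp: cp_scalar_eq_xmono)
qed

lemma CP_submodule_of_Span:
  assumes "set Us \<subseteq> carrier CP" "N \<subseteq> ring.Span CP (cp_scalar ` V) Us" "\<zero>\<^bsub>CP\<^esub> \<in> N"
    and "\<And>x y. \<lbrakk>x \<in> N; y \<in> N\<rbrakk> \<Longrightarrow> x \<oplus>\<^bsub>CP\<^esub> y \<in> N"
    and "\<And>c x. \<lbrakk>c \<in> V; x \<in> N\<rbrakk> \<Longrightarrow> xmono c id \<otimes>\<^bsub>CP\<^esub> x \<in> N"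
  shows "\<exists>Ws. set Ws \<subseteq> N \<and> N = ring.Span CP (cp_scalar ` V) Ws"
proof (rule ring.submodule_of_Span[OF ring_CP subring_scalars _ assms(1-4)])
  fix I
  assume I: "I \<subseteq> cp_scalar ` V" "\<zero>\<^bsub>CP\<^esub> \<in> I"
    "\<And>k x. \<lbrakk>k \<in> cp_scalar ` V; x \<in> I\<rbrakk> \<Longrightarrow> k \<otimes>\<^bsub>CP\<^esub> x \<in> I"
  let ?I = "{c \<in> V. xmono c id \<in> I}"
  have mult: "xmono c id \<otimes>\<^bsub>CP\<^esub> xmono d id = xmono (c * d) id" for c d
    by (simp add: xmono_mult id_in_G f_id_left)
  have "\<exists>d\<in>?I. \<forall>x\<in>?I. \<exists>k\<in>V. x = k * d"
  proof (rule V_principal)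
    have "xmono 0 id = \<zero>\<^bsub>CP\<^esub>"
      by (auto simp: CP_simps xmono_def)
    then show "0 \<in> ?I"
      using I(2) V_zero by simp
    show "k * x \<in> ?I" if "k \<in> V" "x \<in> ?I" for k x
      using that I(3)[of "cp_scalar k" "xmono x id"] V_mult by (simp add: cp_scalar_eq_xmono mult)
  qed blast
  then obtain d where d: "d \<in> ?I" "\<And>x. x \<in> ?I \<Longrightarrow> \<exists>k\<in>V. x = k * d"
    by blast
  show "\<exists>d\<in>I. \<forall>x\<in>I. \<exists>k\<in>cp_scalar ` V. x = k \<otimes>\<^bsub>CP\<^esub> d"
  proof (rule bexI[of _ "xmono d id"], rule ballI)
    show "xmono d id \<in> I"
      using d(1) by blast
    fix x
    assume x: "x \<in> I"
    then obtain c where c: "c \<in> V" "x = xmono c id"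
      using I(1) by (auto simp: cp_scalar_eq_xmono)
    then obtain k where "k \<in> V" "c = k * d"
      using d(2) x by blast
    then show "\<exists>k\<in>cp_scalar ` V. x = k \<otimes>\<^bsub>CP\<^esub> xmono d id"
      by (auto simp: c(2) cp_scalar_eq_xmono mult)
  qed
qed (use assms(5) in \<open>auto simp: cp_scalar_eq_xmono\<close>)

lemma Span_scalar_map:
  assumes "set Us \<subseteq> carrier CP" "x \<in> ring.Span CP (cp_scalar ` V) Us" "c \<in> F"
  shows "xmono c id \<otimes>\<^bsub>CP\<^esub> x \<in> ring.Span CP (cp_scalar ` V) (map (\<lambda>u. xmono c id \<otimes>\<^bsub>CP\<^esub> u) Us)"
proof -
  interpret R: ring CP
    by (rule ring_CP)
  have xc: "xmono d id \<in> carrier CP" for d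
    by (rule xmono_in_CP[OF id_in_G])
  show ?thesis
    using assms(1,2)
  proof (induction Us arbitrary: x)
    case Nil
    then have "x = \<zero>\<^bsub>CP\<^esub>"
      by simp
    then have "xmono c id \<otimes>\<^bsub>CP\<^esub> x = \<zero>\<^bsub>CP\<^esub>"
      using R.r_null[OF xc] by blast
    then show ?case
      using R.Span_subring_closed(2)[OF subring_scalars, of "[]"] by (simp only: list.map list.set empty_subsetI)
  next
    case (Cons u Us)
    then obtain k w where kw: "k \<in> V" "w \<in> R.Span (cp_scalar ` V) Us" "x = xmono k id \<otimes>\<^bsub>CP\<^esub> u \<oplus>\<^bsub>CP\<^esub> w"
      unfolding R.Span_Cons_iff by (auto simp: cp_scalar_eq_xmono)
    have w: "w \<in> carrier CP"
      using R.Span_subring_closed(1)[OF subring_scalars, of Us] Cons.prems(1) kw(2) by auto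
    have "xmono c id \<otimes>\<^bsub>CP\<^esub> x = xmono k id \<otimes>\<^bsub>CP\<^esub> (xmono c id \<otimes>\<^bsub>CP\<^esub> u) \<oplus>\<^bsub>CP\<^esub> xmono c id \<otimes>\<^bsub>CP\<^esub> w"
      using Cons.prems(1) w xc
      by (simp add: kw(3) R.r_distr R.m_assoc[symmetric] xmono_mult id_in_G f_id_left mult.commute)
    moreover have "xmono c id \<otimes>\<^bsub>CP\<^esub> w \<in> R.Span (cp_scalar ` V) (map (\<lambda>u. xmono c id \<otimes>\<^bsub>CP\<^esub> u) Us)"
      by (rule Cons.IH[OF _ kw(2)]) (use Cons.prems(1) in auto)
    ultimately show ?case
      unfolding list.map R.Span_Cons_iff using kw(1) by (auto simp: cp_scalar_eq_xmono)
  qed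
qed

subsection \<open>Maximal orders\<close>

lemma exists_maximal_in_G:
  assumes "\<tau> \<in> G" "Q \<tau>"
  shows "\<exists>\<tau>\<in>G. Q \<tau> \<and> (\<forall>\<rho>\<in>G. Q \<rho> \<longrightarrow> m \<rho> \<le> (m \<tau> :: nat))"
proof -
  let ?A = "{\<tau>\<in>G. Q \<tau>}"
  have "finite ?A" "?A \<noteq> {}"
    using finite_G assms by auto
  then have "Max (m ` ?A) \<in> m ` ?A"
    by (intro Max_in) auto
  then obtain \<tau> where "\<tau> \<in> ?A" "m \<tau> = Max (m ` ?A)"
    by auto
  then show ?thesis
    using \<open>finite ?A\<close> by (intro bexI[of _ \<tau>]) auto
qed

text \<open>At \<open>M\<close>, the relation \<open>f \<sigma> (\<sigma>\<^sup>-\<^sup>1 \<tau>) \<notin> M\<close> between \<open>\<sigma>\<close> and \<open>\<tau>\<close> is a preorder, along which the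
  value of \<open>f \<tau> \<tau>\<^sup>-\<^sup>1\<close> at \<open>M\<close> increases. Hence some \<open>\<tau>\<close> of value at least 2 is maximal.\<close>

lemma maximal_nonhereditary_element:
  assumes M: "maxidl M" and \<tau>: "\<tau> \<in> G" "ord M (f \<tau> (finv \<tau>)) \<ge> 2"
  obtains \<tau> where "\<tau> \<in> G" "ord M (f \<tau> (finv \<tau>)) \<ge> 2"
    "\<And>\<rho>. \<lbrakk>\<rho> \<in> G; f \<tau> \<rho> \<notin> M\<rbrakk> \<Longrightarrow> unit_at \<rho> (finv \<tau> ` M)"
proof -
  \<comment> \<open>The lower set of \<tau> in the preorder. Maximizing its cardinality gives a
    maximal \<tau> without passing to equivalence classes.\<close>
  define D where "D \<tau> = {\<sigma> \<in> G. f \<sigma> (finv \<sigma> \<circ> \<tau>) \<notin> M}" for \<tau>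
  obtain \<tau> where \<tau>: "\<tau> \<in> G" "ord M (f \<tau> (finv \<tau>)) \<ge> 2"
    and max: "\<And>\<rho>. \<lbrakk>\<rho> \<in> G; ord M (f \<rho> (finv \<rho>)) \<ge> 2\<rbrakk> \<Longrightarrow> card (D \<rho>) \<le> card (D \<tau>)"
    using exists_maximal_in_G[of \<tau> "\<lambda>\<tau>. ord M (f \<tau> (finv \<tau>)) \<ge> 2" "\<lambda>\<tau>. card (D \<tau>)"] \<tau> by blast
  have "unit_at \<rho> (finv \<tau> ` M)" if \<rho>: "\<rho> \<in> G" "f \<tau> \<rho> \<notin> M" for \<rho>
  proof (rule ccontr)
    assume nu: "\<not> unit_at \<rho> (finv \<tau> ` M)"
    have \<tau>\<rho>: "\<tau> \<circ> \<rho> \<in> G"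
      by (rule comp_in_G[OF \<tau>(1) \<rho>(1)])
    have fS: "f \<sigma> \<mu> \<in> S" "f \<sigma> \<mu> \<noteq> 0" if "\<sigma> \<in> G" "\<mu> \<in> G" for \<sigma> \<mu>
      using that f_in_S f_nonzero by auto
    have "ord M (f (\<tau> \<circ> \<rho>) (finv (\<tau> \<circ> \<rho>))) \<ge> 2"
    proof -
      let ?x = "\<tau> (f \<rho> (finv (\<tau> \<circ> \<rho>)))"
      have x: "?x \<in> S" "?x \<noteq> 0"
        using \<tau> \<rho> \<tau>\<rho> by (auto simp: S_apply_f inv_in_G G_eq_zero_iff f_nonzero)
      have "ord M ?x + ord M (f \<tau> (finv \<tau>)) = ord M (f \<tau> \<rho>) + ord M (f (\<tau> \<circ> \<rho>) (finv (\<tau> \<circ> \<rho>)))"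
        using cocycle_inv_comp[OF \<tau>(1) \<rho>(1)] x fS \<tau> \<rho> \<tau>\<rho>
        by (simp add: ord_mult[OF M, symmetric] inv_in_G)
      then show ?thesis
        using ord_unit[OF M fS(1)[OF \<tau>(1) \<rho>(1)] \<rho>(2)] ord_S_nonneg[OF M x] \<tau>(2) by simp
    qed
    then have "card (D (\<tau> \<circ> \<rho>)) \<le> card (D \<tau>)"
      using max \<tau>\<rho> by blast
    moreover have "D \<tau> \<subset> D (\<tau> \<circ> \<rho>)"
    proof (rule psubsetI)
      show "D \<tau> \<subseteq> D (\<tau> \<circ> \<rho>)"
      proof
        fix \<sigma>
        assume "\<sigma> \<in> D \<tau>"
        then have \<sigma>: "\<sigma> \<in> G" "f \<sigma> (finv \<sigma> \<circ> \<tau>) \<notin> M"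
          by (auto simp: D_def)
        have st: "finv \<sigma> \<circ> \<tau> \<in> G"
          using \<sigma> \<tau> by (simp add: comp_in_G inv_in_G)
        have "\<sigma> (f (finv \<sigma> \<circ> \<tau>) \<rho>) * f \<sigma> (finv \<sigma> \<circ> (\<tau> \<circ> \<rho>)) = f \<sigma> (finv \<sigma> \<circ> \<tau>) * f \<tau> \<rho>"
          using cocycle[OF \<sigma>(1) st \<rho>(1)] \<sigma>(1) by (simp add: inv_comp_cancel comp_assoc)
        moreover have "f \<sigma> (finv \<sigma> \<circ> \<tau>) * f \<tau> \<rho> \<notin> M"
          using \<sigma> \<rho> \<tau> st fS by (simp add: S_mult_notin_iff[OF M])
        ultimately have "f \<sigma> (finv \<sigma> \<circ> (\<tau> \<circ> \<rho>)) \<notin> M"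
          using idlD(4)[OF maxidl_idl[OF M] S_apply_f[OF \<sigma>(1) st \<rho>(1)]] by metis
        then show "\<sigma> \<in> D (\<tau> \<circ> \<rho>)"
          using \<sigma>(1) by (simp add: D_def)
      qed
      have "\<tau> \<circ> \<rho> \<in> D (\<tau> \<circ> \<rho>)"
        using \<tau>\<rho> maxidl_one[OF M] by (simp add: D_def G_inv_comp f_id_right)
      moreover have "\<tau> \<circ> \<rho> \<notin> D \<tau>"
      proof
        assume "\<tau> \<circ> \<rho> \<in> D \<tau>"
        moreover have "finv (\<tau> \<circ> \<rho>) \<circ> \<tau> = finv \<rho>"
          using \<tau> \<rho> by (simp add: finv_comp inv_comp_cancel comp_assoc G_inv_comp)
        ultimately have "f (\<tau> \<circ> \<rho>) (finv \<rho>) \<notin> M"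
          by (simp add: D_def)
        then have "\<tau> (f \<rho> (finv \<rho>)) \<notin> M"
          using cocycle_cancel_right[OF \<tau>(1) \<rho>(1)] \<rho> \<tau> \<tau>\<rho> fS by (simp add: S_mult_notin_iff[OF M] inv_in_G)
        then show False
          using nu \<tau>(1) by (simp add: unit_at_def apply_mem_iff)
      qed
      ultimately show "D \<tau> \<noteq> D (\<tau> \<circ> \<rho>)"
        by blast
    qed
    ultimately show False
      using psubset_card_mono[of "D (\<tau> \<circ> \<rho>)" "D \<tau>"] finite_G by (simp add: D_def)
  qed
  then show ?thesis
    using that \<tau> by blast
qed

section \<open>The left order of the radical and the necessity of the criterion\<close>

definition left_order :: "(('k \<Rightarrow> 'k) \<Rightarrow> 'k) set"
  where "left_order = {x \<in> carrier CP. \<forall>j\<in>graded_ideal {}. x \<otimes>\<^bsub>CP\<^esub> j \<in> graded_ideal {}}"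

lemma unit_closed_empty: "unit_closed {}"
  by (simp add: unit_closed_def)

lemma Ord_subset_left_order: "Ord \<subseteq> left_order"
  using graded_ideal_mult_left[OF unit_closed_empty] by (auto simp: left_order_def Ord_iff)

lemma scalars_in_Ord: "cp_scalar ` V \<subseteq> Ord"
  using V_in_S id_in_G by (auto simp: cp_scalar_eq_xmono intro: xmono_in_Ord)

text \<open>The radical contains \<pi>, so the left order is contained in \<pi>^-1 times the given
  order. Finite generation passes to submodules because V is principal.\<close>

lemma left_order_is_order:
  assumes ord: "is_order CP (cp_scalar ` V) (cp_scalar ` F) Ord"
  shows "is_order CP (cp_scalar ` V) (cp_scalar ` F) left_order"
proof -
  interpret R: ring CP
    by (rule ring_CP)
  have J: "graded_ideal {} \<subseteq> carrier CP"
    using graded_ideal_subset[of "{}"] by (auto simp: Ord_iff)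
  have sub: "subring left_order CP"
  proof (rule R.subringI)
    show "left_order \<subseteq> carrier CP"
      by (auto simp: left_order_def)
    show "\<one>\<^bsub>CP\<^esub> \<in> left_order"
      using J by (auto simp: left_order_def)
    fix x y
    assume x: "x \<in> left_order" and y: "y \<in> left_order"
    have xy: "x \<in> carrier CP" "y \<in> carrier CP"
      using x y by (auto simp: left_order_def)
    show "\<ominus>\<^bsub>CP\<^esub> x \<in> left_order"
      using x xy J graded_ideal_minus[of _ "{}"]
      by (auto simp: left_order_def R.l_minus[symmetric] subset_iff)
        (metis R.l_minus graded_ideal_minus)
    show "x \<otimes>\<^bsub>CP\<^esub> y \<in> left_order"
      using x y xy J by (auto simp: left_order_def R.m_assoc subset_iff)
    show "x \<oplus>\<^bsub>CP\<^esub> y \<in> left_order"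
      using x y xy J graded_ideal_add by (auto simp: left_order_def R.l_distr subset_iff)
  qed
  have V_sub: "cp_scalar ` V \<subseteq> left_order"
    using scalars_in_Ord Ord_subset_left_order by blast
  obtain Us where Us: "set Us \<subseteq> Ord" "Ord = R.Span (cp_scalar ` V) Us"
    using ord unfolding is_order_def by blast
  let ?c = "inverse \<pi>"
  have cF: "?c \<in> F"
    by (simp add: F_def G_inverse G_unif)
  have UsC: "set Us \<subseteq> carrier CP"
    using Us(1) by (auto simp: Ord_iff)
  have "left_order \<subseteq> R.Span (cp_scalar ` V) (map (\<lambda>u. xmono ?c id \<otimes>\<^bsub>CP\<^esub> u) Us)"
  proof
    fix x
    assume x: "x \<in> left_order"
    then have xC: "x \<in> carrier CP"
      by (simp add: left_order_def)
    have "xmono \<pi> id \<in> graded_ideal {}"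
      by (rule xmono_in_graded_ideal[OF id_in_G]) (simp add: graded_comp_def S_unif unif_in_maxidl)
    then have "x \<otimes>\<^bsub>CP\<^esub> xmono \<pi> id \<in> Ord"
      using x graded_ideal_subset by (auto simp: left_order_def)
    moreover have "xmono ?c id \<otimes>\<^bsub>CP\<^esub> (x \<otimes>\<^bsub>CP\<^esub> xmono \<pi> id) = x"
    proof
      fix \<rho>
      have eq: "x \<rho> * \<rho> \<pi> = \<pi> * x \<rho>"
        using xC by (cases "\<rho> \<in> G") (auto simp: G_unif CP_simps)
      show "(xmono ?c id \<otimes>\<^bsub>CP\<^esub> (x \<otimes>\<^bsub>CP\<^esub> xmono \<pi> id)) \<rho> = x \<rho>"
        unfolding fun_cong[OF scalar_mult[OF CP_mult_closed]] fun_cong[OF mult_scalar[OF xC]]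
          eq
        using unif_nonzero by (simp add: mult.assoc[symmetric])
    qed
    ultimately show "x \<in> R.Span (cp_scalar ` V) (map (\<lambda>u. xmono ?c id \<otimes>\<^bsub>CP\<^esub> u) Us)"
      using Span_scalar_map[OF UsC _ cF] Us(2) by metis
  qed
  then have "\<exists>Ws. set Ws \<subseteq> left_order \<and> left_order = R.Span (cp_scalar ` V) Ws"
  proof (rule CP_submodule_of_Span[rotated])
    show "\<zero>\<^bsub>CP\<^esub> \<in> left_order"
      using subringE(2)[OF sub] .
    show "x \<oplus>\<^bsub>CP\<^esub> y \<in> left_order" if "x \<in> left_order" "y \<in> left_order" for x y
      using subringE(7)[OF sub that] .
    show "xmono c id \<otimes>\<^bsub>CP\<^esub> x \<in> left_order" if "c \<in> V" "x \<in> left_order" for c x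
      using subringE(6)[OF sub _ that(2), of "cp_scalar c"] V_sub that(1) by (auto simp: cp_scalar_eq_xmono)
  qed (use UsC xmono_in_CP[OF id_in_G] in auto)
  moreover have "\<forall>x\<in>carrier CP. \<exists>Us. set Us \<subseteq> left_order \<and> x \<in> R.Span (cp_scalar ` F) Us"
    using ord Ord_subset_left_order unfolding is_order_def by (meson subset_trans)
  ultimately show ?thesis
    unfolding is_order_def using sub V_sub by blast
qed

lemma maximal_order_imp_hereditary:
  assumes max: "maximal_order CP (cp_scalar ` V) (cp_scalar ` F) Ord"
    and M: "maxidl M" and "\<tau> \<in> G"
  shows "ord M (f \<tau> (finv \<tau>)) < 2"
proof (rule ccontr)
  assume "\<not> ?thesis"
  then obtain \<tau> where \<tau>: "\<tau> \<in> G" "ord M (f \<tau> (finv \<tau>)) \<ge> 2"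
    and \<tau>_max: "\<And>\<rho>. \<lbrakk>\<rho> \<in> G; f \<tau> \<rho> \<notin> M\<rbrakk> \<Longrightarrow> unit_at \<rho> (finv \<tau> ` M)"
    using maximal_nonhereditary_element[OF M \<open>\<tau> \<in> G\<close>] by (metis not_less)
  obtain b where b: "b \<noteq> 0" "ord M b = - 1" "\<And>N. \<lbrakk>maxidl N; N \<noteq> M\<rbrakk> \<Longrightarrow> ord N b \<ge> 1"
    using pole_element[OF M] by blast
  have "b * \<tau> a * f \<tau> \<rho> \<in> graded_comp {} (\<tau> \<circ> \<rho>)" if \<rho>: "\<rho> \<in> G" and a: "a \<in> graded_comp {} \<rho>" for \<rho> a
  proof (cases "a = 0")
    case True
    then show ?thesis
      using idlD(2)[OF idl_graded_comp] \<tau>(1) by (simp add: G_zero)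
  next
    case False
    have aS: "a \<in> S"
      using a by (simp add: graded_comp_def)
    have \<tau>\<rho>: "\<tau> \<circ> \<rho> \<in> G"
      by (rule comp_in_G[OF \<tau>(1) \<rho>])
    let ?x = "b * \<tau> a * f \<tau> \<rho>"
    have \<tau>a: "\<tau> a \<in> S" "\<tau> a \<noteq> 0"
      using S_apply[OF aS \<tau>(1)] False \<tau>(1) by (auto simp: G_eq_zero_iff)
    have f: "f \<tau> \<rho> \<in> S" "f \<tau> \<rho> \<noteq> 0"
      using f_in_S f_nonzero \<tau>(1) \<rho> by auto
    have x0: "?x \<noteq> 0"
      using b \<tau>a f by simp
    have ordx: "ord N ?x = ord N b + ord N (\<tau> a) + ord N (f \<tau> \<rho>)" if "maxidl N" for N
      using b \<tau>a f by (simp add: ord_mult[OF that])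
    have M_main: "ord M ?x \<ge> (if unit_at (\<tau> \<circ> \<rho>) M then 1 else 0)"
    proof -
      have \<tau>a0: "ord M (\<tau> a) \<ge> 0" and f0: "ord M (f \<tau> \<rho>) \<ge> 0"
        using ord_S_nonneg[OF M] \<tau>a f by auto
      \<comment> \<open>The value -1 of b has to be compensated. In (1) the result must even be in
        M, and the cocycle identity gives \<open>f \<tau> \<rho>\<close> value at least 2. In (2)
        the factor \<open>\<tau> a\<close> lies in M. In (3) the maximality of \<tau> puts
        \<open>f \<tau> \<rho>\<close> into M.\<close>
      consider (1) "unit_at (\<tau> \<circ> \<rho>) M" | (2) "\<not> unit_at (\<tau> \<circ> \<rho>) M" "unit_at \<rho> (finv \<tau> ` M)"
        | (3) "\<not> unit_at (\<tau> \<circ> \<rho>) M" "\<not> unit_at \<rho> (finv \<tau> ` M)"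
        by blast
      then show ?thesis
      proof cases
        case 1
        let ?y = "\<tau> (f \<rho> (finv (\<tau> \<circ> \<rho>)))"
        have y: "?y \<in> S" "?y \<noteq> 0"
          using \<tau> \<rho> \<tau>\<rho> by (auto simp: S_apply_f inv_in_G G_eq_zero_iff f_nonzero)
        have "ord M ?y + ord M (f \<tau> (finv \<tau>)) = ord M (f \<tau> \<rho>) + ord M (f (\<tau> \<circ> \<rho>) (finv (\<tau> \<circ> \<rho>)))"
          using cocycle_inv_comp[OF \<tau>(1) \<rho>] y f \<tau> \<rho> \<tau>\<rho> f_nonzero
          by (simp add: ord_mult[OF M, symmetric] inv_in_G)
        moreover have "ord M (f (\<tau> \<circ> \<rho>) (finv (\<tau> \<circ> \<rho>))) = 0"
          using 1 \<tau>\<rho> by (intro ord_unit[OF M]) (auto simp: unit_at_def f_in_S inv_in_G)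
        ultimately have "ord M (f \<tau> \<rho>) \<ge> 2"
          using ord_S_nonneg[OF M y] \<tau>(2) by linarith
        then show ?thesis
          using 1 ordx[OF M] b(2) \<tau>a0 by simp
      next
        case 2
        then have "a \<in> finv \<tau> ` M"
          using a maxidl_apply_inv[OF M \<tau>(1)] by (simp add: graded_comp_def)
        then have "\<tau> a \<in> M"
          using \<tau>(1) by (simp add: apply_mem_iff)
        then show ?thesis
          using 2 ordx[OF M] b(2) f0 ord_M_pos[OF M _ \<tau>a(2)] by simp
      next
        case 3
        then have "f \<tau> \<rho> \<in> M"
          using \<tau>_max[OF \<rho>] by blast
        then show ?thesis
          using 3 ordx[OF M] b(2) \<tau>a0 ord_M_pos[OF M _ f(2)] by simp
      qed
    qed
    have other: "ord N ?x \<ge> 1" if "maxidl N" "N \<noteq> M" for N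
      using ordx[OF that(1)] b(3)[OF that] ord_S_nonneg[OF that(1) \<tau>a] ord_S_nonneg[OF that(1) f] by simp
    have xS: "?x \<in> S"
    proof (rule mem_SI[OF x0])
      fix N
      assume N: "maxidl N"
      show "ord N ?x \<ge> 0"
        using M_main other[OF N] by (cases "N = M") (auto split: if_splits)
    qed
    have "?x \<in> N" if N: "maxidl N" "unit_at (\<tau> \<circ> \<rho>) N" for N
      using M_main other[OF N(1)] N(2) by (intro ord_pos_imp_M[OF N(1) xS]) (cases "N = M", auto)
    then show ?thesis
      using xS by (auto simp: graded_comp_def)
  qed
  note key = this
  have "xmono b \<tau> \<in> left_order"
    unfolding left_order_def
  proof (intro CollectI conjI ballI)
    show xb: "xmono b \<tau> \<in> carrier CP"
      by (rule xmono_in_CP[OF \<tau>(1)])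
    fix j
    assume j: "j \<in> graded_ideal {}"
    show "xmono b \<tau> \<otimes>\<^bsub>CP\<^esub> j \<in> graded_ideal {}"
    proof (rule graded_ideal_mult[OF xb])
      show "j \<in> carrier CP"
        using j by (simp add: graded_ideal_def)
      fix \<sigma> \<rho>
      assume "\<sigma> \<in> G" "\<rho> \<in> G"
      then show "xmono b \<tau> \<sigma> * \<sigma> (j \<rho>) * f \<sigma> \<rho> \<in> graded_comp {} (\<sigma> \<circ> \<rho>)"
        using key[of \<rho> "j \<rho>"] j idlD(2)[OF idl_graded_comp]
        by (cases "\<sigma> = \<tau>") (auto simp: xmono_def graded_ideal_def)
    qed
  qed
  moreover have "left_order = Ord"
    using max left_order_is_order Ord_subset_left_order unfolding maximal_order_def by blast
  ultimately have "b \<in> S"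
    using \<tau>(1) by (auto simp: Ord_iff xmono_def dest: bspec[of _ _ \<tau>])
  then show False
    using ord_S_nonneg[OF M _ b(1)] b(2) by simp
qed

end

subsection \<open>Maximal left ideals and primary rings\<close>

context ring
begin

lemma left_idealI:
  assumes "I \<subseteq> carrier R" "\<zero> \<in> I" "\<And>x y. \<lbrakk>x \<in> I; y \<in> I\<rbrakk> \<Longrightarrow> x \<oplus> y \<in> I"
    and "\<And>r x. \<lbrakk>r \<in> carrier R; x \<in> I\<rbrakk> \<Longrightarrow> r \<otimes> x \<in> I"
  shows "left_ideal I R"
proof -
  have "\<ominus> x \<in> I" if "x \<in> I" for x
    using assms(4)[of "\<ominus> \<one>" x] assms(1) that by (auto simp: l_minus)
  then have "additive_subgroup I R"
    using assms by (intro additive_subgroup.intro add.subgroupI) (auto simp: a_inv_def)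
  then show ?thesis
    using assms(4) by (simp add: left_ideal_def)
qed

lemma left_idealD:
  assumes "left_ideal I R"
  shows "I \<subseteq> carrier R" "\<zero> \<in> I" "\<lbrakk>x \<in> I; y \<in> I\<rbrakk> \<Longrightarrow> x \<oplus> y \<in> I" "\<lbrakk>r \<in> carrier R; x \<in> I\<rbrakk> \<Longrightarrow> r \<otimes> x \<in> I"
  using assms additive_subgroup.a_subset additive_subgroup.zero_closed additive_subgroup.a_closed
  by (auto simp: left_ideal_def)

lemma left_ideal_one: "\<lbrakk>left_ideal I R; \<one> \<in> I\<rbrakk> \<Longrightarrow> I = carrier R"
  using left_idealD(1,4)[of I] by (metis r_one subsetI subset_antisym)

lemma left_ideal_in_maximal:
  assumes "left_ideal I R" "\<one> \<notin> I"
  shows "\<exists>M. maximal_left_ideal M R \<and> I \<subseteq> M"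
proof -
  let ?A = "{J. left_ideal J R \<and> I \<subseteq> J \<and> \<one> \<notin> J}"
  have "\<exists>M\<in>?A. \<forall>J\<in>?A. M \<subseteq> J \<longrightarrow> J = M"
  proof (rule subset_Zorn_nonempty)
    show "?A \<noteq> {}"
      using assms by blast
    fix C
    assume C: "C \<noteq> {}" "subset.chain ?A C"
    have CA: "left_ideal J R" "I \<subseteq> J" "\<one> \<notin> J" if "J \<in> C" for J
      using C(2) that unfolding subset_chain_def by blast+
    have "left_ideal (\<Union>C) R"
    proof (rule left_idealI)
      show "\<Union>C \<subseteq> carrier R"
        using CA(1) left_idealD(1) by blast
      show "\<zero> \<in> \<Union>C"
        using C(1) CA(1) left_idealD(2) by blast
      show "x \<oplus> y \<in> \<Union>C" if xy: "x \<in> \<Union>C" "y \<in> \<Union>C" for x y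
      proof -
        obtain J K where JK: "x \<in> J" "y \<in> K" "J \<in> C" "K \<in> C"
          using xy by blast
        then have "J \<subseteq> K \<or> K \<subseteq> J"
          using C(2) unfolding subset_chain_def by blast
        then show ?thesis
          using JK CA(1) left_idealD(3) by (meson UnionI subsetD)
      qed
      show "r \<otimes> x \<in> \<Union>C" if "r \<in> carrier R" "x \<in> \<Union>C" for r x
        using that CA(1) left_idealD(4) by blast
    qed
    then show "\<Union>C \<in> ?A"
      using C(1) CA(2,3) by blast
  qed
  then obtain M where M: "M \<in> ?A" "\<forall>J\<in>?A. M \<subseteq> J \<longrightarrow> J = M"
    by blast
  have "J = M \<or> J = carrier R" if "left_ideal J R" "M \<subseteq> J" for J
    using M left_ideal_one[OF that(1)] that by blast
  then have "maximal_left_ideal M R"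
    unfolding maximal_left_ideal_def using M(1) by blast
  then show ?thesis
    using M(1) by blast
qed

text \<open>If the left ideal R t were proper, a maximal left ideal containing it would contain t
  and j, hence 1.\<close>

lemma jacobson_radical_complement:
  assumes "j \<in> jacobson_radical R" "t \<in> carrier R" "j \<oplus> t = \<one>"
  shows "\<exists>a\<in>carrier R. a \<otimes> t = \<one>"
proof (rule ccontr)
  assume *: "\<not> ?thesis"
  let ?I = "(\<lambda>a. a \<otimes> t) ` carrier R"
  have "left_ideal ?I R"
  proof (rule left_idealI)
    show "\<zero> \<in> ?I"
      using assms(2) by (auto intro!: image_eqI[of _ _ \<zero>])
    show "x \<oplus> y \<in> ?I" if "x \<in> ?I" "y \<in> ?I" for x y
      using that assms(2) by (auto simp: l_distr[symmetric])
    show "r \<otimes> x \<in> ?I" if "r \<in> carrier R" "x \<in> ?I" for r x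
      using that assms(2) by (auto simp: m_assoc[symmetric])
  qed (use assms(2) in auto)
  moreover have "\<one> \<notin> ?I"
    using * by force
  ultimately obtain M where M: "maximal_left_ideal M R" "?I \<subseteq> M"
    using left_ideal_in_maximal by blast
  have "t \<in> M"
    using M(2) assms(2) by (auto simp: subset_iff image_iff) (metis l_one one_closed)
  moreover have "j \<in> M"
    using assms(1) M(1) by (auto simp: jacobson_radical_def)
  ultimately have "\<one> \<in> M"
    using M(1) left_idealD(3) assms(3) by (metis maximal_left_ideal_def)
  then show False
    using M(1) left_ideal_one by (auto simp: maximal_left_ideal_def)
qed

text \<open>If the radical and I together gave the whole ring, then 1 = j + t with t in I left
  invertible, so I would contain 1. Maximality of the radical does the rest.\<close>

lemma primary_ideal_subset:
  assumes "primary R" "ideal I R" "\<one> \<notin> I"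
  shows "I \<subseteq> jacobson_radical R"
proof -
  let ?J = "jacobson_radical R"
  interpret J: maximalideal ?J R
    using assms(1) by (simp add: primary_def)
  interpret I: ideal I R
    by (rule assms(2))
  have K: "ideal (?J <+> I) R"
    by (rule add_ideals[OF J.is_ideal assms(2)])
  have sub: "?J \<subseteq> ?J <+> I" "I \<subseteq> ?J <+> I"
  proof -
    have "x \<oplus> \<zero> \<in> ?J <+> I" if "x \<in> ?J" for x
      using that I.zero_closed unfolding set_add_def' by blast
    then show "?J \<subseteq> ?J <+> I"
      using J.Icarr by fastforce
    have "\<zero> \<oplus> x \<in> ?J <+> I" if "x \<in> I" for x
      using that J.zero_closed unfolding set_add_def' by blast
    then show "I \<subseteq> ?J <+> I"
      using I.Icarr by fastforce
  qed
  have "?J <+> I \<noteq> carrier R"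
  proof
    assume "?J <+> I = carrier R"
    then obtain j t where jt: "j \<in> ?J" "t \<in> I" "\<one> = j \<oplus> t"
      using one_closed unfolding set_add_def' by blast
    then obtain a where "a \<in> carrier R" "a \<otimes> t = \<one>"
      using jacobson_radical_complement[of j t] I.Icarr by auto
    then show False
      using I.I_l_closed[OF jt(2)] assms(3) by metis
  qed
  then have "?J <+> I = ?J"
    using J.I_maximal[OF K sub(1)] ideal.Icarr[OF K] by blast
  then show ?thesis
    using sub(2) by simp
qed

end

lemma (in ring) Span_append_mem:
  assumes "subring K R" "set Us \<subseteq> carrier R" "set Ws \<subseteq> carrier R" "x \<in> Span K Us" "y \<in> Span K Ws"
  shows "x \<oplus> y \<in> Span K (Us @ Ws)"
  using assms(2,4)
proof (induction Us arbitrary: x)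
  case Nil
  then have "x = \<zero>"
    by simp
  then show ?case
    using assms(5) Span_subring_closed(1)[OF assms(1,3)] by (auto simp del: Span.simps)
next
  case (Cons u Us)
  then obtain k w where kw: "k \<in> K" "w \<in> Span K Us" "x = k \<otimes> u \<oplus> w"
    unfolding Span_Cons_iff by blast
  have "k \<in> carrier R" "w \<in> carrier R" "y \<in> carrier R" "u \<in> carrier R"
    using kw subringE(1)[OF assms(1)] Span_subring_closed(1)[OF assms(1)] assms(3,5) Cons.prems(1)
    by (auto simp del: Span.simps)
  then have "x \<oplus> y = k \<otimes> u \<oplus> (w \<oplus> y)"
    by (simp add: kw(3) a_assoc)
  moreover have "w \<oplus> y \<in> Span K (Us @ Ws)"
    by (rule Cons.IH) (use Cons.prems(1) kw(2) in auto)
  ultimately show ?case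
    unfolding append_Cons Span_Cons_iff using kw(1) by blast
qed

context crossed
begin

section \<open>Two-sided ideals of the crossed-product order and connectedness of the
  groupoid\<close>

abbreviation "OrdR \<equiv> CP\<lparr>carrier := Ord\<rparr>"

lemma ring_OrdR: "ring OrdR"
  by (rule ring.subring_is_ring[OF ring_CP subring_Ord])

lemma ideal_graded_ideal:
  assumes "unit_closed C"
  shows "ideal (graded_ideal C) OrdR"
proof (rule idealI[OF ring_OrdR])
  interpret R: ring OrdR
    by (rule ring_OrdR)
  show "subgroup (graded_ideal C) (add_monoid OrdR)"
  proof (rule R.add.subgroupI)
    show "graded_ideal C \<subseteq> carrier OrdR" "graded_ideal C \<noteq> {}"
      using graded_ideal_subset graded_ideal_zero by auto
    fix a b
    assume ab: "a \<in> graded_ideal C" "b \<in> graded_ideal C"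
    then show "a \<oplus>\<^bsub>OrdR\<^esub> b \<in> graded_ideal C"
      by (simp add: graded_ideal_add)
    have a: "a \<in> Ord" "\<ominus>\<^bsub>CP\<^esub> a \<in> Ord"
      using ab(1) graded_ideal_minus[OF ab(1)] graded_ideal_subset by blast+
    then have aC: "a \<in> carrier CP"
      by (simp add: Ord_iff)
    have "\<ominus>\<^bsub>OrdR\<^esub> a = \<ominus>\<^bsub>CP\<^esub> a"
      by (rule R.minus_equality) (use a in \<open>simp_all add: CP_minus[OF aC]\<close>, simp add: CP_simps)
    then show "\<ominus>\<^bsub>OrdR\<^esub> a \<in> graded_ideal C"
      using graded_ideal_minus[OF ab(1)] by simp
  qed
qed (use assms graded_ideal_mult_left graded_ideal_mult_right in auto)

lemma one_notin_graded_ideal: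
  assumes "maxidl M" "M \<notin> C"
  shows "\<one>\<^bsub>CP\<^esub> \<notin> graded_ideal C"
proof
  assume *: "\<one>\<^bsub>CP\<^esub> \<in> graded_ideal C"
  have "xmono 1 id id \<in> graded_comp C id"
    using * id_in_G unfolding graded_ideal_def CP_simps(2) by blast
  then have "1 \<in> graded_comp C id"
    by (simp add: xmono_def)
  moreover have "unit_at id M"
    using maxidl_one[OF assms(1)] by (simp add: unit_at_def f_id_left id_in_G)
  ultimately show False
    using assms maxidl_one[OF assms(1)] by (auto simp: graded_comp_def)
qed

text \<open>The Chinese remainder theorem for the maximal ideals in C and those outside C: the
  intersections of the two families are comaximal.\<close>

lemma maxidl_partition_of_unity:
  obtains a b where "a \<in> S" "b \<in> S" "a + b = 1"
    "\<And>M. \<lbrakk>maxidl M; M \<notin> C\<rbrakk> \<Longrightarrow> a \<in> M" "\<And>M. \<lbrakk>maxidl M; M \<in> C\<rbrakk> \<Longrightarrow> b \<in> M"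
proof -
  define I where "I C = {x \<in> S. \<forall>M. maxidl M \<and> M \<notin> C \<longrightarrow> x \<in> M}" for C
  have idl_I: "idl (I C)" for C
    by (rule idlI) (auto simp: I_def intro: S_zero S_add S_mult idlD maxidl_idl)
  let ?K = "{x + y | x y. x \<in> I C \<and> y \<in> I (- C)}"
  have "idl ?K"
  proof (rule idlI)
    show "?K \<subseteq> S"
      using idlD(1)[OF idl_I] S_add by blast
    show "0 \<in> ?K"
      using idlD(2)[OF idl_I] by force
    show "x + y \<in> ?K" if xy: "x \<in> ?K" "y \<in> ?K" for x y
    proof -
      obtain a b c d where "a \<in> I C" "b \<in> I (- C)" "c \<in> I C" "d \<in> I (- C)" "x = a + b" "y = c + d"
        using xy by blast
      then show ?thesis
        using idlD(3)[OF idl_I]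
        by (intro CollectI exI[of _ "a + c"] exI[of _ "b + d"]) (simp add: algebra_simps)
    qed
    show "r * x \<in> ?K" if rx: "r \<in> S" "x \<in> ?K" for r x
    proof -
      obtain a b where "a \<in> I C" "b \<in> I (- C)" "x = a + b"
        using rx by blast
      then show ?thesis
        using idlD(4)[OF idl_I rx(1)]
        by (intro CollectI exI[of _ "r * a"] exI[of _ "r * b"]) (simp add: algebra_simps)
    qed
  qed
  have escape: "\<exists>q\<in>I D. q \<notin> M" if M: "maxidl M" "M \<in> D" for M D
  proof -
    have "\<exists>q\<in>S. q \<notin> M \<and> (\<forall>N\<in>{N. maxidl N} - D. q \<in> N)"
      by (rule prime_avoidance) (use finite_maxidl M in auto)
    then show ?thesis
      by (auto simp: I_def)
  qed
  have "1 \<in> ?K"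
  proof (rule ccontr)
    assume "1 \<notin> ?K"
    then obtain M where M: "maxidl M" "?K \<subseteq> M"
      using maxidl_exists \<open>idl ?K\<close> by blast
    have "I C \<subseteq> ?K" "I (- C) \<subseteq> ?K"
      using idlD(2)[OF idl_I] by force+
    then show False
      using escape[OF M(1), of C] escape[OF M(1), of "- C"] M(2) by blast
  qed
  then obtain a b where "a \<in> I C" "b \<in> I (- C)" "a + b = 1"
    by force
  then show ?thesis
    using that[of a b] by (auto simp: I_def)
qed

text \<open>Otherwise the component C of M misses N. Then \<open>graded_ideal C\<close> and
  \<open>graded_ideal (- C)\<close> are proper two-sided ideals, so primarity puts both into the
  radical. A partition of unity writes 1 as a sum of elements of the two.\<close>

lemma primary_imp_connected:
  assumes prim: "primary OrdR" and M: "maxidl M" and N: "maxidl N"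
  shows "\<exists>g\<in>G. unit_at g M \<and> N = finv g ` M"
proof (rule ccontr)
  assume no: "\<not> ?thesis"
  define C where "C = {K. \<exists>g\<in>G. unit_at g M \<and> K = finv g ` M}"
  have id_unit: "unit_at id K" if "maxidl K" for K
    using maxidl_one[OF that] by (simp add: unit_at_def f_id_left id_in_G)
  have MC: "M \<in> C"
    unfolding C_def using id_in_G id_unit[OF M] by (intro CollectI bexI[of _ id]) auto
  have step: "finv \<sigma> ` K \<in> C" if \<sigma>: "\<sigma> \<in> G" "unit_at \<sigma> K" and K: "K \<in> C" for K \<sigma>
  proof -
    obtain g where g: "g \<in> G" "unit_at g M" "K = finv g ` M"
      using K by (auto simp: C_def)
    have "unit_at (g \<circ> \<sigma>) M"
      using unit_at_comp[OF M g(1) \<sigma>(1) g(2)] \<sigma>(2) g(3) by simp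
    moreover have "finv (g \<circ> \<sigma>) ` M = finv \<sigma> ` K"
      using g \<sigma>(1) by (simp add: finv_comp image_comp)
    ultimately show ?thesis
      unfolding C_def using comp_in_G[OF g(1) \<sigma>(1)] by blast
  qed
  have closed: "unit_closed C"
    unfolding unit_closed_def
  proof (intro allI impI notI)
    fix K \<sigma>
    assume K: "maxidl K \<and> \<sigma> \<in> G \<and> unit_at \<sigma> K \<and> K \<notin> C" and *: "finv \<sigma> ` K \<in> C"
    have "finv (finv \<sigma>) ` finv \<sigma> ` K \<in> C"
      using step[OF _ _ *] K unit_at_inv inv_in_G by blast
    then show False
      using K by (simp add: G_inv_inv image_inv_image)
  qed
  have co_closed: "unit_closed (- C)"
    unfolding unit_closed_def using step by blast
  obtain a b where ab: "a \<in> S" "b \<in> S" "a + b = 1"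
    "\<And>K. \<lbrakk>maxidl K; K \<notin> C\<rbrakk> \<Longrightarrow> a \<in> K" "\<And>K. \<lbrakk>maxidl K; K \<in> C\<rbrakk> \<Longrightarrow> b \<in> K"
    using maxidl_partition_of_unity[of C] by blast
  interpret R: ring OrdR
    by (rule ring_OrdR)
  interpret J: maximalideal "jacobson_radical OrdR" OrdR
    using prim by (simp add: primary_def)
  have "N \<notin> C"
    using no by (auto simp: C_def)
  then have "graded_ideal C \<subseteq> jacobson_radical OrdR"
    using one_notin_graded_ideal[OF N]
    by (intro R.primary_ideal_subset[OF prim ideal_graded_ideal[OF closed]]) simp
  moreover have "graded_ideal (- C) \<subseteq> jacobson_radical OrdR"
    using one_notin_graded_ideal[OF M, of "- C"] MC
    by (intro R.primary_ideal_subset[OF prim ideal_graded_ideal[OF co_closed]]) simp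
  moreover have "xmono a id \<in> graded_ideal C" "xmono b id \<in> graded_ideal (- C)"
    using ab by (auto intro!: xmono_in_graded_ideal id_in_G simp: graded_comp_def)
  ultimately have "xmono a id \<oplus>\<^bsub>OrdR\<^esub> xmono b id \<in> jacobson_radical OrdR"
    using J.a_closed by blast
  moreover have "xmono a id \<oplus>\<^bsub>OrdR\<^esub> xmono b id = \<one>\<^bsub>OrdR\<^esub>"
  proof -
    have "xmono a id \<oplus>\<^bsub>CP\<^esub> xmono b id = \<one>\<^bsub>CP\<^esub>"
      unfolding CP_simps using ab(3) by (auto simp: xmono_def)
    then show ?thesis
      by simp
  qed
  ultimately show False
    using J.one_imp_carrier J.I_notcarr by metis
qed

subsection \<open>Orders containing the crossed-product order\<close>

lemma scale_all_in_S:
  assumes "u \<in> carrier CP"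
  shows "\<exists>k. \<forall>\<sigma>. \<pi> ^ k * u \<sigma> \<in> S"
proof -
  have "\<exists>k. \<forall>\<sigma>\<in>H. \<pi> ^ k * u \<sigma> \<in> S" if "finite H" for H
    using that
  proof (induction H rule: finite_induct)
    case (insert \<sigma> H)
    then obtain k where k: "\<forall>\<sigma>\<in>H. \<pi> ^ k * u \<sigma> \<in> S"
      by blast
    obtain l where l: "\<pi> ^ l * u \<sigma> \<in> S"
      using S_scale by blast
    have pS: "\<pi> ^ n \<in> S" for n
      by (rule S_power[OF S_unif])
    have "\<pi> ^ (k + l) * u \<tau> \<in> S" if "\<tau> \<in> insert \<sigma> H" for \<tau>
      using that S_mult[OF pS l, of k] S_mult[OF pS, of "\<pi> ^ k * u \<tau>" l] k
      by (auto simp: power_add algebra_simps)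
    then show ?case
      by blast
  qed simp
  then obtain k where "\<forall>\<sigma>\<in>G. \<pi> ^ k * u \<sigma> \<in> S"
    using finite_G by blast
  then have "\<pi> ^ k * u \<sigma> \<in> S" for \<sigma>
    using assms S_zero by (cases "\<sigma> \<in> G") (auto simp: CP_simps)
  then show ?thesis
    by blast
qed

lemma Span_bounded:
  assumes "set Us \<subseteq> carrier CP"
  shows "\<exists>k. \<forall>x\<in>ring.Span CP (cp_scalar ` V) Us. \<forall>\<sigma>. \<pi> ^ k * x \<sigma> \<in> S"
  using assms
proof (induction Us)
  case Nil
  interpret R: ring CP
    by (rule ring_CP)
  show ?case
    using S_zero by (auto simp: CP_simps)
next
  case (Cons u Us)
  interpret R: ring CP
    by (rule ring_CP)
  obtain k where k: "\<And>x \<sigma>. x \<in> R.Span (cp_scalar ` V) Us \<Longrightarrow> \<pi> ^ k * x \<sigma> \<in> S"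
    using Cons by (auto simp del: R.Span.simps)
  have u: "u \<in> carrier CP"
    using Cons.prems by simp
  then obtain l where l: "\<And>\<sigma>. \<pi> ^ l * u \<sigma> \<in> S"
    using scale_all_in_S by blast
  have "\<pi> ^ (k + l) * x \<sigma> \<in> S" if x: "x \<in> R.Span (cp_scalar ` V) (u # Us)" for x \<sigma>
  proof -
    obtain c w where cw: "c \<in> V" "w \<in> R.Span (cp_scalar ` V) Us" "x = xmono c id \<otimes>\<^bsub>CP\<^esub> u \<oplus>\<^bsub>CP\<^esub> w"
      using x unfolding R.Span_Cons_iff by (auto simp: cp_scalar_eq_xmono)
    have "\<pi> ^ (k + l) * x \<sigma> = (\<pi> ^ k * c) * (\<pi> ^ l * u \<sigma>) + \<pi> ^ l * (\<pi> ^ k * w \<sigma>)"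
      by (simp add: cw(3) CP_simps scalar_mult[OF u] power_add algebra_simps)
    moreover have "(\<pi> ^ k * c) * (\<pi> ^ l * u \<sigma>) + \<pi> ^ l * (\<pi> ^ k * w \<sigma>) \<in> S"
      by (intro S_add S_mult S_power S_unif V_in_S[OF cw(1)] k[OF cw(2)] l)
    ultimately show ?thesis
      by simp
  qed
  then show ?case
    by blast
qed

context
  fixes B
  assumes order_B: "is_order CP (cp_scalar ` V) (cp_scalar ` F) B" and Ord_B: "Ord \<subseteq> B"
begin

lemma order_subring: "subring B CP"
  using order_B by (simp add: is_order_def)

text \<open>All powers of c occur in B, which has a common denominator, so c is almost
  integral.\<close>

lemma order_identity_component:
  assumes "xmono c id \<in> B"
  shows "c \<in> S"
proof -
  obtain Us where Us: "set Us \<subseteq> B" "B = ring.Span CP (cp_scalar ` V) Us"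
    using order_B by (auto simp: is_order_def)
  have "set Us \<subseteq> carrier CP"
    using Us(1) subringE(1)[OF order_subring] by blast
  then obtain k where k: "\<And>x \<sigma>. x \<in> B \<Longrightarrow> \<pi> ^ k * x \<sigma> \<in> S"
    using Span_bounded Us(2) by metis
  have "xmono (c ^ n) id \<in> B" for n
  proof (induction n)
    case 0
    show ?case
      unfolding power_0 using Ord_B xmono_in_Ord[OF id_in_G S_one] by blast
  next
    case (Suc n)
    have "xmono (c ^ Suc n) id = xmono c id \<otimes>\<^bsub>CP\<^esub> xmono (c ^ n) id"
      by (simp add: xmono_mult id_in_G f_id_left)
    then show ?case
      using subringE(6)[OF order_subring assms Suc] by metis
  qed
  then have "\<pi> ^ k * c ^ n \<in> S" for n
    using k[of "xmono (c ^ n) id" id] by (simp add: xmono_def)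
  then show ?thesis
    using almost_integral[of "\<pi> ^ k" c] unif_nonzero by simp
qed

text \<open>\<open>B\<close> is an \<open>S\<close>-\<open>S\<close>-bimodule, that is, an \<open>S \<otimes> S\<close>-module.\<close>

lemma order_homogeneous:
  assumes x: "x \<in> B" and \<sigma>: "\<sigma> \<in> G"
  shows "xmono (x \<sigma>) \<sigma> \<in> B"
proof -
  note B = subringE[OF order_subring]
  have xC: "x \<in> carrier CP"
    using x B(1) by blast
  have sc: "xmono c id \<in> B" if "c \<in> S" for c
    using Ord_B xmono_in_Ord[OF id_in_G that] by blast
  have "(\<lambda>\<rho>. if \<rho> \<in> G then g \<rho> * x \<rho> else 0) \<in> B" if "g \<in> E S" for g
    using that
  proof (induction rule: E.induct)
    case (zero h)
    then have "(\<lambda>\<rho>. if \<rho> \<in> G then h \<rho> * x \<rho> else 0) = \<zero>\<^bsub>CP\<^esub>"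
      by (auto simp: CP_simps)
    then show ?case
      using B(2) by simp
  next
    case (step g a b h)
    have outer: "xmono a id \<otimes>\<^bsub>CP\<^esub> (x \<otimes>\<^bsub>CP\<^esub> xmono b id) = (\<lambda>\<rho>. a * (x \<rho> * \<rho> b))"
      by (rule trans[OF scalar_mult[OF CP_mult_closed]]) (simp add: mult_scalar[OF xC])
    have "(\<lambda>\<rho>. if \<rho> \<in> G then h \<rho> * x \<rho> else 0) =
        xmono a id \<otimes>\<^bsub>CP\<^esub> (x \<otimes>\<^bsub>CP\<^esub> xmono b id) \<oplus>\<^bsub>CP\<^esub> (\<lambda>\<rho>. if \<rho> \<in> G then g \<rho> * x \<rho> else 0)"
      unfolding outer CP_simps(4) using xC step.hyps(4) by (auto simp: algebra_simps CP_simps(1))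
    moreover have "xmono a id \<otimes>\<^bsub>CP\<^esub> (x \<otimes>\<^bsub>CP\<^esub> xmono b id) \<in> B"
      by (intro B(6) sc x step.hyps)
    ultimately show ?case
      using B(7) step.IH by simp
  qed
  from this[OF delta_in_E_S_translate[OF \<sigma>]] have "(\<lambda>\<rho>. if \<rho> \<in> G then \<delta> \<sigma> \<rho> * x \<rho> else 0) \<in> B" .
  moreover have "(\<lambda>\<rho>. if \<rho> \<in> G then \<delta> \<sigma> \<rho> * x \<rho> else 0) = xmono (x \<sigma>) \<sigma>"
    using \<sigma> by (auto simp: \<delta>_def xmono_def)
  ultimately show ?thesis
    by simp
qed

lemma order_transport:
  assumes M0: "maxidl M0" and conn: "\<And>N. maxidl N \<Longrightarrow> \<exists>g\<in>G. unit_at g M0 \<and> N = finv g ` M0"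
    and b: "xmono b \<sigma> \<in> B" "\<sigma> \<in> G" "b \<noteq> 0" and M: "maxidl M" "ord M b < 0"
  shows "\<exists>c \<rho>. \<rho> \<in> G \<and> \<rho> ` M0 = M0 \<and> c \<noteq> 0 \<and> ord M0 c < 0 \<and> xmono c \<rho> \<in> B"
proof -
  note B = subringE[OF order_subring]
  obtain g where g: "g \<in> G" "unit_at g M0" "M = finv g ` M0"
    using conn[OF M(1)] by blast
  obtain h where h: "h \<in> G" "unit_at h M0" "finv \<sigma> ` M = finv h ` M0"
    using conn[OF maxidl_apply_inv[OF M(1) b(2)]] by blast
  have hi: "finv h \<in> G" "unit_at (finv h) (finv h ` M0)"
    using h inv_in_G unit_at_inv by auto
  have g\<sigma>: "g \<circ> \<sigma> \<in> G"
    by (rule comp_in_G[OF g(1) b(2)])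
  define \<rho> where "\<rho> = g \<circ> \<sigma> \<circ> finv h"
  define c where "c = g b * f g \<sigma> * f (g \<circ> \<sigma>) (finv h)"
  have \<rho>: "\<rho> \<in> G"
    unfolding \<rho>_def by (rule comp_in_G[OF g\<sigma> hi(1)])
  have "xmono 1 g \<otimes>\<^bsub>CP\<^esub> xmono b \<sigma> \<otimes>\<^bsub>CP\<^esub> xmono 1 (finv h) = xmono c \<rho>"
    by (simp add: xmono_mult g b g\<sigma> hi c_def \<rho>_def G_one)
  moreover have "xmono 1 g \<otimes>\<^bsub>CP\<^esub> xmono b \<sigma> \<otimes>\<^bsub>CP\<^esub> xmono 1 (finv h) \<in> B"
    using Ord_B xmono_in_Ord[OF g(1) S_one] xmono_in_Ord[OF hi(1) S_one] by (intro B(6) b(1)) auto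
  moreover have "\<rho> ` M0 = M0"
  proof -
    have "\<rho> ` M0 = g ` \<sigma> ` finv h ` M0"
      by (simp add: \<rho>_def image_comp comp_assoc)
    also have "\<dots> = g ` \<sigma> ` finv \<sigma> ` finv g ` M0"
      by (simp only: h(3)[symmetric] g(3))
    also have "\<dots> = M0"
      by (simp add: image_inv_image b(2) g(1))
    finally show ?thesis .
  qed
  moreover have "c \<noteq> 0"
    using b g g\<sigma> hi by (simp add: c_def f_nonzero G_eq_zero_iff)
  moreover have "ord M0 c < 0"
  proof -
    have "ord M0 (g b) = ord M b"
      using ord_apply[OF M(1) g(1) b(3)] g by (simp add: image_inv_image)
    moreover have "f g \<sigma> \<notin> M0"
      by (rule unit_at_imp_f_left[OF M0 g(1) b(2) g(2)])
    moreover have "finv (g \<circ> \<sigma>) ` M0 = finv h ` M0"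
      by (simp only: finv_comp[OF g(1) b(2)] image_comp[symmetric] g(3)[symmetric] h(3))
    then have "f (g \<circ> \<sigma>) (finv h) \<notin> M0"
      using unit_at_imp_f_right[OF M0 g\<sigma> hi(1)] hi(2) by simp
    moreover have "g b \<noteq> 0"
      using b g by (simp add: G_eq_zero_iff)
    ultimately show ?thesis
      using M(2) g b g\<sigma> hi by (simp add: c_def ord_mult[OF M0] f_nonzero ord_unit[OF M0] f_in_S)
  qed
  ultimately show ?thesis
    using \<rho> by metis
qed

lemma order_no_pole:
  assumes M0: "maxidl M0" and hered: "\<And>\<tau>. \<lbrakk>\<tau> \<in> G; \<tau> ` M0 = M0\<rbrakk> \<Longrightarrow> ord M0 (f \<tau> (finv \<tau>)) < 2"
    and c: "xmono c \<rho> \<in> B" "\<rho> \<in> G" "\<rho> ` M0 = M0" "c \<noteq> 0"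
  shows "ord M0 c \<ge> 0"
proof (rule ccontr)
  assume neg: "\<not> ?thesis"
  note B = subringE[OF order_subring]
  have pow: "\<rho> ^^ n \<in> G \<and> (\<rho> ^^ n) ` M0 = M0" for n
  proof (induction n)
    case 0
    show ?case
      unfolding funpow.simps(1) by (intro conjI id_in_G) auto
  next
    case (Suc n)
    then show ?case
      unfolding funpow.simps(2) image_comp[symmetric] using c(2,3) comp_in_G by blast
  qed
  \<comment> \<open>\<open>C n\<close> is the coefficient of the n-th power of
    \<open>xmono c \<rho>\<close>, which sits in degree \<open>\<rho> ^^ n\<close>.\<close>
  define C where "C = rec_nat 1 (\<lambda>n a. c * \<rho> a * f \<rho> (\<rho> ^^ n))"
  have C_simps: "C 0 = 1" "C (Suc n) = c * \<rho> (C n) * f \<rho> (\<rho> ^^ n)" for n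
    by (simp_all add: C_def)
  have C_B: "xmono (C n) (\<rho> ^^ n) \<in> B" for n
  proof (induction n)
    case 0
    show ?case
      unfolding C_simps(1) funpow.simps(1) using Ord_B xmono_in_Ord[OF id_in_G S_one] by blast
  next
    case (Suc n)
    have "xmono c \<rho> \<otimes>\<^bsub>CP\<^esub> xmono (C n) (\<rho> ^^ n) \<in> B"
      by (rule B(6)[OF c(1) Suc])
    then show ?case
      unfolding xmono_mult[OF c(2) conjunct1[OF pow]] C_simps(2) funpow.simps(2) .
  qed
  have C0: "C n \<noteq> 0" for n
    by (induction n) (use c pow in \<open>simp_all add: C_simps f_nonzero G_eq_zero_iff\<close>)
  \<comment> \<open>For \<mu> = \<open>\<rho> ^^ n\<close>, the cocycle identity shows that
    \<open>f \<rho> \<mu>\<close> divides \<open>\<rho> (f \<mu> (finv \<mu>))\<close>, whose value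
    at M0 is unchanged by \<rho> because \<rho> stabilizes M0.\<close>
  have f_le: "ord M0 (f \<rho> (\<rho> ^^ n)) \<le> 1" for n
  proof -
    let ?\<mu> = "\<rho> ^^ n"
    have \<mu>: "?\<mu> \<in> G" "?\<mu> ` M0 = M0"
      using pow by auto
    have "ord M0 (\<rho> (f ?\<mu> (finv ?\<mu>))) = ord M0 (f ?\<mu> (finv ?\<mu>))"
      using ord_apply[OF M0 c(2), of "f ?\<mu> (finv ?\<mu>)"] c(3) \<mu> by (simp add: f_nonzero inv_in_G)
    also have "\<dots> \<le> 1"
      using hered[OF \<mu>] by simp
    finally have "ord M0 (f \<rho> ?\<mu> * f (\<rho> \<circ> ?\<mu>) (finv ?\<mu>)) \<le> 1"
      using cocycle_cancel_right[OF c(2) \<mu>(1)] by simp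
    moreover have "f (\<rho> \<circ> ?\<mu>) (finv ?\<mu>) \<in> S" "f (\<rho> \<circ> ?\<mu>) (finv ?\<mu>) \<noteq> 0" "f \<rho> ?\<mu> \<noteq> 0"
      using \<mu> c(2) by (simp_all add: f_in_S f_nonzero comp_in_G inv_in_G)
    ultimately show ?thesis
      using ord_S_nonneg[OF M0, of "f (\<rho> \<circ> ?\<mu>) (finv ?\<mu>)"] by (simp add: ord_mult[OF M0])
  qed
  \<comment> \<open>Each further factor adds the value of c, at most -1, and a cocycle value of at
    most 1. The first power has the cocycle factor \<open>f \<rho> id\<close> = 1, so the value
    starts negative and stays so.\<close>
  have ord_C: "ord M0 (C (Suc n)) < 0" for n
  proof (induction n)
    case 0
    have "C (Suc 0) = c"
      using c(2) by (simp add: C_simps G_one f_id_right)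
    then show ?case
      using neg by simp
  next
    case (Suc n)
    have "ord M0 (C (Suc (Suc n))) = ord M0 c + ord M0 (\<rho> (C (Suc n))) + ord M0 (f \<rho> (\<rho> ^^ Suc n))"
      unfolding C_simps(2)[of "Suc n"]
      using C0 c pow[of "Suc n"] by (simp only: ord_mult[OF M0] G_eq_zero_iff f_nonzero mult_eq_0_iff simp_thms)
    moreover have "ord M0 (\<rho> (C (Suc n))) = ord M0 (C (Suc n))"
      using ord_apply[OF M0 c(2) C0] c(3) by metis
    ultimately show ?case
      using Suc f_le[of "Suc n"] neg by linarith
  qed
  have "\<not> inj (\<lambda>n. \<rho> ^^ n)"
    using finite_G pow by (metis finite_subset image_subset_iff infinite_UNIV_nat finite_imageD)
  then obtain m n where mn: "m < n" "\<rho> ^^ m = \<rho> ^^ n"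
    unfolding inj_def by (metis nat_neq_iff)
  have "\<rho> ^^ n = \<rho> ^^ m \<circ> \<rho> ^^ (n - m)"
    using mn(1) by (simp add: funpow_add[symmetric])
  then have "\<rho> ^^ (n - m) = id"
    using mn(2) pow[of m] by (metis inv_comp_cancel(1) G_inv_comp)
  then have "xmono (C (n - m)) id \<in> B"
    using C_B[of "n - m"] by simp
  then have "C (n - m) \<in> S"
    by (rule order_identity_component)
  moreover obtain k where "n - m = Suc k"
    using mn(1) by (metis Suc_diff_Suc)
  ultimately show False
    using ord_C[of k] ord_S_nonneg[OF M0 _ C0[of "n - m"]] by simp
qed

lemma order_eq_Ord:
  assumes M0: "maxidl M0" and hered: "\<And>\<tau>. \<lbrakk>\<tau> \<in> G; \<tau> ` M0 = M0\<rbrakk> \<Longrightarrow> ord M0 (f \<tau> (finv \<tau>)) < 2"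
    and conn: "\<And>N. maxidl N \<Longrightarrow> \<exists>g\<in>G. unit_at g M0 \<and> N = finv g ` M0"
  shows "B = Ord"
proof (rule antisym[OF _ Ord_B], rule subsetI)
  fix x
  assume x: "x \<in> B"
  have "x \<sigma> \<in> S" if \<sigma>: "\<sigma> \<in> G" for \<sigma>
  proof (cases "x \<sigma> = 0")
    case False
    show ?thesis
    proof (rule mem_SI[OF False], rule ccontr)
      fix M
      assume M: "maxidl M" "\<not> ord M (x \<sigma>) \<ge> 0"
      then obtain c \<rho> where "\<rho> \<in> G" "\<rho> ` M0 = M0" "c \<noteq> 0" "ord M0 c < 0" "xmono c \<rho> \<in> B"
        using order_transport[OF M0 conn order_homogeneous[OF x \<sigma>] \<sigma> False M(1)] by auto
      then show False
        using order_no_pole[OF M0 hered, of c \<rho>] by simp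
    qed
  qed (simp add: S_zero)
  then show "x \<in> Ord"
    using x subringE(1)[OF order_subring] by (auto simp: Ord_iff)
qed

end

section \<open>The crossed-product order is an order, and the maximality criterion\<close>

lemma xmono_in_Span:
  assumes "c \<in> vspan us" "\<sigma> \<in> G"
  shows "xmono c \<sigma> \<in> ring.Span CP (cp_scalar ` V) (map (\<lambda>u. xmono u \<sigma>) us)"
  using assms(1)
proof (induction us arbitrary: c)
  case Nil
  interpret R: ring CP
    by (rule ring_CP)
  show ?case
    using Nil by (auto simp: xmono_def CP_simps)
next
  case (Cons u us)
  interpret R: ring CP
    by (rule ring_CP)
  obtain v w where vw: "v \<in> V" "w \<in> vspan us" "c = v * u + w"
    using Cons.prems by auto
  have "xmono c \<sigma> = cp_scalar v \<otimes>\<^bsub>CP\<^esub> xmono u \<sigma> \<oplus>\<^bsub>CP\<^esub> xmono w \<sigma>"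
    unfolding cp_scalar_eq_xmono scalar_mult[OF xmono_in_CP[OF assms(2)]] CP_simps vw(3)
    by (auto simp: xmono_def)
  then show ?case
    unfolding list.map R.Span_Cons_iff using vw Cons.IH by blast
qed

lemma Ord_subset_Span: "\<exists>Us. set Us \<subseteq> carrier CP \<and> Ord \<subseteq> ring.Span CP (cp_scalar ` V) Us"
proof -
  interpret R: ring CP
    by (rule ring_CP)
  obtain us where us: "S \<subseteq> vspan us"
    using S_subset_vspan by blast
  have "\<exists>Us. set Us \<subseteq> carrier CP \<and>
      (\<forall>a\<in>Ord. (\<forall>\<sigma>. \<sigma> \<notin> H \<longrightarrow> a \<sigma> = 0) \<longrightarrow> a \<in> R.Span (cp_scalar ` V) Us)"
    if "finite H" "H \<subseteq> G" for H
    using that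
  proof (induction H rule: finite_induct)
    case empty
    have "a \<in> R.Span (cp_scalar ` V) []" if "\<forall>\<sigma>. a \<sigma> = 0" for a
      using that by (auto simp: CP_simps)
    then show ?case
      by (intro exI[of _ "[]"]) auto
  next
    case (insert \<sigma> H)
    then obtain Us where Us: "set Us \<subseteq> carrier CP"
      "\<And>a. \<lbrakk>a \<in> Ord; \<forall>\<sigma>. \<sigma> \<notin> H \<longrightarrow> a \<sigma> = 0\<rbrakk> \<Longrightarrow> a \<in> R.Span (cp_scalar ` V) Us"
      by blast
    let ?Ws = "map (\<lambda>u. xmono u \<sigma>) us"
    have \<sigma>: "\<sigma> \<in> G"
      using insert.prems by simp
    have Ws: "set ?Ws \<subseteq> carrier CP"
      using xmono_in_CP[OF \<sigma>] by auto
    have "a \<in> R.Span (cp_scalar ` V) (?Ws @ Us)" if a: "a \<in> Ord" "\<forall>\<tau>. \<tau> \<notin> insert \<sigma> H \<longrightarrow> a \<tau> = 0" for a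
    proof -
      let ?b = "\<lambda>\<tau>. if \<tau> = \<sigma> then 0 else a \<tau>"
      have "?b \<in> Ord"
        using a(1) S_zero by (auto simp: Ord_iff CP_simps)
      then have b: "?b \<in> R.Span (cp_scalar ` V) Us"
        using a(2) by (intro Us(2)) auto
      have "xmono (a \<sigma>) \<sigma> \<in> R.Span (cp_scalar ` V) ?Ws"
        using us a(1) \<sigma> by (intro xmono_in_Span) (auto simp: Ord_iff)
      then have "xmono (a \<sigma>) \<sigma> \<oplus>\<^bsub>CP\<^esub> ?b \<in> R.Span (cp_scalar ` V) (?Ws @ Us)"
        by (rule R.Span_append_mem[OF subring_scalars Ws Us(1) _ b])
      moreover have "xmono (a \<sigma>) \<sigma> \<oplus>\<^bsub>CP\<^esub> ?b = a"
        unfolding CP_simps by (auto simp: xmono_def)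
      ultimately show ?thesis
        by simp
    qed
    then show ?case
      using Ws Us(1) by (intro exI[of _ "?Ws @ Us"] conjI ballI impI) (auto simp del: R.Span.simps)
  qed
  from this[OF finite_G order_refl] show ?thesis
    by (auto simp: Ord_iff CP_simps(1) simp del: R.Span.simps)
qed

lemma Ord_is_order: "is_order CP (cp_scalar ` V) (cp_scalar ` F) Ord"
  unfolding is_order_def
proof (intro conjI ballI)
  interpret R: ring CP
    by (rule ring_CP)
  show "subring Ord CP"
    by (rule subring_Ord)
  show "cp_scalar ` V \<subseteq> Ord"
    by (rule scalars_in_Ord)
  note OrdE = subringE[OF subring_Ord]
  obtain Us where Us: "set Us \<subseteq> carrier CP" "Ord \<subseteq> R.Span (cp_scalar ` V) Us"
    using Ord_subset_Span by blast
  show "\<exists>Us. set Us \<subseteq> Ord \<and> Ord = R.Span (cp_scalar ` V) Us"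
    by (rule CP_submodule_of_Span[OF Us OrdE(2)])
      (use OrdE scalars_in_Ord in \<open>auto simp: cp_scalar_eq_xmono\<close>)
  fix x
  assume x: "x \<in> carrier CP"
  obtain k where k: "\<forall>\<sigma>. \<pi> ^ k * x \<sigma> \<in> S"
    using scale_all_in_S[OF x] by blast
  let ?a = "\<lambda>\<sigma>. \<pi> ^ k * x \<sigma>" and ?c = "inverse (\<pi> ^ k)"
  have a: "?a \<in> Ord"
    using k x by (auto simp: Ord_iff CP_simps)
  then have aC: "?a \<in> carrier CP"
    by (simp add: Ord_iff)
  have "?c \<in> F"
    by (simp add: F_def G_inverse G_power G_unif)
  moreover have "x = cp_scalar ?c \<otimes>\<^bsub>CP\<^esub> ?a \<oplus>\<^bsub>CP\<^esub> \<zero>\<^bsub>CP\<^esub>"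
    unfolding cp_scalar_eq_xmono scalar_mult[OF aC] CP_simps
    using unif_nonzero by (auto simp: mult.assoc[symmetric])
  moreover have "\<zero>\<^bsub>CP\<^esub> \<in> R.Span (cp_scalar ` F) []"
    by simp
  ultimately have "x \<in> R.Span (cp_scalar ` F) [?a]"
    unfolding R.Span_Cons_iff by blast
  then show "\<exists>Us. set Us \<subseteq> Ord \<and> x \<in> R.Span (cp_scalar ` F) Us"
    using a by (intro exI[of _ "[?a]"]) (auto simp del: R.Span.simps)
qed

text \<open>Necessity gives the value bound at every M and for all of G. Sufficiency starts from the
  stabilizer of one M and reaches the other maximal ideals by connectedness.\<close>

theorem maximal_order_iff:
  assumes "primary OrdR"
  shows "maximal_order CP (cp_scalar ` V) (cp_scalar ` F) Ord \<longleftrightarrow>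
    (\<exists>M. maxidl M \<and> (\<forall>\<tau>\<in>G. \<tau> ` M = M \<longrightarrow> f \<tau> (finv \<tau>) \<notin> idpow M 2))"
proof
  assume max: "maximal_order CP (cp_scalar ` V) (cp_scalar ` F) Ord"
  obtain M where M: "maxidl M"
    using maxidl_ex by blast
  have "f \<tau> (finv \<tau>) \<notin> idpow M 2" if "\<tau> \<in> G" for \<tau>
    using maximal_order_imp_hereditary[OF max M that] idpow_2_ord[OF M, of "f \<tau> (finv \<tau>)"]
      f_nonzero[OF that inv_in_G[OF that]] by auto
  then show "\<exists>M. maxidl M \<and> (\<forall>\<tau>\<in>G. \<tau> ` M = M \<longrightarrow> f \<tau> (finv \<tau>) \<notin> idpow M 2)"
    using M by blast
next
  assume "\<exists>M. maxidl M \<and> (\<forall>\<tau>\<in>G. \<tau> ` M = M \<longrightarrow> f \<tau> (finv \<tau>) \<notin> idpow M 2)"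
  then obtain M where M: "maxidl M" "\<And>\<tau>. \<lbrakk>\<tau> \<in> G; \<tau> ` M = M\<rbrakk> \<Longrightarrow> f \<tau> (finv \<tau>) \<notin> idpow M 2"
    by blast
  have hered: "ord M (f \<tau> (finv \<tau>)) < 2" if "\<tau> \<in> G" "\<tau> ` M = M" for \<tau>
  proof -
    have "f \<tau> (finv \<tau>) \<in> S" "f \<tau> (finv \<tau>) \<noteq> 0"
      using that(1) by (simp_all add: f_in_S f_nonzero inv_in_G)
    then show ?thesis
      using M(2)[OF that] ord_in_idpow_2[OF M(1)] not_less by blast
  qed
  show "maximal_order CP (cp_scalar ` V) (cp_scalar ` F) Ord"
    unfolding maximal_order_def
    using Ord_is_order order_eq_Ord[OF _ _ M(1) hered primary_imp_connected[OF assms M(1)]] by blast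
qed

end

subsection \<open>Subrings of a field as HOL-Algebra rings\<close>

lemma type_algebra_simps:
  "carrier ring_of_type_algebra = UNIV" "x \<otimes>\<^bsub>ring_of_type_algebra\<^esub> y = x * y"
  "x \<oplus>\<^bsub>ring_of_type_algebra\<^esub> y = x + y" "\<one>\<^bsub>ring_of_type_algebra\<^esub> = 1" "\<zero>\<^bsub>ring_of_type_algebra\<^esub> = 0"
  by (simp_all add: ring_of_type_algebra_def)

lemma ring_on_ops:
  "carrier (ring_on S) = S" "x \<otimes>\<^bsub>ring_on S\<^esub> y = x * y" "x \<oplus>\<^bsub>ring_on S\<^esub> y = x + y"
  "\<one>\<^bsub>ring_on S\<^esub> = 1" "\<zero>\<^bsub>ring_on S\<^esub> = 0"
  by (simp_all add: ring_of_type_algebra_def)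

lemmas ring_on_simps = ring_on_ops type_algebra_simps

text \<open>Coefficient lists of \<open>univ_poly\<close> start with the leading coefficient, those
  of \<open>Poly\<close> with the constant one; hence the reversals.\<close>

lemma poly_Poly_rev_Cons:
  fixes x :: "'a::comm_ring_1"
  shows "poly (Poly (rev (a # p))) x = a * x ^ length p + poly (Poly (rev p)) x"
  by (simp add: Poly_snoc poly_monom algebra_simps)

text \<open>Stated for any ring structure with the operations of the type, to cover both the whole
  field and \<open>ring_on S\<close>.\<close>

lemma eval_eq_poly:
  fixes R :: "('a::comm_ring_1, 'b) ring_scheme"
  assumes R: "ring R" and simps: "\<And>x y. x \<otimes>\<^bsub>R\<^esub> y = x * y" "\<And>x y. x \<oplus>\<^bsub>R\<^esub> y = x + y" "\<one>\<^bsub>R\<^esub> = 1" "\<zero>\<^bsub>R\<^esub> = 0"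
  shows "ring.eval R p x = poly (Poly (rev p)) x"
proof -
  have pow: "x [^]\<^bsub>R\<^esub> n = x ^ n" for n :: nat
    by (induction n) (simp_all add: nat_pow_def simps mult.commute)
  show ?thesis
  proof (induction p)
    case Nil
    then show ?case
      by (simp add: ring.eval.simps[OF R] simps)
  next
    case (Cons a p)
    have "ring.eval R (a # p) x = a * x ^ length p + ring.eval R p x"
      by (simp add: ring.eval.simps[OF R] simps pow)
    then show ?case
      unfolding poly_Poly_rev_Cons Cons.IH .
  qed
qed

lemma eval_type_algebra: "ring.eval ring_of_type_algebra p x = poly (Poly (rev p)) (x :: 'a::comm_ring_1)"
  by (rule eval_eq_poly[OF ring_from_type_algebra type_algebra_simps(2-)])

lemma coeff_Poly_rev_mem: "\<lbrakk>set p \<subseteq> A; 0 \<in> A\<rbrakk> \<Longrightarrow> Polynomial.coeff (Poly (rev p)) i \<in> A"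
  unfolding coeff_Poly_eq nth_default_def by (auto simp: rev_nth subset_iff)

lemma Poly_rev_lead_coeff:
  assumes "p \<noteq> []" "hd p \<noteq> 0"
  shows "Polynomial.lead_coeff (Poly (rev p)) = hd p"
proof -
  have "coeffs (Poly (rev p)) = rev p"
    using assms by (cases p) auto
  then have "last (coeffs (Poly (rev p))) = hd p" and "Poly (rev p) \<noteq> 0"
    using assms(1) by (metis last_rev, metis coeffs_eq_Nil rev_is_Nil_conv)
  then show ?thesis
    by (metis last_coeffs_eq_coeff_degree)
qed

lemma rev_coeffs_hd: "p \<noteq> 0 \<Longrightarrow> hd (rev (coeffs p)) = Polynomial.lead_coeff p"
  by (simp add: hd_rev last_coeffs_eq_coeff_degree)

lemma integral_closure_eq:
  fixes V :: "'k::field set"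
  assumes "0 \<in> V"
  shows "integral_closure ring_of_type_algebra V =
    {x. \<exists>p. Polynomial.lead_coeff p = 1 \<and> (\<forall>i. Polynomial.coeff p i \<in> V) \<and> poly p x = 0}"
proof (intro Set.set_eqI iffI)
  fix x :: 'k
  assume "x \<in> integral_closure ring_of_type_algebra V"
  then obtain p where p: "p \<in> carrier (univ_poly ring_of_type_algebra V)" "p \<noteq> []" "hd p = 1" "poly (Poly (rev p)) x = 0"
    by (auto simp: integral_closure_def type_algebra_simps eval_type_algebra)
  then have "set p \<subseteq> V"
    by (auto simp: univ_poly_carrier[symmetric] polynomial_def)
  then show "x \<in> {x. \<exists>p. Polynomial.lead_coeff p = 1 \<and> (\<forall>i. Polynomial.coeff p i \<in> V) \<and> poly p x = 0}"
    using p Poly_rev_lead_coeff[of p] coeff_Poly_rev_mem[of p V] assms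
    by (intro CollectI exI[of _ "Poly (rev p)"]) auto
next
  fix x :: 'k
  assume "x \<in> {x. \<exists>p. Polynomial.lead_coeff p = 1 \<and> (\<forall>i. Polynomial.coeff p i \<in> V) \<and> poly p x = 0}"
  then obtain p where p: "Polynomial.lead_coeff p = 1" "\<And>i. Polynomial.coeff p i \<in> V" "poly p x = 0"
    by blast
  then have p0: "p \<noteq> 0"
    by auto
  let ?q = "rev (coeffs p)"
  have "?q \<noteq> []" "hd ?q = 1"
    using p0 p(1) rev_coeffs_hd[OF p0] by auto
  moreover have "set ?q \<subseteq> V"
    using p(2) by (auto simp: coeffs_def)
  moreover have "poly (Poly (rev ?q)) x = 0"
    using p(3) by simp
  ultimately show "x \<in> integral_closure ring_of_type_algebra V"
    unfolding integral_closure_def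
    by (intro CollectI conjI bexI[of _ ?q])
      (auto simp: type_algebra_simps eval_type_algebra univ_poly_carrier[symmetric] polynomial_def)
qed

lemma (in cring) left_ideal_imp_ideal:
  assumes "left_ideal I R"
  shows "ideal I R"
proof -
  have "a \<otimes> x \<in> I" if "a \<in> I" "x \<in> carrier R" for a x
    using left_idealD(1,4)[OF assms] that m_comm[of a x] by auto
  then show ?thesis
    using assms ring_axioms
    by (intro ideal.intro ideal_axioms.intro) (auto simp: left_ideal_def)
qed

subsection \<open>Uniformizers\<close>

text \<open>\<pi> generates the unique maximal ideal. A nonzero nonunit has an irreducible divisor,
  which generates a maximal ideal, hence this one; so \<pi> divides every nonunit. Splitting off
  \<pi> must end because ideals are principal.\<close>

lemma dvr_uniformizer:
  fixes V :: "'k::field set"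
  assumes V: "subring V (ring_of_type_algebra :: 'k ring)" and dvr: "discrete_valuation_ring (ring_on V)"
  obtains \<pi> where "\<pi> \<in> V" "\<pi> \<noteq> 0" "inverse \<pi> \<notin> V"
    "\<And>x. \<lbrakk>x \<in> V; x \<noteq> 0\<rbrakk> \<Longrightarrow> \<exists>n u. u \<in> V \<and> inverse u \<in> V \<and> x = \<pi> ^ n * u"
proof -
  interpret R: principal_domain "ring_on V"
    using dvr by (simp add: discrete_valuation_ring_def)
  have not_field: "\<not> field (ring_on V)" and ex1: "\<exists>!M. maximalideal M (ring_on V)"
    using dvr by (simp_all add: discrete_valuation_ring_def)
  obtain M where M: "maximalideal M (ring_on V)"
    using ex1 by blast
  interpret M: maximalideal M "ring_on V"
    by (rule M)
  have V_one: "1 \<in> V" and V_mult: "\<And>x y. \<lbrakk>x \<in> V; y \<in> V\<rbrakk> \<Longrightarrow> x * y \<in> V"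
    using R.one_closed R.m_closed by (auto simp: ring_on_simps)
  have V_add: "\<And>x y. \<lbrakk>x \<in> V; y \<in> V\<rbrakk> \<Longrightarrow> x + y \<in> V"
    using R.a_closed by (auto simp: ring_on_simps)
  obtain \<pi> where \<pi>: "\<pi> \<in> V" "M = PIdl\<^bsub>ring_on V\<^esub> \<pi>"
    using R.exists_gen[OF M.is_ideal] by (auto simp: ring_on_simps)
  have M_eq: "M = {v * \<pi> | v. v \<in> V}"
    unfolding \<pi>(2) cgenideal_def by (auto simp: ring_on_simps)
  have "\<pi> \<noteq> 0"
  proof
    assume "\<pi> = 0"
    then have "M = {\<zero>\<^bsub>ring_on V\<^esub>}"
      using V_one by (auto simp: M_eq ring_on_simps)
    then show False
      using R.zeromaximalideal_fieldI M not_field by simp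
  qed
  have nonunit: "inverse \<pi> \<notin> V"
  proof
    assume "inverse \<pi> \<in> V"
    then have "\<one>\<^bsub>ring_on V\<^esub> \<in> M"
      using \<open>\<pi> \<noteq> 0\<close> unfolding M_eq by (auto simp: ring_on_simps intro!: exI[of _ "inverse \<pi>"])
    then show False
      using M.one_imp_carrier M.I_notcarr by blast
  qed
  have unit_or_div: "inverse x \<in> V \<or> (\<exists>y\<in>V. x = \<pi> * y)" if x: "x \<in> V" "x \<noteq> 0" for x
  proof (cases "x \<in> Units (ring_on V)")
    case True
    then obtain y where "y \<in> V" "x * y = 1"
      by (auto simp: Units_def ring_on_simps)
    then show ?thesis
      by (metis inverse_unique)
  next
    case False
    have xV: "x \<in> carrier (ring_on V) - {\<zero>\<^bsub>ring_on V\<^esub>}"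
      using x by (simp add: ring_on_simps)
    obtain b where bV: "b \<in> carrier (ring_on V)"
      and b: "ring_irreducible\<^bsub>ring_on V\<^esub> b" "b divides\<^bsub>ring_on V\<^esub> x"
      by (rule R.exists_irreducible_divisor[OF xV False])
    have "maximalideal (PIdl\<^bsub>ring_on V\<^esub> b) (ring_on V)"
      by (rule R.irreducible_imp_maximalideal[OF bV b(1)])
    then have "PIdl\<^bsub>ring_on V\<^esub> b = M"
      using ex1 M by blast
    moreover have "b \<in> PIdl\<^bsub>ring_on V\<^esub> b"
      by (rule R.cgenideal_self[OF bV])
    ultimately obtain v where v: "v \<in> V" "b = v * \<pi>"
      by (auto simp: M_eq)
    obtain c where "c \<in> V" "x = b * c"
      using b(2) by (auto simp: factor_def ring_on_simps)
    then have "x = \<pi> * (v * c)" "v * c \<in> V"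
      using v V_mult by (auto simp: algebra_simps)
    then show ?thesis
      by blast
  qed
  have "\<exists>n u. u \<in> V \<and> inverse u \<in> V \<and> x = \<pi> ^ n * u" if x: "x \<in> V" "x \<noteq> 0" for x
  proof (rule ccontr)
    assume no: "\<not> ?thesis"
    have ex: "\<exists>y\<in>V. x = \<pi> ^ n * y" for n
    proof (induction n)
      case (Suc n)
      then obtain y where y: "y \<in> V" "x = \<pi> ^ n * y"
        by blast
      then have "y \<noteq> 0" "inverse y \<notin> V"
        using no x(2) by auto
      then obtain z where "z \<in> V" "y = \<pi> * z"
        using unit_or_div[OF y(1)] by blast
      then show ?case
        using y(2) by (intro bexI[of _ z]) auto
    qed (use x in auto)
    \<comment> \<open>The union of the ascending ideals generated by x / \<pi>^n. Its generator d
      already belongs to one of them, and x / \<pi>^(n+1), being a multiple of d, then makes \<pi> a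
      unit.\<close>
    define I where "I = {y \<in> V. \<exists>n. \<exists>w\<in>V. y * \<pi> ^ n = x * w}"
    have \<pi>n: "\<pi> ^ n \<in> V" for n
      by (induction n) (auto intro: V_one V_mult \<pi>)
    have "left_ideal I (ring_on V)"
    proof (rule R.left_idealI)
      show "I \<subseteq> carrier (ring_on V)"
        by (auto simp: I_def ring_on_simps)
      show "\<zero>\<^bsub>ring_on V\<^esub> \<in> I"
        using R.zero_closed by (auto simp: I_def ring_on_simps intro!: bexI[of _ 0])
      show "y \<oplus>\<^bsub>ring_on V\<^esub> z \<in> I" if yz: "y \<in> I" "z \<in> I" for y z
      proof -
        obtain m n v w where *: "y \<in> V" "z \<in> V" "v \<in> V" "w \<in> V" "y * \<pi> ^ m = x * v" "z * \<pi> ^ n = x * w"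
          using yz by (auto simp: I_def)
        have "(y + z) * \<pi> ^ (m + n) = (y * \<pi> ^ m) * \<pi> ^ n + (z * \<pi> ^ n) * \<pi> ^ m"
          by (simp add: power_add algebra_simps)
        also have "\<dots> = x * (v * \<pi> ^ n + w * \<pi> ^ m)"
          by (simp add: *(5,6) algebra_simps)
        finally show ?thesis
          using * V_add V_mult[OF _ \<pi>n] unfolding I_def ring_on_simps by blast
      qed
      show "r \<otimes>\<^bsub>ring_on V\<^esub> y \<in> I" if ry: "r \<in> carrier (ring_on V)" "y \<in> I" for r y
      proof -
        obtain n w where *: "r \<in> V" "y \<in> V" "w \<in> V" "y * \<pi> ^ n = x * w"
          using ry by (auto simp: I_def ring_on_simps)
        have "(r * y) * \<pi> ^ n = x * (r * w)"
          using *(4) by (simp add: algebra_simps)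
        then show ?thesis
          using * V_mult unfolding I_def ring_on_simps by blast
      qed
    qed
    then obtain d where "d \<in> V" "I = PIdl\<^bsub>ring_on V\<^esub> d"
      using R.exists_gen[OF R.left_ideal_imp_ideal] by (auto simp: ring_on_simps)
    then have I_eq: "I = {v * d | v. v \<in> V}"
      unfolding cgenideal_def by (auto simp: ring_on_simps)
    then have "d \<in> I"
      using V_one by force
    then obtain n w where w: "w \<in> V" "d * \<pi> ^ n = x * w"
      by (auto simp: I_def)
    obtain y where y: "y \<in> V" "x = \<pi> ^ Suc n * y"
      using ex by blast
    have "y * \<pi> ^ Suc n = x * 1"
      using y(2) by (simp add: algebra_simps)
    then have "y \<in> I"
      using y(1) V_one unfolding I_def by blast
    then obtain v where v: "v \<in> V" "y = v * d"
      by (auto simp: I_eq)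
    have "d \<noteq> 0"
      using v(2) y(2) x(2) by auto
    have "d * \<pi> ^ n * 1 = d * \<pi> ^ n * (\<pi> * (v * w))"
      using w(2) y(2) v(2) by (simp add: algebra_simps)
    then have "\<pi> * (v * w) = 1"
      using \<open>d \<noteq> 0\<close> \<open>\<pi> \<noteq> 0\<close> by simp
    then have "inverse \<pi> = v * w"
      by (rule inverse_unique)
    then show False
      using nonunit V_mult[OF v(1) w(1)] by simp
  qed
  then show ?thesis
    using that \<pi>(1) \<open>\<pi> \<noteq> 0\<close> nonunit by blast
qed

subsection \<open>Galois groups\<close>

lemma GalD:
  assumes "\<sigma> \<in> Gal F"
  shows "bij \<sigma>" "\<sigma> (x + y) = \<sigma> x + \<sigma> y" "\<sigma> (x * y) = \<sigma> x * \<sigma> y" "\<sigma> 1 = 1" "c \<in> F \<Longrightarrow> \<sigma> c = c"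
  using assms by (auto simp: Gal_def ring_iso_def ring_hom_def type_algebra_simps)

lemma GalI:
  assumes "bij \<sigma>" "\<And>x y. \<sigma> (x + y) = \<sigma> x + \<sigma> y" "\<And>x y. \<sigma> (x * y) = \<sigma> x * \<sigma> y" "\<sigma> 1 = 1"
    "\<And>c. c \<in> F \<Longrightarrow> \<sigma> c = c"
  shows "\<sigma> \<in> Gal F"
  using assms by (auto simp: Gal_def ring_iso_def ring_hom_def type_algebra_simps)

lemma id_in_Gal: "id \<in> Gal F"
  by (rule GalI) auto

lemma comp_in_Gal:
  assumes "\<sigma> \<in> Gal F" "\<tau> \<in> Gal F"
  shows "\<sigma> \<circ> \<tau> \<in> Gal F"
  using GalD[OF assms(1)] GalD[OF assms(2)] by (intro GalI) (auto intro: bij_comp)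

lemma inv_in_Gal:
  assumes "\<sigma> \<in> Gal F"
  shows "finv \<sigma> \<in> Gal F"
proof -
  note \<sigma> = GalD[OF assms]
  have cancel: "finv \<sigma> (\<sigma> x) = x" "\<sigma> (finv \<sigma> x) = x" for x
    using \<sigma>(1) by (simp_all add: bij_is_inj bij_is_surj surj_f_inv_f)
  show ?thesis
  proof (rule GalI)
    show "bij (finv \<sigma>)"
      using \<sigma>(1) by (rule bij_imp_bij_inv)
    show "finv \<sigma> (x + y) = finv \<sigma> x + finv \<sigma> y" for x y
      using cancel(1)[of "finv \<sigma> x + finv \<sigma> y"] by (simp add: \<sigma>(2) cancel(2))
    show "finv \<sigma> (x * y) = finv \<sigma> x * finv \<sigma> y" for x y
      using cancel(1)[of "finv \<sigma> x * finv \<sigma> y"] by (simp add: \<sigma>(3) cancel(2))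
    show "finv \<sigma> 1 = 1"
      using cancel(1)[of 1] by (simp add: \<sigma>(4))
    show "finv \<sigma> c = c" if "c \<in> F" for c
      using cancel(1)[of c] by (simp add: \<sigma>(5)[OF that])
  qed
qed

text \<open>An automorphism is determined by its values on a finite spanning list, and each value is
  a root of a fixed nonzero polynomial over F.\<close>

lemma finite_Gal:
  fixes F :: "'k::field set"
  assumes "finite_galois F"
  shows "finite (Gal F)"
proof -
  interpret K: field "ring_of_type_algebra :: 'k ring"
    by (rule field_from_type_algebra)
  have sf: "subfield F (ring_of_type_algebra :: 'k ring)" and fd: "K.finite_dimension F UNIV"
    using assms by (simp_all add: finite_galois_def)
  have F0: "0 \<in> F"
    using subringE(2)[OF subfieldE(1)[OF sf]] by (simp add: type_algebra_simps)
  obtain n where n: "K.dimension n F UNIV"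
    using fd by (auto simp: K.finite_dimension_def)
  obtain Us where Us: "K.Span F Us = UNIV"
    using K.exists_base[OF sf n] by blast
  have "\<exists>p. p \<noteq> 0 \<and> (\<forall>i. Polynomial.coeff p i \<in> F) \<and> poly p u = 0" for u
  proof -
    have "subring (UNIV :: 'k set) ring_of_type_algebra"
      using K.carrier_is_subring by (simp add: type_algebra_simps)
    then have "\<not> K.transcendental F u"
      using K.finite_dimension_imp_algebraic[OF sf _ fd] by (simp add: over_def)
    then obtain p where p: "p \<in> carrier (univ_poly ring_of_type_algebra F)" "p \<noteq> []" "K.eval p u = 0"
      using K.algebraicE[OF subfieldE(1)[OF sf], of u] by (auto simp: type_algebra_simps over_def)
    then have pF: "set p \<subseteq> F" "hd p \<noteq> 0"
      by (auto simp: univ_poly_carrier[symmetric] polynomial_def type_algebra_simps)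
    then have "Poly (rev p) \<noteq> 0"
      using Poly_rev_lead_coeff[OF p(2)] by (metis leading_coeff_0_iff)
    then show ?thesis
      using p(3) coeff_Poly_rev_mem[OF pF(1) F0] unfolding eval_type_algebra by blast
  qed
  then obtain p where p: "\<And>u. p u \<noteq> 0" "\<And>u i. Polynomial.coeff (p u) i \<in> F" "\<And>u. poly (p u) u = 0"
    by metis
  define A where "A = (\<Union>u\<in>set Us. {y. poly (p u) y = 0})"
  have "finite A"
    unfolding A_def using p(1) poly_roots_finite by blast
  have zero: "\<sigma> 0 = 0" if "\<sigma> \<in> Gal F" for \<sigma>
    using GalD(5)[OF that F0] .
  have root: "poly (p u) (\<sigma> u) = 0" if \<sigma>: "\<sigma> \<in> Gal F" for \<sigma> u
  proof -
    have sum: "\<sigma> (sum g I) = (\<Sum>i\<in>I. \<sigma> (g i))" for g and I :: "nat set"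
      by (induction I rule: infinite_finite_induct) (simp_all add: zero[OF \<sigma>] GalD(2)[OF \<sigma>])
    have pow: "\<sigma> (u ^ n) = \<sigma> u ^ n" for n
      by (induction n) (simp_all add: GalD(3,4)[OF \<sigma>])
    have "\<sigma> (poly (p u) u) = poly (p u) (\<sigma> u)"
      unfolding poly_altdef by (simp add: sum pow GalD(3)[OF \<sigma>] GalD(5)[OF \<sigma> p(2)])
    then show ?thesis
      using p(3) zero[OF \<sigma>] by simp
  qed
  have inj: "inj_on (\<lambda>\<sigma>. map \<sigma> Us) (Gal F)"
  proof (rule inj_onI)
    fix \<sigma> \<tau>
    assume \<sigma>: "\<sigma> \<in> Gal F" and \<tau>: "\<tau> \<in> Gal F" and eq: "map \<sigma> Us = map \<tau> Us"
    have "K.Span F Us \<subseteq> {x. \<sigma> x = \<tau> x}"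
      by (rule K.Span_subset_submodule[OF subfieldE(1)[OF sf]])
        (use eq GalD[OF \<sigma>] GalD[OF \<tau>] zero[OF \<sigma>] zero[OF \<tau>] in \<open>auto simp: type_algebra_simps\<close>)
    then show "\<sigma> = \<tau>"
      using Us by auto
  qed
  have "(\<lambda>\<sigma>. map \<sigma> Us) ` Gal F \<subseteq> {xs. set xs \<subseteq> A \<and> length xs = length Us}"
    using root unfolding A_def by fastforce
  then have "finite ((\<lambda>\<sigma>. map \<sigma> Us) ` Gal F)"
    using finite_lists_length_eq[OF \<open>finite A\<close>] finite_subset by blast
  then show ?thesis
    using inj by (rule finite_imageD)
qed

subsection \<open>Ideals of the integral closure\<close>

context dvr_galois
begin

lemma cring_S: "cring (ring_on S)"
proof -
  interpret K: field "ring_of_type_algebra :: 'k ring"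
    by (rule field_from_type_algebra)
  have "subring S ring_of_type_algebra"
    by (rule K.subringI)
      (auto simp: a_inv_type_algebra S_minus,
        auto simp: type_algebra_simps S_one S_add S_mult)
  then show ?thesis
    using K.subcringI' K.subcring_iff[of S] by (simp add: type_algebra_simps)
qed

lemma ideal_iff_idl: "ideal I (ring_on S) \<longleftrightarrow> idl I"
proof
  interpret R: cring "ring_on S"
    by (rule cring_S)
  show "idl I" if "ideal I (ring_on S)"
  proof -
    interpret I: ideal I "ring_on S"
      by (rule that)
    show ?thesis
      using I.Icarr I.zero_closed I.a_closed I.I_l_closed
      by (intro idlI) (auto simp: ring_on_simps)
  qed
  show "ideal I (ring_on S)" if "idl I"
    by (rule R.left_ideal_imp_ideal[OF R.left_idealI])
      (use idlD[OF that] in \<open>auto simp: ring_on_simps\<close>)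
qed

lemma maximalideal_iff_maxidl: "maximalideal M (ring_on S) \<longleftrightarrow> maxidl M"
proof
  interpret R: cring "ring_on S"
    by (rule cring_S)
  have carr: "J = S" if "idl J" "1 \<in> J" for J
    using idlD(1,5)[OF that(1)] that(2) by (metis mult_1 subsetI subset_antisym)
  show "maxidl M" if "maximalideal M (ring_on S)"
  proof -
    interpret M: maximalideal M "ring_on S"
      by (rule that)
    have M: "idl M"
      using M.is_ideal by (simp add: ideal_iff_idl)
    have "1 \<notin> M"
      using carr[OF M] M.I_notcarr by (auto simp: ring_on_simps)
    moreover have "J = M" if J: "idl J" "M \<subseteq> J" "1 \<notin> J" for J
      using M.I_maximal[of J] J idlD(1)[OF J(1)] S_one by (auto simp: ring_on_simps ideal_iff_idl)
    ultimately show ?thesis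
      using M by (auto simp: maxidl_def)
  qed
  show "maximalideal M (ring_on S)" if M: "maxidl M"
  proof (rule maximalidealI)
    show "ideal M (ring_on S)"
      using M maxidl_idl by (simp add: ideal_iff_idl)
    show "carrier (ring_on S) \<noteq> M"
      using maxidl_one[OF M] S_one by (auto simp: ring_on_simps)
    show "J = M \<or> J = carrier (ring_on S)" if "ideal J (ring_on S)" "M \<subseteq> J" "J \<subseteq> carrier (ring_on S)" for J
      using that M carr[of J] by (auto simp: ideal_iff_idl maxidl_def ring_on_simps)
  qed
qed

lemma ideal_prod_eq_idp: "ideal_prod (ring_on S) I J = idp I J"
proof (intro Set.set_eqI iffI)
  fix x
  show "x \<in> idp I J" if "x \<in> ideal_prod (ring_on S) I J"
    using that by induction (auto simp: ring_on_simps intro: idp.intros)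
  show "x \<in> ideal_prod (ring_on S) I J" if "x \<in> idp I J"
    using that
  proof induction
    case (prod i j)
    then show ?case
      using ideal_prod.prod[of i I j J "ring_on S"] by (simp add: ring_on_simps)
  next
    case (sum x y)
    then show ?case
      using ideal_prod.sum[of x "ring_on S" I J y] by (simp add: ring_on_simps)
  qed
qed

lemma ideal_power_eq_idpow: "ideal_power (ring_on S) M n = idpow M n"
  by (induction n) (simp_all add: nat_pow_def ideals_set_def ideal_prod_eq_idp ring_on_simps)

text \<open>\<open>M \<inter> V\<close> consists of the V-multiples of \<pi>.\<close>

lemma genideal_subset_idpow_iff:
  assumes M: "maxidl M"
  shows "genideal (ring_on S) (M \<inter> V) \<subseteq> idpow M e \<longleftrightarrow> \<pi> \<in> idpow M e"
proof
  have "\<pi> \<in> genideal (ring_on S) (M \<inter> V)"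
    unfolding genideal_def using unif_in_maxidl[OF M] unif_in_V by blast
  then show "\<pi> \<in> idpow M e" if "genideal (ring_on S) (M \<inter> V) \<subseteq> idpow M e"
    using that by blast
  assume \<pi>: "\<pi> \<in> idpow M e"
  note I = idl_idpow[OF maxidl_idl[OF M], of e]
  have "M \<inter> V \<subseteq> idpow M e"
    using maxidl_V[OF M] idlD(5)[OF I V_in_S \<pi>] by blast
  moreover have "ideal (idpow M e) (ring_on S)"
    using I by (simp add: ideal_iff_idl)
  ultimately show "genideal (ring_on S) (M \<inter> V) \<subseteq> idpow M e"
    unfolding genideal_def by blast
qed

text \<open>\<open>idpow_bounded\<close> bounds the admissible exponents, so that
  \<open>GREATEST\<close> really is their maximum.\<close>

lemma ramification_index_one:
  assumes M: "maxidl M" and ram: "ramification_index (ring_on S) V M = 1"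
  shows "\<pi> \<notin> idpow M 2"
proof
  assume *: "\<pi> \<in> idpow M 2"
  obtain k where k: "\<pi> \<notin> idpow M k"
    using idpow_bounded[OF M] by blast
  have bound: "e \<le> k" if "\<pi> \<in> idpow M e" for e
    using idpow_antimono[OF maxidl_idl[OF M], of k e] that k by (meson nat_le_linear subsetD)
  have "(GREATEST e. \<pi> \<in> idpow M e) \<ge> 2"
    using Greatest_le_nat[of "\<lambda>e. \<pi> \<in> idpow M e", OF * bound] .
  then show False
    using ram by (simp add: ramification_index_def genideal_subset_idpow_iff[OF M] ideal_power_eq_idpow)
qed

lemma unit_in_V:
  assumes M: "maxidl M" and v: "v \<in> V" "v \<notin> M"
  shows "inverse v \<in> V"
proof -
  have "v \<noteq> 0"
    using v(2) idlD(2)[OF maxidl_idl[OF M]] by blast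
  then obtain n u where nu: "u \<in> V" "inverse u \<in> V" "v = \<pi> ^ n * u"
    using V_cases v(1) by blast
  have "n = 0"
  proof (rule ccontr)
    assume "n \<noteq> 0"
    then have "v = (\<pi> ^ (n - 1) * u) * \<pi>"
      using nu(3) by (cases n) auto
    then show False
      using v(2) idlD(4)[OF maxidl_idl[OF M] V_in_S unif_in_maxidl[OF M]] V_mult[OF unif_power_in_V nu(1)]
      by metis
  qed
  then show ?thesis
    using nu by simp
qed

lemma poly_pderiv_Poly_rev:
  "pderiv (Poly (rev vs)) = Poly (rev (map (\<lambda>i. of_nat (length vs - 1 - i) * vs ! i) [0..<length vs - 1]))"
  (is "_ = Poly (rev ?q)")
proof (rule poly_eqI)
  fix i
  show "Polynomial.coeff (pderiv (Poly (rev vs))) i = Polynomial.coeff (Poly (rev ?q)) i"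
  proof (cases "Suc i < length vs")
    case True
    then have "rev ?q ! i = ?q ! (length vs - 1 - Suc i)"
      by (subst rev_nth) auto
    also have "\<dots> = of_nat (Suc i) * vs ! (length vs - Suc (Suc i))"
      using True by (subst nth_map) (auto simp: Suc_diff_Suc)
    finally show ?thesis
      using True by (simp add: coeff_pderiv coeff_Poly_eq nth_default_def rev_nth)
  next
    case False
    then show ?thesis
      by (simp add: coeff_pderiv coeff_Poly_eq nth_default_def)
  qed
qed

text \<open>Lift the minimal polynomial of the residue of x coefficientwise to V. The Bezout
  relation between it and its derivative, evaluated at that residue, shows that the derivative does
  not vanish there.\<close>

lemma separable_residue:
  assumes M: "maxidl M" and sep: "separable_extension (ring_on S Quot M) ((\<lambda>v. M +>\<^bsub>ring_on S\<^esub> v) ` V)"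
    and x: "x \<in> S"
  shows "\<exists>g. (\<forall>i. Polynomial.coeff g i \<in> V) \<and> poly g x \<in> M \<and> poly (pderiv g) x \<notin> M"
proof -
  let ?R = "ring_on S" and ?L = "ring_on S Quot M" and ?h = "\<lambda>v. M +>\<^bsub>ring_on S\<^esub> v"
  let ?k = "?h ` V"
  interpret R: cring ?R
    by (rule cring_S)
  interpret M: maximalideal M ?R
    using M by (simp add: maximalideal_iff_maxidl)
  interpret L: field ?L
    by (rule M.quotient_is_field[OF cring_S])
  interpret h: ring_hom_ring ?R ?L ?h
    by (rule M.rcos_ring_hom_ring)
  have h_zero: "?h s = \<zero>\<^bsub>?L\<^esub> \<longleftrightarrow> s \<in> M" if "s \<in> S" for s
    using M.a_rcos_const R.a_rcos_zero[OF M.is_ideal] M.rcos_const_imp_mem[of s] that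
    by (auto simp: FactRing_def ring_on_simps)
  have V_S: "V \<subseteq> S"
    using V_in_S by blast
  have h_one: "?h 1 = \<one>\<^bsub>?L\<^esub>"
    using h.hom_one by (simp add: ring_on_simps)
  have h_mult: "?h (a * b) = ?h a \<otimes>\<^bsub>?L\<^esub> ?h b" if "a \<in> S" "b \<in> S" for a b
    using h.hom_mult[of a b] that by (simp add: ring_on_simps)
  have h_add: "?h (a + b) = ?h a \<oplus>\<^bsub>?L\<^esub> ?h b" if "a \<in> S" "b \<in> S" for a b
    using h.hom_add[of a b] that by (simp add: ring_on_simps)
  have subring_V': "subring V ?R"
    by (rule R.ring_incl_imp_subring) (use V_S subring_V in \<open>auto simp: ring_on_simps intro: ring.subring_is_ring[OF ring_from_type_algebra]\<close>)
  have k: "subfield ?k ?L"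
  proof (rule L.subfieldI')
    show "subring ?k ?L"
      by (rule h.img_is_subring[OF subring_V'])
    fix a
    assume "a \<in> ?k - {\<zero>\<^bsub>?L\<^esub>}"
    then obtain v where v: "v \<in> V" "a = ?h v" "v \<notin> M"
      using h_zero V_S by auto
    have iv: "inverse v \<in> V"
      by (rule unit_in_V[OF M v(1,3)])
    have "v \<noteq> 0"
      using v(3) idlD(2)[OF maxidl_idl[OF M]] by blast
    then have "?h v \<otimes>\<^bsub>?L\<^esub> ?h (inverse v) = \<one>\<^bsub>?L\<^esub>"
      using h_mult[of v "inverse v"] v(1) iv V_S h_one by auto
    then have "inv\<^bsub>?L\<^esub> a = ?h (inverse v)"
      using v(1,2) iv V_S h.hom_closed by (intro L.comm_inv_char) (auto simp: ring_on_simps)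
    then show "inv\<^bsub>?L\<^esub> a \<in> ?k"
      using iv by blast
  qed
  have xL: "?h x \<in> carrier ?L"
    using h.hom_closed x by (simp add: ring_on_simps)
  let ?p = "L.Irr ?k (?h x)"
  have alg: "\<not> L.transcendental ?k (?h x)" and sep_p: "separable_poly ?L ?k ?p"
    using sep xL by (auto simp: separable_extension_def)
  have p: "?p \<in> carrier (univ_poly ?L ?k)" "L.eval ?p (?h x) = \<zero>\<^bsub>?L\<^esub>"
    using L.IrrE[OF k xL] alg by (auto simp: over_def)
  have kL: "?k \<subseteq> carrier ?L"
    using subringE(1)[OF subfieldE(1)[OF k]] .
  have carr: "set q \<subseteq> carrier ?L" if "q \<in> carrier (univ_poly ?L ?k)" for q
    using that kL L.polynomial_incl[of ?k q] unfolding univ_poly_carrier[symmetric] by blast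
  have pk: "set ?p \<subseteq> ?k"
    using p(1) L.polynomial_incl[of ?k ?p] unfolding univ_poly_carrier[symmetric] by blast
  have "?p \<in> map ?h ` lists V"
    unfolding lists_image[symmetric] by (rule in_lists_conv_set[THEN iffD2]) (use pk in blast)
  then obtain vs where vs: "set vs \<subseteq> V" "?p = map ?h vs"
    by blast
  have eval_h: "?h (poly (Poly (rev ws)) x) = L.eval (map ?h ws) (?h x)" if "set ws \<subseteq> S" for ws
    using h.eval_hom'[of x ws] that x eval_eq_poly[OF R.ring_axioms, of ws x] by (simp add: ring_on_simps)
  have poly_S: "poly (Poly (rev ws)) x \<in> S" if "set ws \<subseteq> S" for ws
    unfolding poly_altdef using coeff_Poly_rev_mem[OF that S_zero] x by (intro S_sum S_mult S_power) auto
  define ws where "ws = map (\<lambda>i. of_nat (length vs - 1 - i) * vs ! i) [0..<length vs - 1]"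
  have vS: "set vs \<subseteq> S"
    using vs(1) V_S by blast
  have "of_nat m * vs ! i \<in> S" if "i < length vs" for m i
    by (rule S_mult[OF V_in_S[OF V_of_nat]]) (use vS that nth_mem in blast)
  then have ws: "set ws \<subseteq> S"
    by (auto simp: ws_def simp del: of_nat_diff)
  have "Poly (rev ws) = pderiv (Poly (rev vs))"
    by (simp add: poly_pderiv_Poly_rev ws_def)
  have h_of_nat: "?h (of_nat m * s) = add_pow ?L m (?h s)" if s: "s \<in> S" for m s
  proof (induction m)
    case 0
    then show ?case
      using h_zero[OF S_zero] idlD(2)[OF maxidl_idl[OF M]] by simp
  next
    case (Suc m)
    have "?h (of_nat (Suc m) * s) = ?h (of_nat m * s + s)"
      by (simp add: algebra_simps)
    then show ?case
      using h_add[of "of_nat m * s" s] s V_in_S[OF V_of_nat] S_mult Suc by simp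
  qed
  \<comment> \<open>In positive characteristic leading coefficients of the derivative may vanish
    modulo M. The normalization strips them, which does not affect evaluation.\<close>
  have fd: "formal_derivative ?L ?p = L.normalize (map ?h ws)"
    unfolding formal_derivative_def vs(2) ws_def map_map length_map
  proof (intro arg_cong[where f = L.normalize] map_cong refl)
    fix i
    assume "i \<in> set [0..<length vs - 1]"
    then have i: "i < length vs"
      by simp
    then have "vs ! i \<in> S"
      using vS nth_mem by blast
    from h_of_nat[OF this, of "length vs - 1 - i"] i
    show "add_pow ?L (length vs - 1 - i) (map ?h vs ! i) = (?h \<circ> (\<lambda>i. of_nat (length vs - 1 - i) * vs ! i)) i"
      by (simp only: nth_map comp_apply)
  qed
  have hws: "set (map ?h ws) \<subseteq> carrier ?L"
    using ws h.hom_closed by (auto simp: ring_on_simps)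
  obtain a b where ab: "a \<in> carrier (univ_poly ?L ?k)" "b \<in> carrier (univ_poly ?L ?k)"
    "L.poly_add (L.poly_mult a ?p) (L.poly_mult b (formal_derivative ?L ?p)) = [\<one>\<^bsub>?L\<^esub>]"
    using sep_p by (auto simp: separable_poly_def univ_poly_mult univ_poly_add univ_poly_one)
  let ?e = "\<lambda>q. L.eval q (?h x)"
  have fdc: "set (formal_derivative ?L ?p) \<subseteq> carrier ?L"
    unfolding fd by (rule L.normalize_in_carrier[OF hws])
  have "\<one>\<^bsub>?L\<^esub> = ?e [\<one>\<^bsub>?L\<^esub>]"
    using xL by simp
  also have "\<dots> = ?e (L.poly_mult a ?p) \<oplus>\<^bsub>?L\<^esub> ?e (L.poly_mult b (formal_derivative ?L ?p))"
    unfolding ab(3)[symmetric]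
    by (rule L.eval_poly_add) (use xL L.poly_mult_in_carrier carr[OF ab(1)] carr[OF ab(2)] carr[OF p(1)] fdc in auto)
  also have "\<dots> = ?e a \<otimes>\<^bsub>?L\<^esub> ?e ?p \<oplus>\<^bsub>?L\<^esub> ?e b \<otimes>\<^bsub>?L\<^esub> ?e (formal_derivative ?L ?p)"
    using L.eval_poly_mult[OF carr[OF ab(1)] carr[OF p(1)] xL] L.eval_poly_mult[OF carr[OF ab(2)] fdc xL] by simp
  also have "?e (formal_derivative ?L ?p) = ?e (map ?h ws)"
    unfolding fd by (rule L.eval_normalize[OF hws xL])
  also have "\<dots> = ?h (poly (pderiv (Poly (rev vs))) x)"
    using eval_h[OF ws] \<open>Poly (rev ws) = _\<close> by simp
  finally have one: "\<one>\<^bsub>?L\<^esub> = ?e a \<otimes>\<^bsub>?L\<^esub> \<zero>\<^bsub>?L\<^esub> \<oplus>\<^bsub>?L\<^esub> ?e b \<otimes>\<^bsub>?L\<^esub> ?h (poly (pderiv (Poly (rev vs))) x)"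
    unfolding p(2) .
  have "poly (pderiv (Poly (rev vs))) x \<notin> M"
  proof
    assume *: "poly (pderiv (Poly (rev vs))) x \<in> M"
    have "?h (poly (pderiv (Poly (rev vs))) x) = \<zero>\<^bsub>?L\<^esub>"
      using * h_zero idlD(1)[OF maxidl_idl[OF M]] by blast
    then show False
      using one L.eval_in_carrier[OF carr[OF ab(1)] xL] L.eval_in_carrier[OF carr[OF ab(2)] xL] L.one_not_zero
      by simp
  qed
  moreover have "poly (Poly (rev vs)) x \<in> M"
    using eval_h[OF vS] p(2) vs(2) h_zero[OF poly_S[OF vS]] by simp
  moreover have "Polynomial.coeff (Poly (rev vs)) i \<in> V" for i
    by (rule coeff_Poly_rev_mem[OF vs(1) V_zero])
  ultimately show ?thesis
    by blast
qed

end

theorem corollary3: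
  fixes V F S :: "'k::field set"
    and G :: "('k \<Rightarrow> 'k) set"
    and f :: "('k \<Rightarrow> 'k) \<Rightarrow> ('k \<Rightarrow> 'k) \<Rightarrow> 'k"
  assumes "subring V (ring_of_type_algebra :: 'k ring)"
    and "discrete_valuation_ring (ring_on V)"
    and "F = quotient_field V"
    and "finite_galois F"
    and "G = Gal F"
    and "S = integral_closure ring_of_type_algebra V"
    and "unramified (ring_on S) V"
    and "normalized_cocycle G f"
    and "\<And>\<sigma> \<tau>. \<sigma> \<in> G \<Longrightarrow> \<tau> \<in> G \<Longrightarrow> f \<sigma> \<tau> \<in> S - {0}"
    and "primary ((crossed_product G f)\<lparr>carrier := crossed_product_order G f S\<rparr>)"
  shows "maximal_order (crossed_product G f) (cp_scalar ` V) (cp_scalar ` F)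
            (crossed_product_order G f S)
      \<longleftrightarrow> (\<exists>M. maximalideal M (ring_on S) \<and>
            (\<forall>\<tau> \<in> decomposition_group G M.
                f \<tau> (inv_into UNIV \<tau>) \<notin> ideal_power (ring_on S) M 2))"
proof -
  obtain \<pi> where \<pi>: "\<pi> \<in> V" "\<pi> \<noteq> 0" "inverse \<pi> \<notin> V"
    "\<And>x. \<lbrakk>x \<in> V; x \<noteq> 0\<rbrakk> \<Longrightarrow> \<exists>n u. u \<in> V \<and> inverse u \<in> V \<and> x = \<pi> ^ n * u"
    using dvr_uniformizer[OF assms(1,2)] by blast
  have V: "1 \<in> V" "\<And>x y. \<lbrakk>x \<in> V; y \<in> V\<rbrakk> \<Longrightarrow> x * y \<in> V" "\<And>x y. \<lbrakk>x \<in> V; y \<in> V\<rbrakk> \<Longrightarrow> x + y \<in> V"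
    "\<And>x. x \<in> V \<Longrightarrow> - x \<in> V"
    using subringE(3,5,6,7)[OF assms(1)] by (auto simp: a_inv_type_algebra type_algebra_simps)
  have fixed: "{x. \<forall>\<sigma>\<in>G. \<sigma> x = x} = F"
    using assms(4) by (simp add: finite_galois_def assms(5))
  interpret dvr_galois V \<pi> G
  proof
    show "x - y \<in> V" if "x \<in> V" "y \<in> V" for x y
      using V(3)[OF that(1) V(4)[OF that(2)]] by simp
    show "(\<forall>\<sigma>\<in>G. \<sigma> x = x) \<longleftrightarrow> (\<exists>a\<in>V. \<exists>b\<in>V. b \<noteq> 0 \<and> x = a / b)" for x
      using fixed unfolding assms(3) quotient_field_def by blast
  qed (use V \<pi> finite_Gal[OF assms(4)] id_in_Gal comp_in_Gal inv_in_Gal GalD(1,2,3) in \<open>auto simp: assms(5)\<close>)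
  have S_eq: "S = dvr_galois.S V"
    unfolding assms(6) integral_closure_eq[OF V_zero] S_def ..
  have F_eq: "F = dvr_galois.F G"
    using fixed by (simp add: F_def)
  have unr: "ramification_index (ring_on S) V M = 1"
    "separable_extension (ring_on S Quot M) ((\<lambda>v. M +>\<^bsub>ring_on S\<^esub> v) ` V)" if "maxidl M" for M
    using assms(7) that by (auto simp: unramified_def maximalideal_iff_maxidl S_eq)
  \<comment> \<open>The unramified hypothesis enters here: \<open>P_eq_piS\<close> and
    \<open>separable_residue\<close>, proved under the first interpretation, turn ramification index
    and residue separability into the two remaining conditions on S.\<close>
  interpret crossed V \<pi> G f
  proof
    show "P = piS"
      by (rule P_eq_piS) (use unr(1) ramification_index_one in \<open>auto simp: S_eq\<close>)
    show "\<exists>g. (\<forall>i. Polynomial.coeff g i \<in> V) \<and> poly g x \<in> M \<and> poly (pderiv g) x \<notin> M"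
      if "maxidl M" "x \<in> dvr_galois.S V" for M x
      using separable_residue[OF that(1) _ that(2)] unr(2)[OF that(1)] by (simp add: S_eq)
  qed (use assms(8,9) in \<open>auto simp: normalized_cocycle_def S_eq\<close>)
  show ?thesis
    using maximal_order_iff assms(10)
    by (simp add: S_eq F_eq maximalideal_iff_maxidl ideal_power_eq_idpow decomposition_group_def Ball_def imp_conjL)
qed

end
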